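(* Let $\omega=(\tilde\omega,\omega_d)\in\mathbb R^d$, $d\geq3$, be non-resonant with $\tilde\omega\in\mathbb R^{d-1}$ such that there is a sequence $\{\bar k_j\}\subset\mathbb Z^{d-1}$ with $\lim_{j\to\infty}\frac{\ln|\langle\tilde\omega,\bar k_j\rangle|}{\|\bar k_j\|}=-\infty$. There exists a real entire Hamiltonian $H$ on $\mathbb{T}^d\times\mathbb R^d$ of the form $H(\theta,r)=\langle\omega,r\rangle+\mathcal O(r^2)$ such that: (i) there exists a real analytic symplectic diffeomorphism $\Psi$ of $M^-=\mathbb{T}^d\times\mathbb R^{d-1}\times(-\infty,0)$ onto itself with $H\circ\Psi=H_0$ on $M^-$, where $H_0(\theta,r)=\langle\omega,r\rangle$; (ii) for every $(\theta,r)\in\mathbb{T}^d\times\mathbb R^{d-1}\times(0,\infty)$, $\limsup_{t\to\infty}|\Phi^t_H(\theta,r)|=\infty$. Moreover the Birkhoff normal form of $H$ at $\mathcal{T}_0=\mathbb{T}^d\times\{0\}$ is $N(r)=\langle\omega,r\rangle$.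
   Context: $\|k\|=\max_m|k_m|$; non-resonant means rationally independent coordinates. Real entire: extends holomorphically to $(\mathbb C/\mathbb Z)^d\times\mathbb C^d$, real on real arguments. $\Phi^t_H$ is the Hamiltonian flow for $d\theta\wedge dr$; $|\Phi^t_H(\theta,r)|$ refers to the size of the action component. Birkhoff normal form: formal power series $N_H(r)$ such that some formal series $f(\theta,r)=\sum_j a_j(\theta)r^j=\mathcal O(r^2)$ with coefficients real analytic near $\mathbb{T}^d$ satisfies $H(\theta,r+\partial_\theta f(\theta,r))=N_H(r)$. *)

theory Defs
  imports "HOL-Analysis.Analysis" "HOL-Library.Liminf_Limsup"
begin

text \<open>Phase space: the torus T^d x R^d is represented through its universal
cover R^d x R^d (angles lifted); functions on T^d x R^d are functions on the
cover that are 1-periodic in every angle variable.\<close>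

definition int_vec :: "real^'d \<Rightarrow> bool" where
  "int_vec k \<longleftrightarrow> (\<forall>i. k $ i \<in> \<int>)"

definition non_resonant :: "real^'d \<Rightarrow> bool" where
  "non_resonant w \<longleftrightarrow> (\<forall>k. int_vec k \<longrightarrow> w \<bullet> k = 0 \<longrightarrow> k = 0)"

definition xmon :: "real^('n::finite) \<Rightarrow> ('n \<Rightarrow> nat) \<Rightarrow> real" where
  "xmon x \<alpha> = (\<Prod>i\<in>UNIV. (x $ i) ^ (\<alpha> i))"

definition mdeg :: "('n::finite \<Rightarrow> nat) \<Rightarrow> nat" where
  "mdeg \<alpha> = (\<Sum>i\<in>UNIV. \<alpha> i)"

definition real_analytic1 :: "(real^'n \<Rightarrow> real) \<Rightarrow> (real^'n) set \<Rightarrow> bool" where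
  "real_analytic1 f S \<longleftrightarrow> (\<forall>x0\<in>S. \<exists>e>0. \<exists>c::('n \<Rightarrow> nat) \<Rightarrow> real.
     \<forall>x. norm (x - x0) < e \<longrightarrow>
       (\<lambda>\<alpha>. \<bar>c \<alpha> * xmon (x - x0) \<alpha>\<bar>) summable_on UNIV \<and>
       ((\<lambda>\<alpha>. c \<alpha> * xmon (x - x0) \<alpha>) has_sum f x) UNIV)"

definition real_analytic2 :: "((real^'a) \<times> (real^'b) \<Rightarrow> real) \<Rightarrow> ((real^'a) \<times> (real^'b)) set \<Rightarrow> bool" where
  "real_analytic2 f S \<longleftrightarrow> (\<forall>p0\<in>S. \<exists>e>0. \<exists>c::('a \<Rightarrow> nat) \<times> ('b \<Rightarrow> nat) \<Rightarrow> real.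
     \<forall>p. norm (p - p0) < e \<longrightarrow>
       (\<lambda>(\<alpha>,\<beta>). \<bar>c (\<alpha>,\<beta>) * xmon (fst p - fst p0) \<alpha> * xmon (snd p - snd p0) \<beta>\<bar>)
          summable_on UNIV \<and>
       ((\<lambda>(\<alpha>,\<beta>). c (\<alpha>,\<beta>) * xmon (fst p - fst p0) \<alpha> * xmon (snd p - snd p0) \<beta>)
          has_sum f p) UNIV)"

text \<open>Real entire: given by a single real power series (centred at 0) converging
absolutely at every point; equivalently it extends holomorphically to all of
complex space and is real on real arguments.\<close>
definition real_entire2 :: "((real^'a) \<times> (real^'b) \<Rightarrow> real) \<Rightarrow> bool" where
  "real_entire2 f \<longleftrightarrow> (\<exists>c::('a \<Rightarrow> nat) \<times> ('b \<Rightarrow> nat) \<Rightarrow> real. \<forall>p.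
       (\<lambda>(\<alpha>,\<beta>). \<bar>c (\<alpha>,\<beta>) * xmon (fst p) \<alpha> * xmon (snd p) \<beta>\<bar>) summable_on UNIV \<and>
       ((\<lambda>(\<alpha>,\<beta>). c (\<alpha>,\<beta>) * xmon (fst p) \<alpha> * xmon (snd p) \<beta>) has_sum f p) UNIV)"

definition angle_periodic :: "((real^'d) \<times> (real^'d) \<Rightarrow> real) \<Rightarrow> bool" where
  "angle_periodic H \<longleftrightarrow> (\<forall>\<theta> r k. int_vec k \<longrightarrow> H (\<theta> + k, r) = H (\<theta>, r))"

definition periodic1 :: "(real^'d \<Rightarrow> real) \<Rightarrow> bool" where
  "periodic1 a \<longleftrightarrow> (\<forall>\<theta> k. int_vec k \<longrightarrow> a (\<theta> + k) = a \<theta>)"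

definition symp :: "(real^'d) \<times> (real^'d) \<Rightarrow> (real^'d) \<times> (real^'d) \<Rightarrow> real" where
  "symp u v = fst u \<bullet> snd v - snd u \<bullet> fst v"

text \<open>gamma is a forward solution (t >= 0) of Hamilton's equations for H w.r.t.
d theta /\ d r, i.e. gamma' = X_H(gamma) with symp X_H v = dH v, i.e.
theta' = dH/dr, r' = - dH/dtheta.\<close>
definition ham_solution :: "((real^'d) \<times> (real^'d) \<Rightarrow> real) \<Rightarrow> (real \<Rightarrow> (real^'d) \<times> (real^'d)) \<Rightarrow> bool" where
  "ham_solution H \<gamma> \<longleftrightarrow> (\<forall>t\<ge>0. \<exists>D X. (H has_derivative D) (at (\<gamma> t)) \<and>
      (\<gamma> has_vector_derivative X) (at t within {0..}) \<and> (\<forall>v. D v = symp X v))"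

definition grad1 :: "(real^'d \<Rightarrow> real) \<Rightarrow> real^'d \<Rightarrow> real^'d" where
  "grad1 a \<theta> = (\<chi> i. frechet_derivative a (at \<theta>) (axis i 1))"

text \<open>Birkhoff normal form at T_0 = T^d x {0}.  A formal series
N(r) = sum_alpha N alpha r^alpha is a Birkhoff normal form of H if there is a
formal series f(theta,r) = sum_alpha a_alpha(theta) r^alpha = O(r^2), with
coefficients real analytic (and periodic, i.e. functions on T^d), such that
H(theta, r + d_theta f(theta,r)) = N(r) as formal power series in r.  The
formal identity is written out order by order: for every n, substituting the
truncation of f at degree n, the difference agrees with 0 up to order n in r.\<close>
definition birkhoff_nf :: "((real^'d) \<times> (real^'d) \<Rightarrow> real) \<Rightarrow> (('d \<Rightarrow> nat) \<Rightarrow> real) \<Rightarrow> bool" where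
  "birkhoff_nf H N \<longleftrightarrow> (\<exists>a :: ('d \<Rightarrow> nat) \<Rightarrow> real^'d \<Rightarrow> real.
     (\<forall>\<alpha>. mdeg \<alpha> < 2 \<longrightarrow> a \<alpha> = (\<lambda>_. 0)) \<and>
     (\<forall>\<alpha>. real_analytic1 (a \<alpha>) UNIV \<and> periodic1 (a \<alpha>)) \<and>
     (\<forall>\<theta> n. \<exists>C>0. \<exists>\<delta>>0. \<forall>r. norm r < \<delta> \<longrightarrow>
        \<bar>H (\<theta>, r + (\<Sum>\<alpha>\<in>{\<alpha>. mdeg \<alpha> \<le> n}. xmon r \<alpha> *\<^sub>R grad1 (a \<alpha>) \<theta>))
          - (\<Sum>\<alpha>\<in>{\<alpha>. mdeg \<alpha> \<le> n}. N \<alpha> * xmon r \<alpha>)\<bar> \<le> C * norm r ^ (n + 1)))"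

definition lin_series :: "real^'d \<Rightarrow> ('d \<Rightarrow> nat) \<Rightarrow> real" where
  "lin_series w \<alpha> = (\<Sum>i\<in>UNIV. if \<alpha> = (\<lambda>j. if j = i then 1 else 0) then w $ i else 0)"

end

theory Submission
  imports Defs
begin

text \<open>
  Let \<open>k\<^sub>j\<close> be very sparse almost-resonances, \<open>\<lambda>\<^sub>j = \<langle>w, k\<^sub>j\<rangle>\<close>, and let
  \<open>g\<^sub>j(x) = x\<^sup>j\<^sup>+\<^sup>2 exp (B\<^sub>j x)\<close> with \<open>B\<^sub>j\<close> much larger than \<open>\<parallel>k\<^sub>j\<parallel>\<close> but much smaller than
  \<open>- ln \<bar>\<lambda>\<^sub>j\<bar>\<close>. With \<open>f(\<theta>, x) = \<Sum>\<^sub>j g\<^sub>j(x) sin (2 \<pi> \<langle>k\<^sub>j, \<theta>\<rangle>) / (2 \<pi>)\<close>, take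
  \<open>H(\<theta>, r) = \<langle>w, r\<rangle> - \<partial>\<^sub>w f(\<theta>, r\<^sub>l)\<close>: the small divisors \<open>\<lambda>\<^sub>j\<close> that \<open>\<partial>\<^sub>w\<close> produces make \<open>H\<close> entire.

  For \<open>r\<^sub>l < 0\<close> the factors \<open>exp (B\<^sub>j r\<^sub>l)\<close> make \<open>f\<close> itself real analytic, and since \<open>f\<close> does
  not depend on \<open>\<theta>\<^sub>l\<close>, the time-one map of the Hamiltonian \<open>-f\<close> is explicit and linearizes \<open>H\<close>. For
  \<open>r\<^sub>l > 0\<close> the equations of motion are still solved explicitly (\<open>r\<^sub>l\<close> is conserved), the \<open>j\<close>-th term
  of the action oscillates with amplitude \<open>g\<^sub>j(r\<^sub>l) \<parallel>k\<^sub>j\<parallel>\<close>, and at time of order \<open>1 / \<bar>\<lambda>\<^sub>j\<bar>\<close> it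
  dominates all the others.

  As \<open>g\<^sub>j\<close> vanishes to order \<open>j + 2\<close> at \<open>0\<close>, the coefficients of \<open>f\<close> as a formal series in \<open>r\<^sub>l\<close>
  are trigonometric polynomials, so \<open>f\<close> formally conjugates \<open>H\<close> to \<open>\<langle>w, r\<rangle>\<close>. Uniqueness is
  proved degree by degree: a coefficient of another formal solution differs from that of \<open>f\<close> by a
  periodic function whose derivative along \<open>w\<close> is constant, and such a function is constant by
  Kronecker's theorem; hence all coefficients are independent of \<open>\<theta>\<^sub>l\<close>, which keeps the induction going.
\<close>

section \<open>Unconditionally summable power series\<close>

text \<open>Two requirements on \<open>B j\<close> pull in opposite directions, and
  \<open>B j\<close> can be fixed only after \<open>k j\<close> is known. So each \<open>k j\<close>
  is selected with a margin large enough for every later demand on \<open>B j\<close>, which is then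
  a linear function of the size of \<open>k j\<close>. Since the \<open>l\<close>-component of
  \<open>k j\<close> vanishes, the shears involved leave the phases
  \<open>\<langle>k j, \<theta>\<rangle>\<close> unaffected apart from the linear motion. Conjugacy
  and orbits are therefore closed sums; no iteration scheme has to converge. For positive
  \<open>r $ l\<close> the series of \<open>f\<close> and of its gradient need not converge. What
  converges is their difference between times 0 and \<open>t\<close>, because the
  \<open>j\<close>-th phase moves by only \<open>2 * pi * lam j * t\<close>. The obstacle to
  uniqueness of the normal form is that another formal solution may shift the argument
  \<open>r $ l\<close> of the nonlinear term. That term is quadratic in \<open>r $ l\<close>, so a
  shift of order \<open>n\<close> changes it at order \<open>n + 1\<close> only, and the
  coefficients of degree \<open>n\<close> do not feel it.\<close>

lemma has_sum_Times_mult: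
  fixes f :: "'a \<Rightarrow> 'c::{real_normed_field,banach}" and g :: "'b \<Rightarrow> 'c"
  assumes "Infinite_Sum.abs_summable_on f A" "Infinite_Sum.abs_summable_on g B" "(f has_sum a) A" "(g has_sum b) B"
  shows "Infinite_Sum.abs_summable_on (\<lambda>(x, y). f x * g y) (A \<times> B)"
    and "((\<lambda>(x, y). f x * g y) has_sum (a * b)) (A \<times> B)"
proof -
  have "((\<lambda>y. norm (f x) * norm (g y)) has_sum (norm (f x) * infsum (\<lambda>y. norm (g y)) B)) B" for x
    by (intro has_sum_cmult_right has_sum_infsum assms)
  moreover have "(\<lambda>x. norm (f x) * infsum (\<lambda>y. norm (g y)) B) summable_on A"
    by (intro summable_on_cmult_left assms)
  ultimately have "(\<lambda>(x, y). norm (f x) * norm (g y)) summable_on A \<times> B"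
    by (intro summable_on_SigmaI[where g = "\<lambda>x. norm (f x) * infsum (\<lambda>y. norm (g y)) B"]) auto
  then show abs: "Infinite_Sum.abs_summable_on (\<lambda>(x, y). f x * g y) (A \<times> B)"
    by (simp add: norm_mult case_prod_unfold)
  show "((\<lambda>(x, y). f x * g y) has_sum (a * b)) (A \<times> B)"
  proof (rule has_sum_SigmaI)
    show "((\<lambda>y. case (x, y) of (x, y) \<Rightarrow> f x * g y) has_sum f x * b) B" for x
      using has_sum_cmult_right[OF assms(4)] by simp
    show "((\<lambda>x. f x * b) has_sum a * b) A"
      by (intro has_sum_cmult_left assms)
    show "(\<lambda>(x, y). f x * g y) summable_on A \<times> B"
      using abs by (rule abs_summable_summable)
  qed
qed

lemma has_sum_PiE_prod:
  fixes f :: "'i \<Rightarrow> 'a \<Rightarrow> 'c::{real_normed_field,banach}"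
  assumes "finite I" "\<And>i. i \<in> I \<Longrightarrow> Infinite_Sum.abs_summable_on (f i) (B i)"
    "\<And>i. i \<in> I \<Longrightarrow> (f i has_sum s i) (B i)"
  shows "Infinite_Sum.abs_summable_on (\<lambda>g. \<Prod>i\<in>I. f i (g i)) (PiE I B) \<and>
         ((\<lambda>g. \<Prod>i\<in>I. f i (g i)) has_sum (\<Prod>i\<in>I. s i)) (PiE I B)"
  using assms
proof (induction I rule: finite_induct)
  case empty
  then show ?case by (auto simp: has_sum_finite_iff)
next
  case (insert x I)
  let ?h = "\<lambda>(y, g). (g::'i \<Rightarrow> 'a)(x := y)"
  let ?P = "\<lambda>g. \<Prod>i\<in>insert x I. f i (g i)"
  have inj: "inj_on ?h (B x \<times> PiE I B)"
    using inj_combinator[OF insert.hyps(2)] .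
  have eq: "?P (?h p) = (case p of (y, g) \<Rightarrow> f x y * (\<Prod>i\<in>I. f i (g i)))" for p
    using insert.hyps by (auto simp: case_prod_unfold intro!: prod.cong)
  have IH: "Infinite_Sum.abs_summable_on (\<lambda>g. \<Prod>i\<in>I. f i (g i)) (PiE I B)"
    "((\<lambda>g. \<Prod>i\<in>I. f i (g i)) has_sum (\<Prod>i\<in>I. s i)) (PiE I B)"
    using insert by auto
  note * = has_sum_Times_mult[OF insert.prems(1)[of x] IH(1) insert.prems(2)[of x] IH(2), simplified]
  have "Infinite_Sum.abs_summable_on ?P (?h ` (B x \<times> PiE I B))"
    by (subst summable_on_reindex[OF inj]) (use *(1) eq in \<open>simp add: o_def\<close>)
  moreover have "(?P has_sum (\<Prod>i\<in>insert x I. s i)) (?h ` (B x \<times> PiE I B))"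
    using insert.hyps
    by (subst has_sum_reindex[OF inj]) (use *(2) eq in \<open>simp add: o_def\<close>)
  ultimately show ?case
    unfolding PiE_insert_eq by simp
qed

text \<open>Valid for real and complex \<open>z\<close>: imaginary arguments give the Taylor series
  of a plane wave, nonnegative real ones give its majorant.\<close>

lemma has_sum_prod_exp:
  fixes z :: "'n::finite \<Rightarrow> 'c::{real_normed_field,banach}"
  shows "Infinite_Sum.abs_summable_on (\<lambda>\<alpha>. \<Prod>i\<in>UNIV. z i ^ \<alpha> i / fact (\<alpha> i)) UNIV"
    and "((\<lambda>\<alpha>. \<Prod>i\<in>UNIV. z i ^ \<alpha> i / fact (\<alpha> i)) has_sum exp (\<Sum>i\<in>UNIV. z i)) UNIV"
proof -
  have a: "Infinite_Sum.abs_summable_on (\<lambda>n. z i ^ n / fact n) UNIV" for i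
    using summable_norm_exp[of "z i"]
    by (intro norm_summable_imp_summable_on) (simp add: norm_divide norm_power divide_inverse scaleR_conv_of_real norm_mult mult.commute)
  have b: "((\<lambda>n. z i ^ n / fact n) has_sum exp (z i)) UNIV" for i
    using summable_norm_exp[of "z i"] exp_converges[of "z i"]
    by (intro norm_summable_imp_has_sum) 
      (simp_all add: norm_divide norm_power divide_inverse scaleR_conv_of_real norm_mult mult.commute)
  show "Infinite_Sum.abs_summable_on (\<lambda>\<alpha>. \<Prod>i\<in>UNIV. z i ^ \<alpha> i / fact (\<alpha> i)) UNIV"
    "((\<lambda>\<alpha>. \<Prod>i\<in>UNIV. z i ^ \<alpha> i / fact (\<alpha> i)) has_sum exp (\<Sum>i\<in>UNIV. z i)) UNIV"
    using has_sum_PiE_prod[of UNIV "\<lambda>i n. z i ^ n / fact n" "\<lambda>_. UNIV" "\<lambda>i. exp (z i)"] a b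
    by (simp_all add: exp_sum)
qed

text \<open>The Taylor coefficients of \<open>\<theta> \<mapsto> cos (2 \<pi> \<langle>k, \<theta>\<rangle> + \<phi>)\<close> at \<open>\<theta>\<^sub>0\<close>, where
  \<open>p = 2 \<pi> \<langle>k, \<theta>\<^sub>0\<rangle> + \<phi>\<close>.\<close>
definition trig_coeff :: "real^'n \<Rightarrow> real \<Rightarrow> ('n \<Rightarrow> nat) \<Rightarrow> real" where
  "trig_coeff k p \<alpha> = Re (cis p * (\<Prod>i\<in>UNIV. (\<i> * of_real (2 * pi * k $ i)) ^ \<alpha> i / fact (\<alpha> i)))"

lemma has_sum_trig:
  fixes k h :: "real^'n"
  shows "((\<lambda>\<alpha>. trig_coeff k p \<alpha> * xmon h \<alpha>) has_sum cos (2 * pi * (k \<bullet> h) + p)) UNIV"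
proof -
  let ?z = "\<lambda>i. \<i> * of_real (2 * pi * k $ i * h $ i)"
  have "((\<lambda>\<alpha>. cis p * (\<Prod>i\<in>UNIV. ?z i ^ \<alpha> i / fact (\<alpha> i))) has_sum cis p * exp (\<Sum>i\<in>UNIV. ?z i)) UNIV"
    by (intro has_sum_cmult_right has_sum_prod_exp)
  then have "((\<lambda>\<alpha>. Re (cis p * (\<Prod>i\<in>UNIV. ?z i ^ \<alpha> i / fact (\<alpha> i)))) has_sum
      Re (cis p * exp (\<Sum>i\<in>UNIV. ?z i))) UNIV"
    by (rule has_sum_Re)
  moreover have "Re (cis p * exp (\<Sum>i\<in>UNIV. ?z i)) = cos (2 * pi * (k \<bullet> h) + p)"
  proof -
    have "(\<Sum>i\<in>UNIV. ?z i) = \<i> * of_real (2 * pi * (k \<bullet> h))"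
      by (simp add: inner_vec_def sum_distrib_left mult.assoc)
    then show ?thesis
      by (simp add: cis_conv_exp flip: exp_add)
        (simp add: add.commute exp_eq_polar flip: cis_conv_exp distrib_left of_real_add of_real_mult)
  qed
  moreover have "Re (cis p * (\<Prod>i\<in>UNIV. ?z i ^ \<alpha> i / fact (\<alpha> i))) = trig_coeff k p \<alpha> * xmon h \<alpha>" for \<alpha>
  proof -
    have "(\<Prod>i\<in>UNIV. ?z i ^ \<alpha> i / fact (\<alpha> i)) =
        (\<Prod>i\<in>UNIV. (\<i> * of_real (2 * pi * k $ i)) ^ \<alpha> i / fact (\<alpha> i)) * of_real (xmon h \<alpha>)"
      unfolding xmon_def of_real_prod prod.distrib[symmetric]
      by (intro prod.cong) (auto simp: power_mult_distrib)
    then show ?thesis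
      by (simp only: trig_coeff_def mult.assoc[symmetric] times_complex.simps(1) Re_complex_of_real
          Im_complex_of_real mult_zero_right diff_zero)
  qed
  ultimately show ?thesis by simp
qed

text \<open>Each coefficient is dominated by the corresponding one of a real exponential; the bound
  is the size that a plane wave can reach on a complex polydisc of radius \<open>\<rho>\<close>. It
  is stated for finite partial sums, the form in which the exchange of summations consumes
  it.\<close>

lemma trig_majorant:
  fixes k h :: "real^'n"
  assumes "\<And>i. \<bar>h $ i\<bar> \<le> \<rho>" "finite F"
  shows "(\<Sum>\<alpha>\<in>F. \<bar>trig_coeff k p \<alpha> * xmon h \<alpha>\<bar>) \<le> exp (2 * pi * \<rho> * (\<Sum>i\<in>UNIV. \<bar>k $ i\<bar>))"
proof -
  let ?z = "\<lambda>i. 2 * pi * \<rho> * \<bar>k $ i\<bar>"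
  have r: "\<rho> \<ge> 0" using assms(1) by (meson abs_ge_zero order_trans)
  have "\<bar>trig_coeff k p \<alpha> * xmon h \<alpha>\<bar> \<le> (\<Prod>i\<in>UNIV. ?z i ^ \<alpha> i / fact (\<alpha> i))" for \<alpha>
  proof -
    have "\<bar>trig_coeff k p \<alpha>\<bar> \<le> cmod (cis p * (\<Prod>i\<in>UNIV. (\<i> * of_real (2 * pi * k $ i)) ^ \<alpha> i / fact (\<alpha> i)))"
      unfolding trig_coeff_def by (rule abs_Re_le_cmod)
    also have "\<dots> = (\<Prod>i\<in>UNIV. (2 * pi * \<bar>k $ i\<bar>) ^ \<alpha> i / fact (\<alpha> i))"
      by (simp add: norm_mult norm_divide norm_power abs_mult flip: prod_norm)
    finally have 1: "\<bar>trig_coeff k p \<alpha>\<bar> \<le> (\<Prod>i\<in>UNIV. (2 * pi * \<bar>k $ i\<bar>) ^ \<alpha> i / fact (\<alpha> i))" .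
    have 2: "\<bar>xmon h \<alpha>\<bar> \<le> (\<Prod>i\<in>UNIV. \<rho> ^ \<alpha> i)"
      unfolding xmon_def abs_prod power_abs by (intro prod_mono) (auto intro!: power_mono assms)
    have "\<bar>trig_coeff k p \<alpha> * xmon h \<alpha>\<bar> \<le>
       (\<Prod>i\<in>UNIV. (2 * pi * \<bar>k $ i\<bar>) ^ \<alpha> i / fact (\<alpha> i)) * (\<Prod>i\<in>UNIV. \<rho> ^ \<alpha> i)"
      unfolding abs_mult by (intro mult_mono 1 2) (auto intro!: prod_nonneg)
    also have "\<dots> = (\<Prod>i\<in>UNIV. ?z i ^ \<alpha> i / fact (\<alpha> i))"
      unfolding prod.distrib[symmetric] by (intro prod.cong) (auto simp: power_mult_distrib)
    finally show ?thesis .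
  qed
  then have "(\<Sum>\<alpha>\<in>F. \<bar>trig_coeff k p \<alpha> * xmon h \<alpha>\<bar>) \<le> (\<Sum>\<alpha>\<in>F. \<Prod>i\<in>UNIV. ?z i ^ \<alpha> i / fact (\<alpha> i))"
    by (rule sum_mono)
  also have "\<dots> \<le> exp (\<Sum>i\<in>UNIV. ?z i)"
    using assms(2) has_sum_prod_exp(2)[of ?z] r
    by (intro finite_sum_le_has_sum) (auto intro!: prod_nonneg)
  finally show ?thesis by (simp add: sum_distrib_left)
qed

lemma has_sum_imp_abs_summable_real:
  fixes f :: "'a \<Rightarrow> real"
  assumes "(f has_sum s) A"
  shows "Infinite_Sum.abs_summable_on f A"
  using assms has_sum_imp_summable summable_on_iff_abs_summable_on_real[of f A] by blast

text \<open>Fubini: bounds on finite subfamilies that are summable in \<open>j\<close> make the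
  double family absolutely summable. The outer sum is an ordered \<open>suminf\<close>, the inner
  one an unordered sum over multi-indices.\<close>

lemma has_sum_suminf_interchange:
  fixes a :: "nat \<Rightarrow> 'x \<Rightarrow> real"
  assumes s: "\<And>j. (a j has_sum s j) UNIV"
    and b: "\<And>j F. finite F \<Longrightarrow> (\<Sum>x\<in>F. \<bar>a j x\<bar>) \<le> b j" and sb: "summable b"
  shows "summable (\<lambda>j. a j x)" and "((\<lambda>x. \<Sum>j. a j x) has_sum (\<Sum>j. s j)) UNIV"
proof -
  have abs: "Infinite_Sum.abs_summable_on (a j) UNIV" for j
    by (rule has_sum_imp_abs_summable_real[OF s])
  have nb: "infsum (\<lambda>x. \<bar>a j x\<bar>) UNIV \<le> b j" for j
    using abs[of j] b by (intro infsum_le_finite_sums) auto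
  have b0: "b j \<ge> 0" for j using b[of "{}" j] by simp
  have nn: "0 \<le> infsum (\<lambda>x. \<bar>a j x\<bar>) UNIV" for j by (intro infsum_nonneg) auto
  have sn: "summable (\<lambda>j. infsum (\<lambda>x. \<bar>a j x\<bar>) UNIV)"
    by (rule summable_comparison_test'[OF sb]) (use nb nn in auto)
  have pt: "summable (\<lambda>j. norm (a j x))" for x
    by (rule summable_comparison_test'[OF sb]) (use b[of "{x}"] in auto)
  then show "summable (\<lambda>j. a j x)" by (rule summable_norm_cancel)
  have inn: "((\<lambda>j. a j x) has_sum (\<Sum>j. a j x)) UNIV" for x
    by (rule norm_summable_imp_has_sum[OF pt summable_sums[OF summable_norm_cancel[OF pt]]])
  have "(\<lambda>(j, x). \<bar>a j x\<bar>) summable_on UNIV \<times> UNIV"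
  proof (rule summable_on_SigmaI[where g = "\<lambda>j. infsum (\<lambda>x. \<bar>a j x\<bar>) UNIV"])
    show "((\<lambda>y. case (j, y) of (j, x) \<Rightarrow> \<bar>a j x\<bar>) has_sum (\<Sum>\<^sub>\<infinity>x. \<bar>a j x\<bar>)) UNIV" for j
      using abs[of j] by simp
    show "(\<lambda>j. \<Sum>\<^sub>\<infinity>x. \<bar>a j x\<bar>) summable_on UNIV"
      by (rule summable_nonneg_imp_summable_on[OF sn nn])
  qed auto
  then have "(\<lambda>p. \<bar>case p of (j, x) \<Rightarrow> a j x\<bar>) summable_on UNIV \<times> UNIV"
    by (simp add: case_prod_unfold)
  then have sU: "(\<lambda>(j, x). a j x) summable_on UNIV \<times> UNIV"
    using abs_summable_summable[of "\<lambda>(j, x). a j x" "UNIV \<times> UNIV"] by simp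
  have sj: "\<bar>s j\<bar> \<le> b j" for j
  proof -
    have "\<bar>s j\<bar> \<le> infsum (\<lambda>x. \<bar>a j x\<bar>) UNIV"
      using norm_infsum_bound[OF abs[of j]] infsumI[OF s[of j]] by simp
    then show ?thesis using nb[of j] by linarith
  qed
  have ss: "summable (\<lambda>j. norm (s j))"
    by (rule summable_comparison_test'[OF sb]) (use sj in auto)
  have "(s has_sum (\<Sum>j. s j)) UNIV"
    by (rule norm_summable_imp_has_sum[OF ss summable_sums[OF summable_norm_cancel[OF ss]]])
  then have "((\<lambda>(j, x). a j x) has_sum (\<Sum>j. s j)) (UNIV \<times> UNIV)"
    by (intro has_sum_SigmaI[where g = s] sU) (use s in auto)
  then have "((\<lambda>(x, j). a j x) has_sum (\<Sum>j. s j)) (UNIV \<times> UNIV)"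
    by (subst (asm) has_sum_swap) simp
  then show "((\<lambda>x. \<Sum>j. a j x) has_sum (\<Sum>j. s j)) UNIV"
    by (rule has_sum_SigmaD) (use inn in auto)
qed

section \<open>Joint power series in angles and actions\<close>

text \<open>Absolute summability is not part of the definition: for real families it follows from \<open>has_sum\<close>.\<close>
definition ps_at :: "(('a::finite \<Rightarrow> nat) \<times> ('b::finite \<Rightarrow> nat) \<Rightarrow> real) \<Rightarrow> ((real^'a) \<times> (real^'b) \<Rightarrow> real)
    \<Rightarrow> (real^'a) \<times> (real^'b) \<Rightarrow> (real^'a) \<times> (real^'b) \<Rightarrow> bool" where
  "ps_at c f p0 p \<longleftrightarrow>
     ((\<lambda>(\<alpha>, \<beta>). c (\<alpha>, \<beta>) * xmon (fst p - fst p0) \<alpha> * xmon (snd p - snd p0) \<beta>) has_sum f p) UNIV"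

lemma ps_at_imp_abs_summable:
  assumes "ps_at c f p0 p"
  shows "(\<lambda>(\<alpha>, \<beta>). \<bar>c (\<alpha>, \<beta>) * xmon (fst p - fst p0) \<alpha> * xmon (snd p - snd p0) \<beta>\<bar>) summable_on UNIV"
proof -
  have "Infinite_Sum.abs_summable_on (\<lambda>(\<alpha>, \<beta>). c (\<alpha>, \<beta>) * xmon (fst p - fst p0) \<alpha> * xmon (snd p - snd p0) \<beta>) UNIV"
    using assms unfolding ps_at_def by (rule has_sum_imp_abs_summable_real)
  then show ?thesis by (simp add: case_prod_unfold)
qed

lemma real_analytic2I:
  assumes "\<And>p0. p0 \<in> S \<Longrightarrow> \<exists>e>0. \<exists>c. \<forall>p. norm (p - p0) < e \<longrightarrow> ps_at c f p0 p"
  shows "real_analytic2 f S"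
  unfolding real_analytic2_def
proof
  fix p0 assume "p0 \<in> S"
  then obtain e c where "e > 0" and c: "\<And>p. norm (p - p0) < e \<Longrightarrow> ps_at c f p0 p"
    using assms by blast
  show "\<exists>e>0. \<exists>c. \<forall>p. norm (p - p0) < e \<longrightarrow>
      (\<lambda>(\<alpha>, \<beta>). \<bar>c (\<alpha>, \<beta>) * xmon (fst p - fst p0) \<alpha> * xmon (snd p - snd p0) \<beta>\<bar>) summable_on UNIV \<and>
      ((\<lambda>(\<alpha>, \<beta>). c (\<alpha>, \<beta>) * xmon (fst p - fst p0) \<alpha> * xmon (snd p - snd p0) \<beta>) has_sum f p) UNIV"
    using \<open>e > 0\<close> ps_at_imp_abs_summable[OF c] c[unfolded ps_at_def]
    by (intro exI[of _ e] conjI exI[of _ c] allI impI)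
qed

lemma real_entire2I:
  assumes "\<And>p. ps_at c f 0 p"
  shows "real_entire2 f"
  unfolding real_entire2_def
  using ps_at_imp_abs_summable[OF assms] assms[unfolded ps_at_def]
  by (intro exI[of _ c] conjI allI) simp_all

lemma ps_at_add:
  assumes "ps_at c f p0 p" "ps_at d g p0 p"
  shows "ps_at (\<lambda>x. c x + d x) (\<lambda>p. f p + g p) p0 p"
  using has_sum_add[OF assms[unfolded ps_at_def]] unfolding ps_at_def
  by (simp add: case_prod_unfold algebra_simps)

lemma ps_at_cmult:
  assumes "ps_at c f p0 p"
  shows "ps_at (\<lambda>x. u * c x) (\<lambda>p. u * f p) p0 p"
  using has_sum_cmult_right[OF assms[unfolded ps_at_def], of u] unfolding ps_at_def
  by (simp add: case_prod_unfold algebra_simps)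

lemma ps_at_sum:
  assumes "finite I" "\<And>i. i \<in> I \<Longrightarrow> ps_at (c i) (f i) p0 p"
  shows "ps_at (\<lambda>x. \<Sum>i\<in>I. c i x) (\<lambda>p. \<Sum>i\<in>I. f i p) p0 p"
  using assms
proof (induction I rule: finite_induct)
  case empty
  show ?case by (simp add: ps_at_def case_prod_unfold)
next
  case (insert x I)
  then show ?case using ps_at_add[of "c x" "f x" p0 p] by simp
qed

definition single :: "'n \<Rightarrow> nat \<Rightarrow> 'n \<Rightarrow> nat" where
  "single l m = (\<lambda>i. if i = l then m else 0)"

lemma xmon_single [simp]: "xmon x (single l m) = x $ l ^ m"
proof -
  have "xmon x (single l m) = (\<Prod>i\<in>UNIV. if i = l then x $ l ^ m else 1)"
    unfolding xmon_def single_def by (intro prod.cong) auto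
  then show ?thesis by simp
qed

lemma xmon_zero [simp]: "xmon x (\<lambda>_. 0) = 1"
  by (simp add: xmon_def)

lemma inj_single: "inj (single l)"
  by (auto simp: inj_def single_def fun_eq_iff split: if_splits)

lemma single_apply [simp]: "single l m l = m"
  by (simp add: single_def)

lemma ps_at_fst: "ps_at (\<lambda>x. if x = (\<lambda>_. 0, \<lambda>_. 0) then fst p0 $ i else if x = (single i 1, \<lambda>_. 0) then 1 else 0)
    (\<lambda>p. fst p $ i) p0 p"
proof -
  have ne: "single i (Suc 0) \<noteq> (\<lambda>_. 0)" "(\<lambda>_. 0) \<noteq> single i (Suc 0)"
    by (metis single_apply zero_neq_one One_nat_def)+
  then show ?thesis
    unfolding ps_at_def
    by (intro has_sum_finite_neutralI[of "{(\<lambda>_. 0, \<lambda>_. 0), (single i 1, \<lambda>_. 0)}"])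
      (auto split: if_splits)
qed

lemma ps_at_snd: "ps_at (\<lambda>x. if x = (\<lambda>_. 0, \<lambda>_. 0) then snd p0 $ i else if x = (\<lambda>_. 0, single i 1) then 1 else 0)
    (\<lambda>p. snd p $ i) p0 p"
proof -
  have ne: "single i (Suc 0) \<noteq> (\<lambda>_. 0)" "(\<lambda>_. 0) \<noteq> single i (Suc 0)"
    by (metis single_apply zero_neq_one One_nat_def)+
  then show ?thesis
    unfolding ps_at_def
    by (intro has_sum_finite_neutralI[of "{(\<lambda>_. 0, \<lambda>_. 0), (\<lambda>_. 0, single i 1)}"])
      (auto split: if_splits)
qed

text \<open>A series in one coordinate becomes a multi-index series by padding with zeros off
  \<open>range (single l)\<close>; there \<open>\<beta> l\<close> recovers the exponent.\<close>

lemma has_sum_single: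
  fixes y :: "real^'n"
  assumes "((\<lambda>m. c m * (y $ l) ^ m) has_sum s) UNIV"
  shows "((\<lambda>\<beta>. (if \<beta> \<in> range (single l) then c (\<beta> l) else 0) * xmon y \<beta>) has_sum s) UNIV"
proof -
  have "((\<lambda>\<beta>. c (\<beta> l) * xmon y \<beta>) has_sum s) (range (single l))"
    using assms by (subst has_sum_reindex[OF inj_single]) (simp add: o_def)
  also have "?this \<longleftrightarrow> ?thesis"
    by (rule has_sum_cong_neutral) auto
  finally show ?thesis .
qed

text \<open>Joint Taylor coefficients at a base point of \<open>u * (G (r $ l) * cos (2 * pi * (k
  \<bullet> \<theta>) + \<phi>))\<close>: \<open>c\<close> are the coefficients of \<open>G\<close>,
  and \<open>p\<close> is the phase evaluated at the base point.\<close>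

definition trig_term_coeff ::
    "'b \<Rightarrow> real^'a \<Rightarrow> real \<Rightarrow> real \<Rightarrow> (nat \<Rightarrow> real) \<Rightarrow> ('a \<Rightarrow> nat) \<times> ('b \<Rightarrow> nat) \<Rightarrow> real" where
  "trig_term_coeff l k p u c = (\<lambda>(\<alpha>, \<beta>). u * trig_coeff k p \<alpha> *
     (if \<beta> \<in> range (single l) then c (\<beta> l) else 0))"

text \<open>A product of an angle series and an action series, both absolutely summable. The second
  claim is the domination that later allows infinitely many such terms to be added
  coefficientwise.\<close>

lemma ps_at_trig_term:
  fixes k :: "real^'a" and l :: "'b::finite" and p0 p :: "(real^'a) \<times> (real^'b)"
    and c :: "nat \<Rightarrow> real" and u \<phi> :: real
  defines "y \<equiv> snd p $ l - snd p0 $ l"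
    and "d \<equiv> trig_term_coeff l k (2 * pi * (k \<bullet> fst p0) + \<phi>) u c"
  assumes sc: "summable (\<lambda>m. \<bar>c m\<bar> * \<bar>y\<bar> ^ m)" and M: "(\<Sum>m. \<bar>c m\<bar> * \<bar>y\<bar> ^ m) \<le> M"
    and G: "(\<lambda>m. c m * y ^ m) sums G (snd p $ l)"
    and \<rho>: "\<And>i. \<bar>fst p $ i - fst p0 $ i\<bar> \<le> \<rho>"
  shows "ps_at d (\<lambda>p. u * (G (snd p $ l) * cos (2 * pi * (k \<bullet> fst p) + \<phi>))) p0 p"
    and "finite F \<Longrightarrow>
      (\<Sum>(\<alpha>, \<beta>)\<in>F. \<bar>d (\<alpha>, \<beta>) * xmon (fst p - fst p0) \<alpha> * xmon (snd p - snd p0) \<beta>\<bar>)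
        \<le> \<bar>u\<bar> * (exp (2 * pi * \<rho> * (\<Sum>i\<in>UNIV. \<bar>k $ i\<bar>)) * M)"
proof -
  define q where "q = 2 * pi * (k \<bullet> fst p0) + \<phi>"
  define h where "h = fst p - fst p0"
  define A where "A = (\<lambda>\<alpha>. trig_coeff k q \<alpha> * xmon h \<alpha>)"
  define B where "B = (\<lambda>\<beta>. (if \<beta> \<in> range (single l) then c (\<beta> l) else 0) * xmon (snd p - snd p0) \<beta>)"
  have y: "(snd p - snd p0) $ l = y" by (simp add: y_def)
  have nn: "summable (\<lambda>m. norm (c m * y ^ m))"
    using sc by (simp add: abs_mult power_abs)
  have cy: "((\<lambda>m. c m * y ^ m) has_sum G (snd p $ l)) UNIV"
    by (rule norm_summable_imp_has_sum[OF nn G])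
  have cy': "((\<lambda>m. \<bar>c m\<bar> * \<bar>y\<bar> ^ m) has_sum (\<Sum>m. \<bar>c m\<bar> * \<bar>y\<bar> ^ m)) UNIV"
    by (rule norm_summable_imp_has_sum) (use sc summable_sums[OF sc] in auto)
  have A: "(A has_sum cos (2 * pi * (k \<bullet> h) + q)) UNIV"
    unfolding A_def by (rule has_sum_trig)
  have qh: "2 * pi * (k \<bullet> h) + q = 2 * pi * (k \<bullet> fst p) + \<phi>"
    by (simp add: q_def h_def inner_diff_right algebra_simps)
  have B: "(B has_sum G (snd p $ l)) UNIV"
    unfolding B_def by (rule has_sum_single) (use cy y in simp)
  have absA: "Infinite_Sum.abs_summable_on A UNIV" and absB: "Infinite_Sum.abs_summable_on B UNIV"
    by (rule has_sum_imp_abs_summable_real[OF A], rule has_sum_imp_abs_summable_real[OF B])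
  have prod: "((\<lambda>(\<alpha>, \<beta>). A \<alpha> * B \<beta>) has_sum (cos (2 * pi * (k \<bullet> h) + q) * G (snd p $ l))) UNIV"
    using has_sum_Times_mult(2)[OF absA absB A B] by simp
  have d_eq: "d (\<alpha>, \<beta>) * xmon (fst p - fst p0) \<alpha> * xmon (snd p - snd p0) \<beta> = u * (A \<alpha> * B \<beta>)" for \<alpha> \<beta>
    unfolding d_def trig_term_coeff_def A_def B_def q_def h_def by simp
  show "ps_at d (\<lambda>p. u * (G (snd p $ l) * cos (2 * pi * (k \<bullet> fst p) + \<phi>))) p0 p"
    using has_sum_cmult_right[OF prod, of u] unfolding ps_at_def d_eq qh
    by (simp add: case_prod_unfold mult.commute mult.left_commute)
  assume F: "finite F"
  have nA: "infsum (\<lambda>\<alpha>. \<bar>A \<alpha>\<bar>) UNIV \<le> exp (2 * pi * \<rho> * (\<Sum>i\<in>UNIV. \<bar>k $ i\<bar>))"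
    using absA \<rho> unfolding A_def
    by (intro infsum_le_finite_sums trig_majorant) (auto simp: h_def)
  have Babs: "\<bar>B \<beta>\<bar> = (if \<beta> \<in> range (single l) then \<bar>c (\<beta> l)\<bar> else 0) * xmon (\<chi> i. \<bar>(snd p - snd p0) $ i\<bar>) \<beta>" for \<beta>
    by (simp add: B_def abs_mult xmon_def abs_prod power_abs)
  have "((\<lambda>\<beta>. \<bar>B \<beta>\<bar>) has_sum (\<Sum>m. \<bar>c m\<bar> * \<bar>y\<bar> ^ m)) UNIV"
    unfolding Babs by (rule has_sum_single) (use cy' y in simp)
  then have nB: "infsum (\<lambda>\<beta>. \<bar>B \<beta>\<bar>) UNIV \<le> M"
    using M by (simp add: infsumI)
  have "((\<lambda>(\<alpha>, \<beta>). \<bar>A \<alpha>\<bar> * \<bar>B \<beta>\<bar>) has_sum (infsum (\<lambda>\<alpha>. \<bar>A \<alpha>\<bar>) UNIV * infsum (\<lambda>\<beta>. \<bar>B \<beta>\<bar>) UNIV)) UNIV"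
    using has_sum_Times_mult(2)[of "\<lambda>\<alpha>. \<bar>A \<alpha>\<bar>" UNIV "\<lambda>\<beta>. \<bar>B \<beta>\<bar>" UNIV] absA absB by simp
  then have "(\<Sum>(\<alpha>, \<beta>)\<in>F. \<bar>A \<alpha>\<bar> * \<bar>B \<beta>\<bar>) \<le> infsum (\<lambda>\<alpha>. \<bar>A \<alpha>\<bar>) UNIV * infsum (\<lambda>\<beta>. \<bar>B \<beta>\<bar>) UNIV"
    by (rule finite_sum_le_has_sum) (use F in auto)
  also have "\<dots> \<le> exp (2 * pi * \<rho> * (\<Sum>i\<in>UNIV. \<bar>k $ i\<bar>)) * M"
    by (intro mult_mono nA nB infsum_nonneg) auto
  finally have "\<bar>u\<bar> * (\<Sum>(\<alpha>, \<beta>)\<in>F. \<bar>A \<alpha>\<bar> * \<bar>B \<beta>\<bar>) \<le> \<bar>u\<bar> * (exp (2 * pi * \<rho> * (\<Sum>i\<in>UNIV. \<bar>k $ i\<bar>)) * M)"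
    by (intro mult_left_mono) auto
  then show "(\<Sum>(\<alpha>, \<beta>)\<in>F. \<bar>d (\<alpha>, \<beta>) * xmon (fst p - fst p0) \<alpha> * xmon (snd p - snd p0) \<beta>\<bar>)
        \<le> \<bar>u\<bar> * (exp (2 * pi * \<rho> * (\<Sum>i\<in>UNIV. \<bar>k $ i\<bar>)) * M)"
    unfolding d_eq by (simp add: abs_mult sum_distrib_left case_prod_unfold)
qed

lemma ps_at_suminf:
  assumes ps: "\<And>j. ps_at (d j) (f j) p0 p"
    and b: "\<And>j F. finite F \<Longrightarrow>
      (\<Sum>(\<alpha>, \<beta>)\<in>F. \<bar>d j (\<alpha>, \<beta>) * xmon (fst p - fst p0) \<alpha> * xmon (snd p - snd p0) \<beta>\<bar>) \<le> b j"
    and sb: "summable b"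
  shows "ps_at (\<lambda>x. \<Sum>j. d j x) (\<lambda>p. \<Sum>j. f j p) p0 p"
proof -
  define X where "X = (\<lambda>(\<alpha>, \<beta>). xmon (fst p - fst p0) \<alpha> * xmon (snd p - snd p0) \<beta>)"
  have 1: "((\<lambda>x. d j x * X x) has_sum f j p) UNIV" for j
    using ps[of j] unfolding ps_at_def X_def by (simp add: case_prod_unfold mult.assoc)
  have 2: "finite F \<Longrightarrow> (\<Sum>x\<in>F. \<bar>d j x * X x\<bar>) \<le> b j" for j F
    using b[of F j] unfolding X_def by (simp add: case_prod_unfold mult.assoc)
  note * = has_sum_suminf_interchange[of "\<lambda>j x. d j x * X x", OF 1 2 sb]
  \<comment> \<open>The coefficient series is known to converge only where the monomial is nonzero;
    where it vanishes, both sides are 0 whatever value \<open>suminf\<close> takes.\<close>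
  have "(\<Sum>j. d j x * X x) = (\<Sum>j. d j x) * X x" for x
  proof (cases "X x = 0")
    case False
    have "summable (\<lambda>j. d j x * X x / X x)" by (intro summable_divide *)
    then show ?thesis using False suminf_mult2[of "\<lambda>j. d j x" "X x"] by simp
  qed auto
  then show ?thesis using *(2) unfolding ps_at_def X_def by (simp add: case_prod_unfold mult.assoc)
qed

lemma has_sum_abs_le:
  fixes f :: "'a \<Rightarrow> real"
  assumes "(f has_sum s) A" "(h has_sum t) A" "\<And>x. x \<in> A \<Longrightarrow> \<bar>f x\<bar> \<le> h x"
  shows "\<bar>s\<bar> \<le> t"
proof -
  have "s \<le> t" by (rule has_sum_mono[OF assms(1,2)]) (use assms(3) in force)
  moreover have "((\<lambda>x. - f x) has_sum - s) A" using assms(1) by (simp add: has_sum_uminus)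
  then have "- s \<le> t" by (rule has_sum_mono[OF _ assms(2)]) (use assms(3) in force)
  ultimately show ?thesis by linarith
qed

lemma has_sum_finite_sum:
  fixes f :: "'j \<Rightarrow> 'a \<Rightarrow> real"
  assumes "finite J" "\<And>j. j \<in> J \<Longrightarrow> (f j has_sum s j) A"
  shows "((\<lambda>x. \<Sum>j\<in>J. f j x) has_sum (\<Sum>j\<in>J. s j)) A"
  using assms
proof (induction J rule: finite_induct)
  case (insert j J)
  then show ?case by (simp add: has_sum_add)
qed simp

section \<open>Multi-indices, total degree and truncated series\<close>

lemma finite_mdeg: "finite {\<alpha> :: 'n::finite \<Rightarrow> nat. mdeg \<alpha> \<le> n}"
proof (rule finite_subset)
  show "{\<alpha> :: 'n \<Rightarrow> nat. mdeg \<alpha> \<le> n} \<subseteq> PiE UNIV (\<lambda>_. {..n})"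
  proof
    fix \<alpha> :: "'n \<Rightarrow> nat" assume "\<alpha> \<in> {\<alpha>. mdeg \<alpha> \<le> n}"
    moreover have "\<alpha> i \<le> mdeg \<alpha>" for i unfolding mdeg_def by (rule member_le_sum) auto
    ultimately have "\<alpha> i \<le> n" for i using order_trans by blast
    then show "\<alpha> \<in> PiE UNIV (\<lambda>_. {..n})" by (simp add: PiE_iff)
  qed
qed (auto intro: finite_PiE)

lemma mdeg_single [simp]: "mdeg (single l m) = m"
  unfolding mdeg_def single_def by simp

lemma mdeg_1_single:
  assumes "mdeg \<alpha> = 1" shows "\<exists>i. \<alpha> = single i 1"
proof -
  obtain i where i: "\<alpha> i \<noteq> 0"
    using assms unfolding mdeg_def by (metis sum.neutral zero_neq_one)
  have s: "\<alpha> i + (\<Sum>m\<in>UNIV - {i}. \<alpha> m) = 1"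
    using assms unfolding mdeg_def by (simp add: sum.remove[of UNIV i])
  then have "\<alpha> i = 1" "(\<Sum>m\<in>UNIV - {i}. \<alpha> m) = 0" using i by linarith+
  then have "\<alpha> = single i 1" by (auto simp: single_def fun_eq_iff)
  then show ?thesis ..
qed

lemma abs_xmon_le: "\<bar>xmon r \<alpha>\<bar> \<le> norm r ^ mdeg \<alpha>"
proof -
  have "\<bar>xmon r \<alpha>\<bar> \<le> (\<Prod>i\<in>UNIV. norm r ^ \<alpha> i)"
    unfolding xmon_def abs_prod power_abs by (intro prod_mono) (auto intro!: power_mono component_le_norm_cart)
  then show ?thesis unfolding mdeg_def by (simp add: power_sum)
qed

lemma xmon_scale: "xmon (s *\<^sub>R y) \<alpha> = s ^ mdeg \<alpha> * xmon y \<alpha>"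
  unfolding xmon_def mdeg_def by (simp add: power_mult_distrib prod.distrib power_sum)

lemma sum_single_mdeg:
  fixes G :: "nat \<Rightarrow> 'b::real_vector"
  shows "(\<Sum>\<alpha>\<in>{\<alpha> :: 'n::finite \<Rightarrow> nat. mdeg \<alpha> \<le> n}. xmon r \<alpha> *\<^sub>R (if \<alpha> \<in> range (single l) then G (\<alpha> l) else 0))
    = (\<Sum>m\<le>n. (r $ l) ^ m *\<^sub>R G m)"
proof -
  have "(\<Sum>m\<le>n. (r $ l) ^ m *\<^sub>R G m) = (\<Sum>\<alpha>\<in>single l ` {..n}. xmon r \<alpha> *\<^sub>R (if \<alpha> \<in> range (single l) then G (\<alpha> l) else 0))"
    by (subst sum.reindex) (auto intro: inj_on_subset[OF inj_single])
  also have "\<dots> = (\<Sum>\<alpha>\<in>{\<alpha>. mdeg \<alpha> \<le> n}. xmon r \<alpha> *\<^sub>R (if \<alpha> \<in> range (single l) then G (\<alpha> l) else 0))"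
    by (rule sum.mono_neutral_left) (auto simp: finite_mdeg)
  finally show ?thesis by simp
qed

lemma lin_series_eq: "lin_series w \<alpha> = (\<Sum>i\<in>UNIV. if \<alpha> = single i 1 then w $ i else 0)"
  unfolding lin_series_def single_def ..

lemma lin_series_sum:
  "(\<Sum>\<alpha>\<in>{\<alpha>. mdeg \<alpha> \<le> n}. lin_series w \<alpha> * xmon r \<alpha>) = (if n = 0 then 0 else w \<bullet> r)"
proof -
  have "(\<Sum>\<alpha>\<in>{\<alpha>. mdeg \<alpha> \<le> n}. lin_series w \<alpha> * xmon r \<alpha>)
      = (\<Sum>i\<in>UNIV. \<Sum>\<alpha>\<in>{\<alpha>. mdeg \<alpha> \<le> n}. if \<alpha> = single i 1 then w $ i * xmon r \<alpha> else 0)"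
    unfolding lin_series_eq sum_distrib_right by (subst sum.swap) (intro sum.cong refl, auto)
  also have "\<dots> = (\<Sum>i\<in>UNIV. if n = 0 then 0 else w $ i * r $ i)"
    by (intro sum.cong refl) (auto simp: finite_mdeg sum.delta')
  finally show ?thesis by (auto simp: inner_vec_def)
qed

text \<open>Only \<open>n = 0\<close> cuts off the linear part, and then the error
  \<open>w \<bullet> r\<close> has exactly the order that is allowed.\<close>

lemma lin_series_sum_bound:
  "\<bar>(\<Sum>\<alpha>\<in>{\<alpha>. mdeg \<alpha> \<le> n}. lin_series w \<alpha> * xmon r \<alpha>) - w \<bullet> r\<bar> \<le> norm w * norm r ^ (n + 1)"
  unfolding lin_series_sum using Cauchy_Schwarz_ineq2[of w r] by auto

text \<open>Summability at the diagonal point \<open>x0 + \<rho> *\<^sub>R one\<close> bounds the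
  sum of \<open>\<bar>c \<alpha>\<bar> * \<rho> ^ mdeg \<alpha>\<close> by some \<open>S\<close>.
  Terms of degree at least 2 are then at most \<open>S * (norm h / \<rho>)\<^sup>2\<close>, so the
  part of degree 1 is the derivative. This gives meaning to \<open>grad1\<close> for the arbitrary
  analytic coefficients in \<open>birkhoff_nf\<close>.\<close>

lemma real_analytic1_differentiable:
  fixes f :: "real^'n \<Rightarrow> real"
  assumes "real_analytic1 f UNIV"
  shows "f differentiable (at x0)"
proof -
  obtain e c where e: "e > 0" and c: "\<And>x. norm (x - x0) < e \<Longrightarrow> ((\<lambda>\<alpha>. c \<alpha> * xmon (x - x0) \<alpha>) has_sum f x) UNIV"
    using assms unfolding real_analytic1_def by blast
  define n where "n = norm ((\<chi> i. 1) :: real^'n)"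
  define \<rho> where "\<rho> = e / (2 * (n + 1))"
  have n: "n \<ge> 0" by (simp add: n_def)
  have \<rho>: "\<rho> > 0" using e n by (simp add: \<rho>_def)
  define one where "one = ((\<chi> i. 1) :: real^'n)"
  have "norm (\<rho> *\<^sub>R one) < e"
  proof -
    have "e * n < e * (2 * (n + 1))" using e n by (intro mult_strict_left_mono) auto
    then have "\<rho> * n < e" using n by (simp add: \<rho>_def field_simps)
    then show ?thesis using \<rho> by (simp add: n_def one_def)
  qed
  then have "((\<lambda>\<alpha>. c \<alpha> * xmon (\<rho> *\<^sub>R one) \<alpha>) has_sum f (x0 + \<rho> *\<^sub>R one)) UNIV"
    using c[of "x0 + \<rho> *\<^sub>R one"] by simp
  moreover have "xmon (\<rho> *\<^sub>R one) \<alpha> = \<rho> ^ mdeg \<alpha>" for \<alpha>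
    unfolding xmon_scale by (simp add: one_def xmon_def)
  ultimately have "Infinite_Sum.abs_summable_on (\<lambda>\<alpha>. c \<alpha> * \<rho> ^ mdeg \<alpha>) UNIV"
    using has_sum_imp_abs_summable_real by force
  then obtain S where S: "((\<lambda>\<alpha>. \<bar>c \<alpha>\<bar> * \<rho> ^ mdeg \<alpha>) has_sum S) UNIV"
    using \<rho> by (auto simp: abs_mult summable_on_def)
  have S0: "S \<ge> 0" by (rule has_sum_nonneg[OF S]) (use \<rho> in auto)
  define L where "L = (\<lambda>h. \<Sum>\<alpha>\<in>{\<alpha>. mdeg \<alpha> \<le> 1}. if mdeg \<alpha> = 1 then c \<alpha> * xmon h \<alpha> else 0)"
  have x0: "f x0 = c (\<lambda>_. 0)"
  proof -
    have "((\<lambda>\<alpha>. c \<alpha> * xmon (x0 - x0) \<alpha>) has_sum c (\<lambda>_. 0)) UNIV"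
    proof (rule has_sum_finite_neutralI[of "{\<lambda>_. 0}"])
      fix \<alpha> :: "'n \<Rightarrow> nat" assume "\<alpha> \<in> UNIV - {\<lambda>_. 0}"
      then obtain i where "\<alpha> i \<noteq> 0" by (auto simp: fun_eq_iff)
      then have "(0::real^'n) $ i ^ \<alpha> i = 0" by simp
      then have "xmon (0::real^'n) \<alpha> = 0" unfolding xmon_def by (subst prod_zero_iff) auto
      then show "c \<alpha> * xmon (x0 - x0) \<alpha> = 0" by simp
    qed auto
    then show ?thesis using c[of x0] e has_sum_unique by force
  qed
  have lin: "linear L"
    unfolding L_def
  proof (intro linear_compose_sum ballI)
    fix \<alpha> :: "'n \<Rightarrow> nat"
    show "linear (\<lambda>h. if mdeg \<alpha> = 1 then c \<alpha> * xmon h \<alpha> else 0)"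
    proof (cases "mdeg \<alpha> = 1")
      case True
      then obtain i where "\<alpha> = single i 1" using mdeg_1_single by blast
      then show ?thesis by (auto intro!: linearI simp: algebra_simps)
    qed (auto intro!: linearI)
  qed
  have rem: "\<bar>f x - f x0 - L (x - x0)\<bar> \<le> S / \<rho>\<^sup>2 * (norm (x - x0))\<^sup>2" if x: "norm (x - x0) < min \<rho> e" for x
  proof -
    define h where "h = x - x0"
    have h: "norm h < \<rho>" "norm h < e" using x by (auto simp: h_def)
    let ?A = "{\<alpha>. mdeg \<alpha> \<le> 1} :: ('n \<Rightarrow> nat) set"
    have fin: "finite ?A" by (rule finite_mdeg)
    have split: "(\<Sum>\<alpha>\<in>?A. c \<alpha> * xmon h \<alpha>) = c (\<lambda>_. 0) + L h"
    proof -
      have "(\<Sum>\<alpha>\<in>?A. c \<alpha> * xmon h \<alpha>) = (\<Sum>\<alpha>\<in>?A. (if \<alpha> = (\<lambda>_. 0) then c (\<lambda>_. 0) else 0) + (if mdeg \<alpha> = 1 then c \<alpha> * xmon h \<alpha> else 0))"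
      proof (intro sum.cong refl)
        fix \<alpha> :: "'n \<Rightarrow> nat" assume "\<alpha> \<in> ?A"
        then have "mdeg \<alpha> = 0 \<or> mdeg \<alpha> = 1" by auto
        moreover have "mdeg \<alpha> = 0 \<longleftrightarrow> \<alpha> = (\<lambda>_. 0)" by (auto simp: mdeg_def fun_eq_iff)
        ultimately show "c \<alpha> * xmon h \<alpha> = (if \<alpha> = (\<lambda>_. 0) then c (\<lambda>_. 0) else 0) + (if mdeg \<alpha> = 1 then c \<alpha> * xmon h \<alpha> else 0)"
          by (auto simp: mdeg_def)
      qed
      also have "\<dots> = c (\<lambda>_. 0) + L h"
        unfolding sum.distrib L_def using fin by (simp add: mdeg_def)
      finally show ?thesis .
    qed
    have "((\<lambda>\<alpha>. if \<alpha> \<in> ?A then c \<alpha> * xmon h \<alpha> else 0) has_sum (c (\<lambda>_. 0) + L h)) UNIV"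
    proof (rule has_sum_finite_neutralI[of ?A])
      show "c (\<lambda>_. 0) + L h = (\<Sum>\<alpha>\<in>?A. if \<alpha> \<in> ?A then c \<alpha> * xmon h \<alpha> else 0)"
        unfolding split[symmetric] by (intro sum.cong) auto
    qed (use fin in auto)
    from has_sum_add[OF c[of x] has_sum_cmult_right[OF this, of "- 1"]]
    have "((\<lambda>\<alpha>. c \<alpha> * xmon h \<alpha> - (if \<alpha> \<in> ?A then c \<alpha> * xmon h \<alpha> else 0)) has_sum (f x - (c (\<lambda>_. 0) + L h))) UNIV"
      using h by (simp add: h_def algebra_simps)
    moreover have "((\<lambda>\<alpha>. (norm h / \<rho>)\<^sup>2 * (\<bar>c \<alpha>\<bar> * \<rho> ^ mdeg \<alpha>)) has_sum ((norm h / \<rho>)\<^sup>2 * S)) UNIV"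
      by (rule has_sum_cmult_right[OF S])
    moreover have "\<bar>c \<alpha> * xmon h \<alpha> - (if \<alpha> \<in> ?A then c \<alpha> * xmon h \<alpha> else 0)\<bar> \<le> (norm h / \<rho>)\<^sup>2 * (\<bar>c \<alpha>\<bar> * \<rho> ^ mdeg \<alpha>)" for \<alpha>
    proof (cases "\<alpha> \<in> ?A")
      case False
      then have m: "mdeg \<alpha> \<ge> 2" by auto
      have "norm h ^ mdeg \<alpha> = (norm h / \<rho>) ^ mdeg \<alpha> * \<rho> ^ mdeg \<alpha>"
        using \<rho> by (simp add: power_divide)
      also have "\<dots> \<le> (norm h / \<rho>)\<^sup>2 * \<rho> ^ mdeg \<alpha>"
        using \<rho> h m by (intro mult_right_mono power_decreasing) auto
      finally have "\<bar>xmon h \<alpha>\<bar> \<le> (norm h / \<rho>)\<^sup>2 * \<rho> ^ mdeg \<alpha>" using abs_xmon_le[of h \<alpha>] by linarith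
      then have "\<bar>c \<alpha>\<bar> * \<bar>xmon h \<alpha>\<bar> \<le> \<bar>c \<alpha>\<bar> * ((norm h / \<rho>)\<^sup>2 * \<rho> ^ mdeg \<alpha>)" by (intro mult_left_mono) auto
      then show ?thesis using False by (simp only: if_False abs_mult diff_zero mult_ac)
    qed (use \<rho> in auto)
    ultimately have "\<bar>f x - (c (\<lambda>_. 0) + L h)\<bar> \<le> (norm h / \<rho>)\<^sup>2 * S"
      by (rule has_sum_abs_le)
    then show ?thesis unfolding x0 h_def by (simp add: power_divide algebra_simps)
  qed
  have "(f has_derivative L) (at x0)"
    unfolding has_derivative_at_alt
  proof (intro conjI allI impI)
    show "bounded_linear L" using lin by (simp add: linear_conv_bounded_linear)
    fix \<epsilon> :: real assume \<epsilon>: "\<epsilon> > 0"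
    define d where "d = min (min \<rho> e) (\<epsilon> / (S / \<rho>\<^sup>2 + 1))"
    have q: "S / \<rho>\<^sup>2 \<ge> 0" using S0 by simp
    have d: "d > 0" using \<rho> e \<epsilon> q by (auto simp: d_def)
    show "\<exists>d>0. \<forall>y. norm (y - x0) < d \<longrightarrow> norm (f y - f x0 - L (y - x0)) \<le> \<epsilon> * norm (y - x0)"
    proof (intro exI[of _ d] conjI d allI impI)
      fix y assume y: "norm (y - x0) < d"
      then have "norm (y - x0) \<le> \<epsilon> / (S / \<rho>\<^sup>2 + 1)" by (simp add: d_def)
      then have "norm (y - x0) * (S / \<rho>\<^sup>2 + 1) \<le> \<epsilon>" using q by (simp add: pos_le_divide_eq)
      then have "norm (y - x0) * (S / \<rho>\<^sup>2) + norm (y - x0) \<le> \<epsilon>" by (simp only: distrib_left mult_1_right)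
      then have "S / \<rho>\<^sup>2 * norm (y - x0) \<le> \<epsilon>"
        using norm_ge_zero[of "y - x0"] unfolding mult.commute[of "S / \<rho>\<^sup>2"] by linarith
      then have "S / \<rho>\<^sup>2 * norm (y - x0) * norm (y - x0) \<le> \<epsilon> * norm (y - x0)" by (intro mult_right_mono) auto
      then show "norm (f y - f x0 - L (y - x0)) \<le> \<epsilon> * norm (y - x0)"
        using rem[of y] y by (simp add: d_def power2_eq_square mult.assoc)
    qed
  qed
  then show ?thesis by (auto simp: differentiable_def)
qed

lemma real_analytic1_trig_sum:
  fixes k :: "'j \<Rightarrow> real^'n"
  assumes "finite J"
  shows "real_analytic1 (\<lambda>\<theta>. \<Sum>j\<in>J. u j * cos (2 * pi * (k j \<bullet> \<theta>) + \<phi>)) UNIV"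
  unfolding real_analytic1_def
proof
  fix x0 :: "real^'n"
  define c where "c = (\<lambda>\<alpha>. \<Sum>j\<in>J. u j * trig_coeff (k j) (2 * pi * (k j \<bullet> x0) + \<phi>) \<alpha>)"
  have h: "((\<lambda>\<alpha>. c \<alpha> * xmon (x - x0) \<alpha>) has_sum (\<Sum>j\<in>J. u j * cos (2 * pi * (k j \<bullet> x) + \<phi>))) UNIV" for x
  proof -
    have "((\<lambda>\<alpha>. u j * (trig_coeff (k j) (2 * pi * (k j \<bullet> x0) + \<phi>) \<alpha> * xmon (x - x0) \<alpha>)) has_sum
       u j * cos (2 * pi * (k j \<bullet> (x - x0)) + (2 * pi * (k j \<bullet> x0) + \<phi>))) UNIV" for j
      by (intro has_sum_cmult_right has_sum_trig)
    moreover have "2 * pi * (k j \<bullet> (x - x0)) + (2 * pi * (k j \<bullet> x0) + \<phi>) = 2 * pi * (k j \<bullet> x) + \<phi>" for j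
      by (simp add: inner_diff_right algebra_simps)
    ultimately have "((\<lambda>\<alpha>. \<Sum>j\<in>J. u j * (trig_coeff (k j) (2 * pi * (k j \<bullet> x0) + \<phi>) \<alpha> * xmon (x - x0) \<alpha>)) has_sum
       (\<Sum>j\<in>J. u j * cos (2 * pi * (k j \<bullet> x) + \<phi>))) UNIV"
      using assms by (intro has_sum_finite_sum) auto
    then show ?thesis by (simp add: c_def sum_distrib_right mult.assoc)
  qed
  have "(\<lambda>\<alpha>. \<bar>c \<alpha> * xmon (x - x0) \<alpha>\<bar>) summable_on UNIV" for x
    using has_sum_imp_abs_summable_real[OF h[of x]] by simp
  then show "\<exists>e>0. \<exists>c. \<forall>x. norm (x - x0) < e \<longrightarrow> (\<lambda>\<alpha>. \<bar>c \<alpha> * xmon (x - x0) \<alpha>\<bar>) summable_on UNIV \<and>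
      ((\<lambda>\<alpha>. c \<alpha> * xmon (x - x0) \<alpha>) has_sum (\<Sum>j\<in>J. u j * cos (2 * pi * (k j \<bullet> x) + \<phi>))) UNIV"
    using h by (intro exI[of _ "1::real"] conjI exI[of _ c]) auto
qed

section \<open>Derivatives of series and one-variable majorants\<close>

text \<open>The bounds \<open>b n\<close> on the operator norms make the series of derivatives
  converge uniformly on \<open>S\<close>; the functions themselves need to be summable at one point
  only.\<close>

lemma has_derivative_suminf:
  fixes f :: "nat \<Rightarrow> 'a::real_normed_vector \<Rightarrow> 'b::banach"
  assumes S: "convex S" "open S" "x \<in> S"
    and D: "\<And>n y. y \<in> S \<Longrightarrow> (f n has_derivative f' n y) (at y)"
    and b: "\<And>n y h. y \<in> S \<Longrightarrow> norm (f' n y h) \<le> b n * norm h" and sb: "summable b"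
    and x0: "x0 \<in> S" "summable (\<lambda>n. f n x0)"
  shows "((\<lambda>y. \<Sum>n. f n y) has_derivative (\<lambda>h. \<Sum>n. f' n x h)) (at x)"
proof -
  have sb': "summable (\<lambda>n. norm (f' n y h))" if "y \<in> S" for y h
    by (rule summable_comparison_test'[OF summable_mult2[OF sb, of "norm h"]]) (use b[OF that] in auto)
  have ev: "\<forall>\<^sub>F n in sequentially. \<forall>y\<in>S. \<forall>h. norm ((\<Sum>i<n. f' i y h) - (\<Sum>i. f' i y h)) \<le> e * norm h"
    if "e > 0" for e
  proof -
    obtain N where N: "\<And>n. n \<ge> N \<Longrightarrow> norm (\<Sum>i. b (i + n)) < e"
      using suminf_exist_split[OF \<open>e > 0\<close> sb] by auto
    show ?thesis
      unfolding eventually_sequentially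
    proof (intro exI[of _ N] allI impI ballI)
      fix n y h assume n: "N \<le> n" and y: "y \<in> S"
      have s: "summable (\<lambda>i. norm (f' (i + n) y h))"
        using summable_ignore_initial_segment[OF sb'[OF y]] .
      have "norm ((\<Sum>i<n. f' i y h) - (\<Sum>i. f' i y h)) = norm (\<Sum>i. f' (i + n) y h)"
        using suminf_minus_initial_segment[OF summable_norm_cancel[OF sb'[OF y, of h]], of n]
        by (simp add: norm_minus_commute)
      also have "\<dots> \<le> (\<Sum>i. norm (f' (i + n) y h))"
        by (rule summable_norm[OF s])
      also have "\<dots> \<le> (\<Sum>i. b (i + n) * norm h)"
        by (intro suminf_le s summable_mult2 summable_ignore_initial_segment sb) (use b[OF y] in auto)
      also have "\<dots> = (\<Sum>i. b (i + n)) * norm h"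
        by (intro suminf_mult2[symmetric] summable_ignore_initial_segment sb)
      also have "\<dots> \<le> e * norm h"
        using N[OF n] by (intro mult_right_mono) auto
      finally show "norm ((\<Sum>i<n. f' i y h) - (\<Sum>i. f' i y h)) \<le> e * norm h" .
    qed
  qed
  have "\<exists>g. \<forall>y\<in>S. (\<lambda>n. f n y) sums g y \<and> (g has_derivative (\<lambda>h. \<Sum>n. f' n y h)) (at y within S)"
  proof (rule has_derivative_series[where f = f and f' = f' and x = x0])
    show "(f n has_derivative f' n y) (at y within S)" if "y \<in> S" for n y
      using D[OF that] by (rule has_derivative_at_withinI)
    show "(\<lambda>n. f n x0) sums (\<Sum>n. f n x0)" using x0(2) by (rule summable_sums)
  qed (fact S(1), fact ev, fact x0(1))
  then obtain g where g: "\<And>y. y \<in> S \<Longrightarrow> (\<lambda>n. f n y) sums g y"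
      "\<And>y. y \<in> S \<Longrightarrow> (g has_derivative (\<lambda>h. \<Sum>n. f' n y h)) (at y within S)"
    by blast
  have "(g has_derivative (\<lambda>h. \<Sum>n. f' n x h)) (at x)"
    using g(2)[OF S(3)] at_within_open[OF S(3,2)] by simp
  then show ?thesis
    by (rule has_derivative_transform_within_open[OF _ S(2,3)]) (rule sums_unique[OF g(1)])
qed

text \<open>A bound on the weighted l1 norm of the Taylor coefficients at \<open>x0\<close>. It
  stands in for a supremum over a complex disc, but is submultiplicative by the Cauchy product and
  needs no complex analysis.\<close>

definition majorized :: "(real \<Rightarrow> real) \<Rightarrow> real \<Rightarrow> real \<Rightarrow> real \<Rightarrow> bool" where
  "majorized G x0 \<rho> M \<longleftrightarrow> (\<exists>c. summable (\<lambda>m. \<bar>c m\<bar> * \<rho> ^ m) \<and> (\<Sum>m. \<bar>c m\<bar> * \<rho> ^ m) \<le> M \<and>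
     (\<forall>y. \<bar>y\<bar> \<le> \<rho> \<longrightarrow> (\<lambda>m. c m * y ^ m) sums G (x0 + y)))"

lemma majorized_mono: "majorized G x0 \<rho> M \<Longrightarrow> M \<le> M' \<Longrightarrow> majorized G x0 \<rho> M'"
  unfolding majorized_def by force

lemma majorized_const:
  assumes "\<rho> \<ge> 0" shows "majorized (\<lambda>_. a) x0 \<rho> \<bar>a\<bar>"
proof -
  have *: "(\<lambda>m. if m = 0 then u else 0) sums u" for u :: real
    by (rule sums_single)
  have 1: "(\<lambda>m. \<bar>if m = 0 then a else 0\<bar> * \<rho> ^ m) = (\<lambda>m. if m = 0 then \<bar>a\<bar> else 0)"
    and 2: "(\<lambda>m. (if m = 0 then a else 0) * y ^ m) = (\<lambda>m. if m = 0 then a else 0)" for y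
    by auto
  show ?thesis
    unfolding majorized_def
    by (intro exI[of _ "\<lambda>m. if m = 0 then a else 0"])
      (use *[of a] *[of "\<bar>a\<bar>"] in \<open>auto simp: 1 2 sums_iff\<close>)
qed

lemma majorized_id:
  assumes "\<rho> \<ge> 0" shows "majorized (\<lambda>x. x) x0 \<rho> (\<bar>x0\<bar> + \<rho>)"
proof -
  let ?c = "\<lambda>m. if m = 0 then x0 else if m = 1 then 1 else (0::real)"
  have *: "(\<lambda>m. (if m = 0 then u else if m = 1 then v else 0)) sums (u + v)" for u v :: real
    using sums_finite[of "{0, 1}" "\<lambda>m. if m = 0 then u else if m = 1 then v else 0"] by simp
  have 1: "(\<lambda>m. \<bar>?c m\<bar> * \<rho> ^ m) = (\<lambda>m. if m = 0 then \<bar>x0\<bar> else if m = 1 then \<rho> else 0)"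
    and 2: "(\<lambda>m. ?c m * y ^ m) = (\<lambda>m. if m = 0 then x0 else if m = 1 then y else 0)" for y
    by auto
  show ?thesis
    unfolding majorized_def
    by (rule exI[of _ ?c], unfold 1 2) (use *[of "\<bar>x0\<bar>" \<rho>] *[of x0] in \<open>auto simp: sums_iff\<close>)
qed

text \<open>All coefficients are nonnegative, so the norm is the value at the right end
  \<open>x0 + \<rho>\<close>. It stays exponentially small in \<open>B\<close> as long as that end
  is negative.\<close>

lemma majorized_exp:
  assumes "\<rho> \<ge> 0" "B \<ge> 0" shows "majorized (\<lambda>x. exp (B * x)) x0 \<rho> (exp (B * (x0 + \<rho>)))"
proof -
  let ?c = "\<lambda>m. exp (B * x0) * (B ^ m / fact m)"
  have *: "(\<lambda>m. ?c m * y ^ m) sums exp (B * (x0 + y))" for y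
    using sums_mult[OF exp_converges[of "B * y"], of "exp (B * x0)"]
    by (simp add: power_mult_distrib divide_inverse distrib_left exp_add mult.commute mult.left_commute)
  have 1: "\<bar>?c m\<bar> = ?c m" for m using assms by (auto simp: abs_mult)
  show ?thesis
    unfolding majorized_def
    by (rule exI[of _ ?c], unfold 1) (use * in \<open>auto simp: sums_iff\<close>)
qed

lemma majorized_mult:
  assumes F: "majorized F x0 \<rho> M" and G: "majorized G x0 \<rho> N" and r: "\<rho> \<ge> 0"
  shows "majorized (\<lambda>x. F x * G x) x0 \<rho> (M * N)"
proof -
  obtain c where c: "summable (\<lambda>m. \<bar>c m\<bar> * \<rho> ^ m)" "(\<Sum>m. \<bar>c m\<bar> * \<rho> ^ m) \<le> M"
     "\<And>y. \<bar>y\<bar> \<le> \<rho> \<Longrightarrow> (\<lambda>m. c m * y ^ m) sums F (x0 + y)"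
    using F unfolding majorized_def by auto
  obtain d where d: "summable (\<lambda>m. \<bar>d m\<bar> * \<rho> ^ m)" "(\<Sum>m. \<bar>d m\<bar> * \<rho> ^ m) \<le> N"
     "\<And>y. \<bar>y\<bar> \<le> \<rho> \<Longrightarrow> (\<lambda>m. d m * y ^ m) sums G (x0 + y)"
    using G unfolding majorized_def by auto
  define e where "e = (\<lambda>m. \<Sum>i\<le>m. c i * d (m - i))"
  have sn: "summable (\<lambda>m. norm (a m * y ^ m))" if "summable (\<lambda>m. \<bar>a m\<bar> * \<rho> ^ m)" "\<bar>y\<bar> \<le> \<rho>" for a y
    by (rule summable_comparison_test'[OF that(1)])
       (use that(2) in \<open>auto simp: abs_mult power_abs intro!: mult_left_mono power_mono\<close>)
  have eq: "(\<Sum>i\<le>m. (a i * y ^ i) * (b (m - i) * y ^ (m - i))) = (\<Sum>i\<le>m. a i * b (m - i)) * y ^ m"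
    for m and a b :: "nat \<Rightarrow> real" and y
    unfolding sum_distrib_right
  proof (intro sum.cong refl)
    fix i assume "i \<in> {..m}"
    then have "y ^ m = y ^ i * y ^ (m - i)" by (simp flip: power_add)
    then show "(a i * y ^ i) * (b (m - i) * y ^ (m - i)) = a i * b (m - i) * y ^ m" by simp
  qed
  have e: "(\<lambda>m. e m * y ^ m) sums (F (x0 + y) * G (x0 + y))" if y: "\<bar>y\<bar> \<le> \<rho>" for y
    using Cauchy_product_sums[OF sn[OF c(1) y] sn[OF d(1) y]] c(3)[OF y] d(3)[OF y]
    unfolding eq e_def by (simp add: sums_iff)
  have E: "(\<lambda>m. (\<Sum>i\<le>m. \<bar>c i\<bar> * \<bar>d (m - i)\<bar>) * \<rho> ^ m) sums ((\<Sum>m. \<bar>c m\<bar> * \<rho> ^ m) * (\<Sum>m. \<bar>d m\<bar> * \<rho> ^ m))"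
    using Cauchy_product_sums[of "\<lambda>m. \<bar>c m\<bar> * \<rho> ^ m" "\<lambda>m. \<bar>d m\<bar> * \<rho> ^ m"] c(1) d(1) r
    unfolding eq[of "\<lambda>i. \<bar>c i\<bar>" \<rho> "\<lambda>i. \<bar>d i\<bar>"] by (simp add: abs_mult)
  have le: "\<bar>e m\<bar> * \<rho> ^ m \<le> (\<Sum>i\<le>m. \<bar>c i\<bar> * \<bar>d (m - i)\<bar>) * \<rho> ^ m" for m
    unfolding e_def using r sum_abs[of "\<lambda>i. c i * d (m - i)" "{..m}"]
    by (intro mult_right_mono) (auto simp: abs_mult)
  have s: "summable (\<lambda>m. \<bar>e m\<bar> * \<rho> ^ m)"
    by (rule summable_comparison_test'[OF sums_summable[OF E]]) (use le r in auto)
  have "(\<Sum>m. \<bar>e m\<bar> * \<rho> ^ m) \<le> (\<Sum>m. \<bar>c m\<bar> * \<rho> ^ m) * (\<Sum>m. \<bar>d m\<bar> * \<rho> ^ m)"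
    using suminf_le[OF le s sums_summable[OF E]] sums_unique[OF E] by simp
  also have "\<dots> \<le> M * N"
  proof (rule mult_mono[OF c(2) d(2)])
    show "0 \<le> (\<Sum>m. \<bar>d m\<bar> * \<rho> ^ m)" using d(1) r by (intro suminf_nonneg) auto
    have "0 \<le> (\<Sum>m. \<bar>c m\<bar> * \<rho> ^ m)" using c(1) r by (intro suminf_nonneg) auto
    then show "0 \<le> M" using c(2) by linarith
  qed
  finally show ?thesis
    unfolding majorized_def using s e by (intro exI[of _ e]) auto
qed

lemma majorized_add:
  assumes F: "majorized F x0 \<rho> M" and G: "majorized G x0 \<rho> N" and r: "\<rho> \<ge> 0"
  shows "majorized (\<lambda>x. F x + G x) x0 \<rho> (M + N)"
proof -
  obtain c where c: "summable (\<lambda>m. \<bar>c m\<bar> * \<rho> ^ m)" "(\<Sum>m. \<bar>c m\<bar> * \<rho> ^ m) \<le> M"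
     "\<And>y. \<bar>y\<bar> \<le> \<rho> \<Longrightarrow> (\<lambda>m. c m * y ^ m) sums F (x0 + y)"
    using F unfolding majorized_def by auto
  obtain d where d: "summable (\<lambda>m. \<bar>d m\<bar> * \<rho> ^ m)" "(\<Sum>m. \<bar>d m\<bar> * \<rho> ^ m) \<le> N"
     "\<And>y. \<bar>y\<bar> \<le> \<rho> \<Longrightarrow> (\<lambda>m. d m * y ^ m) sums G (x0 + y)"
    using G unfolding majorized_def by auto
  have S: "summable (\<lambda>m. \<bar>c m\<bar> * \<rho> ^ m + \<bar>d m\<bar> * \<rho> ^ m)"
    using c d by (intro summable_add)
  have le: "\<bar>c m + d m\<bar> * \<rho> ^ m \<le> \<bar>c m\<bar> * \<rho> ^ m + \<bar>d m\<bar> * \<rho> ^ m" for m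
    using r by (metis abs_triangle_ineq distrib_right mult_right_mono zero_le_power)
  have s: "summable (\<lambda>m. \<bar>c m + d m\<bar> * \<rho> ^ m)"
    by (rule summable_comparison_test'[OF S]) (use le r in auto)
  have "(\<Sum>m. \<bar>c m + d m\<bar> * \<rho> ^ m) \<le> M + N"
    using suminf_le[OF le s S] suminf_add[OF c(1) d(1)] c(2) d(2) by linarith
  moreover have "(\<lambda>m. (c m + d m) * y ^ m) sums (F (x0 + y) + G (x0 + y))" if "\<bar>y\<bar> \<le> \<rho>" for y
    using sums_add[OF c(3)[OF that] d(3)[OF that]] by (simp add: distrib_right)
  ultimately show ?thesis
    unfolding majorized_def using s by (intro exI[of _ "\<lambda>m. c m + d m"]) auto
qed

lemma majorized_power:
  assumes "\<rho> \<ge> 0" shows "majorized (\<lambda>x. x ^ n) x0 \<rho> ((\<bar>x0\<bar> + \<rho>) ^ n)"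
proof (induction n)
  case 0
  show ?case using majorized_const[OF assms, of 1] by simp
next
  case (Suc n)
  show ?case using majorized_mult[OF majorized_id[OF assms] Suc assms] by simp
qed

section \<open>The profiles \<open>x ^ n * exp (B * x)\<close>\<close>

definition pow_exp :: "nat \<Rightarrow> real \<Rightarrow> real \<Rightarrow> real" where
  "pow_exp n B x = x ^ n * exp (B * x)"

text \<open>Modulus \<open>R\<close> and upper end \<open>s\<close> are kept apart: a negative
  \<open>s\<close> preserves the exponential decay, which a bound in terms of \<open>R\<close> alone
  would lose. The base \<open>1 + R\<close> allows the power \<open>m\<close> to be raised to
  \<open>n\<close>.\<close>

lemma pow_exp_bound:
  assumes "\<bar>x\<bar> \<le> R" "x \<le> s" "B \<ge> 0" "m \<le> n"
  shows "\<bar>pow_exp m B x\<bar> \<le> (1 + R) ^ n * exp (B * s)"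
proof -
  have R: "R \<ge> 0" using assms(1) by linarith
  have "\<bar>x\<bar> ^ m \<le> (1 + R) ^ m" using assms by (intro power_mono) auto
  also have "\<dots> \<le> (1 + R) ^ n" using R assms by (intro power_increasing) auto
  finally have "\<bar>x\<bar> ^ m \<le> (1 + R) ^ n" .
  then show ?thesis
    unfolding pow_exp_def abs_mult power_abs using R assms by (intro mult_mono) (auto intro: mult_left_mono)
qed

lemma majorized_pow_exp:
  assumes "\<bar>x0\<bar> + \<rho> \<le> R" "x0 + \<rho> \<le> s" "\<rho> \<ge> 0" "B \<ge> 0" "m \<le> n"
  shows "majorized (pow_exp m B) x0 \<rho> ((1 + R) ^ n * exp (B * s))"
proof -
  have R: "R \<ge> 0" using assms by linarith
  have "(\<bar>x0\<bar> + \<rho>) ^ m \<le> (1 + R) ^ m" using assms by (intro power_mono) auto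
  also have "\<dots> \<le> (1 + R) ^ n" using R assms by (intro power_increasing) auto
  finally have 1: "(\<bar>x0\<bar> + \<rho>) ^ m \<le> (1 + R) ^ n" .
  have "majorized (pow_exp m B) x0 \<rho> ((\<bar>x0\<bar> + \<rho>) ^ m * exp (B * (x0 + \<rho>)))"
    unfolding pow_exp_def using assms by (intro majorized_mult majorized_power majorized_exp)
  then show ?thesis
    by (rule majorized_mono) (use 1 R assms in \<open>auto intro!: mult_mono mult_left_mono\<close>)
qed

lemma DERIV_pow_exp: "(pow_exp (Suc n) c has_real_derivative
    (real (Suc n) * pow_exp n c x + c * pow_exp (Suc n) c x)) (at x)"
proof -
  have "((\<lambda>x. x ^ Suc n) has_real_derivative real (Suc n) * x ^ n) (at x)"
    using DERIV_pow[of "Suc n" x] by simp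
  moreover have "((\<lambda>x. exp (c * x)) has_real_derivative c * exp (c * x)) (at x)"
    by (auto intro!: derivative_eq_intros)
  ultimately show ?thesis
    unfolding pow_exp_def[abs_def] using DERIV_mult by (fastforce simp: algebra_simps)
qed

lemma summable_exp_minus: "summable (\<lambda>j. C * exp (- real j))"
proof -
  have "(\<lambda>j. exp (- real j)) = (\<lambda>j. exp (- 1) ^ j)"
    by (simp add: exp_of_nat_mult[symmetric])
  moreover have "summable (\<lambda>j. exp (- 1 :: real) ^ j)"
    by (rule summable_geometric) simp
  ultimately show ?thesis by (intro summable_mult) simp
qed

lemma one_plus_power_le: "R \<ge> 0 \<Longrightarrow> (1 + R) ^ n \<le> exp (real n * R)"
  by (simp add: exp_of_nat_mult power_mono exp_ge_add_one_self)

lemma norm_fst_le_norm: "norm (fst v) \<le> norm v"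
  by (metis norm_fst_le prod.collapse)

lemma norm_snd_le_norm: "norm (snd v) \<le> norm v"
  by (metis norm_snd_le prod.collapse)

section \<open>Lattice periodicity and elementary cosine estimates\<close>

lemma inner_int_vec: "int_vec a \<Longrightarrow> int_vec b \<Longrightarrow> a \<bullet> b \<in> \<int>"
  unfolding int_vec_def inner_vec_def by (auto intro!: Ints_sum)

lemma cos_add_Ints: "n \<in> \<int> \<Longrightarrow> cos (2 * pi * (y + n) + \<phi>) = cos (2 * pi * y + \<phi>)"
proof -
  assume "n \<in> \<int>"
  then obtain m where m: "n = of_int m" by (auto elim: Ints_cases)
  have "2 * pi * (y + n) + \<phi> = (2 * pi * y + \<phi>) + 2 * pi * of_int m" by (simp add: m algebra_simps)
  moreover have "cos (z + 2 * pi * of_int m) = cos z" for z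
    by (simp add: cos_add cos_int_2pin sin_int_2pin)
  ultimately show ?thesis by (simp only:)
qed

lemma cos_diff_le:
  fixes a y :: real
  shows "\<bar>cos (a + y) - cos a\<bar> \<le> 2" and "\<bar>cos (a + y) - cos a\<bar> \<le> \<bar>y\<bar>"
proof -
  show "\<bar>cos (a + y) - cos a\<bar> \<le> 2"
    using abs_cos_le_one[of "a + y"] abs_cos_le_one[of a] by linarith
  have "norm (cos (a + y) - cos a) \<le> 1 * norm ((a + y) - a)"
    by (rule field_differentiable_bound[where S = UNIV and f' = "\<lambda>x. - sin x"])
      (auto intro!: derivative_eq_intros)
  then show "\<bar>cos (a + y) - cos a\<bar> \<le> \<bar>y\<bar>" by simp
qed

text \<open>The two differences are \<open>- e * sin a - cos a\<close> and
  \<open>e * sin a - cos a\<close>, whose squares add up to 2. Hence a turn by one or three quarters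
  moves the cosine by at least 1, whatever the initial phase.\<close>

lemma cos_quarter_jump:
  fixes a e :: real
  assumes e: "\<bar>e\<bar> = 1"
  shows "\<exists>s\<in>{1 / 4, 3 / 4}. \<bar>cos (a + 2 * pi * (e * s)) - cos a\<bar> \<ge> 1"
proof -
  have v: "cos (3 * pi / 2) = 0" "sin (3 * pi / 2) = - 1"
    using cos_3over2_pi sin_3over2_pi by (simp_all add: mult.commute)
  have c: "cos (a + 2 * pi * (e * (1 / 4))) = - e * sin a" "cos (a + 2 * pi * (e * (3 / 4))) = e * sin a"
    using e v by (auto simp: abs_if cos_add cos_diff split: if_splits)
  show ?thesis
  proof (rule ccontr)
    assume "\<not> ?thesis"
    then have "\<bar>- e * sin a - cos a\<bar> < 1" "\<bar>e * sin a - cos a\<bar> < 1" using c by auto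
    then have "(- e * sin a - cos a)\<^sup>2 < 1" "(e * sin a - cos a)\<^sup>2 < 1"
      by (simp_all add: abs_square_less_1)
    moreover have "(- e * sin a - cos a)\<^sup>2 + (e * sin a - cos a)\<^sup>2 = 2"
    proof -
      have "e\<^sup>2 = 1" using e by (metis power2_abs one_power2)
      then have "(- e * sin a - cos a)\<^sup>2 + (e * sin a - cos a)\<^sup>2 = 2 * ((sin a)\<^sup>2 + (cos a)\<^sup>2)"
        by (simp add: power2_sum power2_diff power_mult_distrib algebra_simps)
      then show ?thesis by simp
    qed
    ultimately show False by linarith
  qed
qed

section \<open>Asymptotic polynomials and the cohomological equation\<close>

text \<open>Divide by the fastest exponential with nonzero coefficient and let \<open>\<tau>\<close>
  tend to infinity: only that coefficient survives.\<close>

lemma exp_sum_eq_0_imp: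
  fixes c \<mu> :: "'a \<Rightarrow> real"
  assumes fin: "finite A" and inj: "inj_on \<mu> A" and z: "\<And>\<tau>. (\<Sum>\<alpha>\<in>A. c \<alpha> * exp (\<tau> * \<mu> \<alpha>)) = 0" and a: "a \<in> A"
  shows "c a = 0"
proof (rule ccontr)
  assume "c a \<noteq> 0"
  define A' where "A' = {\<alpha>\<in>A. c \<alpha> \<noteq> 0}"
  have A': "finite A'" "A' \<noteq> {}" using fin a \<open>c a \<noteq> 0\<close> by (auto simp: A'_def)
  obtain b where b: "b \<in> A'" "\<And>\<alpha>. \<alpha> \<in> A' \<Longrightarrow> \<mu> \<alpha> \<le> \<mu> b"
  proof -
    have "Max (\<mu> ` A') \<in> \<mu> ` A'" using A' by (intro Max_in) auto
    then obtain b where "b \<in> A'" "\<mu> b = Max (\<mu> ` A')" by auto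
    then show thesis using that A' by auto
  qed
  have lt: "\<mu> \<alpha> < \<mu> b" if "\<alpha> \<in> A' - {b}" for \<alpha>
    using that b inj unfolding A'_def inj_on_def by (metis (mono_tags, lifting) DiffD1 DiffD2 antisym_conv1 insertCI mem_Collect_eq)
  have z': "c b + (\<Sum>\<alpha>\<in>A' - {b}. c \<alpha> * exp (- (\<mu> b - \<mu> \<alpha>) * \<tau>)) = 0" for \<tau>
  proof -
    have "(\<Sum>\<alpha>\<in>A'. c \<alpha> * exp (\<tau> * \<mu> \<alpha>)) = 0"
      using z[of \<tau>] sum.mono_neutral_left[of A A' "\<lambda>\<alpha>. c \<alpha> * exp (\<tau> * \<mu> \<alpha>)"] fin by (auto simp: A'_def)
    then have "exp (- (\<tau> * \<mu> b)) * (\<Sum>\<alpha>\<in>A'. c \<alpha> * exp (\<tau> * \<mu> \<alpha>)) = 0" by simp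
    then have "(\<Sum>\<alpha>\<in>A'. c \<alpha> * exp (- (\<mu> b - \<mu> \<alpha>) * \<tau>)) = 0"
      unfolding sum_distrib_left by (simp add: exp_minus exp_diff exp_add algebra_simps divide_inverse)
    then show ?thesis using A' b(1) by (simp add: sum.remove[of A' b])
  qed
  have "((\<lambda>\<tau>. c b + (\<Sum>\<alpha>\<in>A' - {b}. c \<alpha> * exp (- (\<mu> b - \<mu> \<alpha>) * \<tau>))) \<longlongrightarrow> c b + (\<Sum>\<alpha>\<in>A' - {b}. c \<alpha> * 0)) at_top"
  proof (intro tendsto_intros)
    fix \<alpha> assume "\<alpha> \<in> A' - {b}"
    then have "- (\<mu> b - \<mu> \<alpha>) < 0" using lt by simp
    then have "filterlim (\<lambda>\<tau>. - (\<mu> b - \<mu> \<alpha>) * \<tau>) at_bot at_top"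
      by (intro filterlim_tendsto_neg_mult_at_bot[OF tendsto_const] filterlim_ident)
    then show "((\<lambda>\<tau>. exp (- (\<mu> b - \<mu> \<alpha>) * \<tau>)) \<longlongrightarrow> 0) at_top"
      by (rule filterlim_compose[OF exp_at_bot])
  qed
  then have "((\<lambda>\<tau>::real. 0::real) \<longlongrightarrow> c b) at_top" using z' by simp
  then have "c b = 0" by (simp add: tendsto_const_iff)
  then show False using b(1) by (simp add: A'_def)
qed

text \<open>Lowest coefficient first: once the smaller ones vanish, divide by \<open>s ^ m\<close>
  and let \<open>s\<close> tend to 0 from the right.\<close>

lemma poly_small_imp_0:
  fixes h :: "nat \<Rightarrow> real"
  assumes d: "\<delta> > 0" and b: "\<And>s. 0 < s \<Longrightarrow> s < \<delta> \<Longrightarrow> \<bar>\<Sum>m\<le>n. h m * s ^ m\<bar> \<le> C * s ^ (n + 1)" and m: "m \<le> n"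
  shows "h m = 0"
  using m
proof (induction m rule: less_induct)
  case (less m)
  have "\<bar>h m + (\<Sum>i\<in>{Suc m..n}. h i * s ^ (i - m))\<bar> \<le> C * s ^ (n + 1 - m)" if s: "0 < s" "s < \<delta>" for s
  proof -
    have "(\<Sum>i\<le>n. h i * s ^ i) = (\<Sum>i\<in>{m..n}. h i * s ^ i)"
      by (rule sum.mono_neutral_right) (use less in auto)
    also have "\<dots> = h m * s ^ m + (\<Sum>i\<in>{Suc m..n}. h i * s ^ i)"
      using less.prems by (rule sum.atLeast_Suc_atMost)
    also have "\<dots> = s ^ m * (h m + (\<Sum>i\<in>{Suc m..n}. h i * s ^ (i - m)))"
      unfolding distrib_left sum_distrib_left
      by (simp add: mult.commute mult.left_commute flip: power_add)
    finally have "s ^ m * \<bar>h m + (\<Sum>i\<in>{Suc m..n}. h i * s ^ (i - m))\<bar> \<le> C * s ^ (n + 1)"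
      using b[OF s] s by (simp add: abs_mult)
    also have "s ^ (n + 1) = s ^ m * s ^ (n + 1 - m)" using less.prems by (simp flip: power_add)
    finally have "s ^ m * \<bar>h m + (\<Sum>i\<in>{Suc m..n}. h i * s ^ (i - m))\<bar> \<le> s ^ m * (C * s ^ (n + 1 - m))"
      by (simp add: mult_ac)
    then show ?thesis using s by simp
  qed
  then have "\<forall>\<^sub>F s in at_right 0. \<bar>h m + (\<Sum>i\<in>{Suc m..n}. h i * s ^ (i - m))\<bar> \<le> C * s ^ (n + 1 - m)"
    using d unfolding eventually_at_right_field by (intro exI[of _ \<delta>]) auto
  moreover have "((\<lambda>s. \<bar>h m + (\<Sum>i\<in>{Suc m..n}. h i * s ^ (i - m))\<bar>) \<longlongrightarrow> \<bar>h m + (\<Sum>i\<in>{Suc m..n}. h i * 0 ^ (i - m))\<bar>) (at_right 0)"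
    by (intro tendsto_intros)
  moreover have "((\<lambda>s. C * s ^ (n + 1 - m)) \<longlongrightarrow> C * 0 ^ (n + 1 - m)) (at_right 0)"
    by (intro tendsto_intros)
  ultimately have L: "\<bar>h m + (\<Sum>i\<in>{Suc m..n}. h i * 0 ^ (i - m))\<bar> \<le> C * 0 ^ (n + 1 - m)"
    by (intro tendsto_le[OF trivial_limit_at_right_real])
  have S: "(\<Sum>i\<in>{Suc m..n}. h i * 0 ^ (i - m)) = 0" by (intro sum.neutral) auto
  have Z: "(0::real) ^ (n + 1 - m) = 0" using less.prems by (intro zero_power) auto
  show "h m = 0" using L unfolding S Z by simp
qed

text \<open>Two multi-indices of equal weight differ by an integer vector orthogonal to
  \<open>w\<close>.\<close>

lemma non_resonant_inj:
  fixes w :: "real^'d"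
  assumes "non_resonant w"
  shows "inj (\<lambda>\<alpha> :: 'd \<Rightarrow> nat. \<Sum>i\<in>UNIV. w $ i * real (\<alpha> i))"
proof (rule injI)
  fix \<alpha> \<beta> :: "'d \<Rightarrow> nat"
  assume eq: "(\<Sum>i\<in>UNIV. w $ i * real (\<alpha> i)) = (\<Sum>i\<in>UNIV. w $ i * real (\<beta> i))"
  define v where "v = ((\<chi> i. real (\<alpha> i) - real (\<beta> i)) :: real^'d)"
  have "int_vec v" by (simp add: int_vec_def v_def)
  moreover have "w \<bullet> v = 0"
    using eq by (simp add: inner_vec_def v_def right_diff_distrib sum_subtractf)
  ultimately have "v = 0" using assms by (simp add: non_resonant_def)
  then show "\<alpha> = \<beta>" by (auto simp: v_def vec_eq_iff fun_eq_iff)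
qed

text \<open>The substitution \<open>r\<^sub>i = s exp (\<tau> w\<^sub>i)\<close> separates the monomials because \<open>w\<close> is non-resonant.\<close>
lemma mpoly_small_imp_0:
  fixes w :: "real^'d" and c :: "('d \<Rightarrow> nat) \<Rightarrow> real"
  assumes w: "non_resonant w" and d: "\<delta> > 0"
    and b: "\<And>r :: real^'d. norm r < \<delta> \<Longrightarrow> \<bar>\<Sum>\<alpha>\<in>{\<alpha>. mdeg \<alpha> \<le> n}. c \<alpha> * xmon r \<alpha>\<bar> \<le> C * norm r ^ (n + 1)"
    and a: "mdeg a \<le> n"
  shows "c a = 0"
proof -
  define \<mu> where "\<mu> = (\<lambda>\<alpha> :: 'd \<Rightarrow> nat. \<Sum>i\<in>UNIV. w $ i * real (\<alpha> i))"
  define A where "A = {\<alpha> :: 'd \<Rightarrow> nat. mdeg \<alpha> = mdeg a}"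
  have finA: "finite A" by (rule finite_subset[OF _ finite_mdeg[of "mdeg a"]]) (auto simp: A_def)
  have "(\<Sum>\<alpha>\<in>A. c \<alpha> * exp (\<tau> * \<mu> \<alpha>)) = 0" for \<tau>
  proof -
    define y where "y = ((\<chi> i. exp (\<tau> * w $ i)) :: real^'d)"
    have ny: "norm y > 0" by (simp add: y_def vec_eq_iff)
    have xy: "xmon y \<alpha> = exp (\<tau> * \<mu> \<alpha>)" for \<alpha>
      unfolding xmon_def y_def \<mu>_def
      by (simp add: sum_distrib_left exp_sum mult_ac flip: exp_of_nat_mult)
    define h where "h = (\<lambda>m. \<Sum>\<alpha>\<in>{\<alpha> :: 'd \<Rightarrow> nat. mdeg \<alpha> = m}. c \<alpha> * xmon y \<alpha>)"
    \<comment> \<open>Restriction to the ray through \<open>y\<close> groups the monomials by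
      degree, so each homogeneous part vanishes at \<open>y\<close>; varying \<open>\<tau>\<close>
      then separates the monomials inside one part.\<close>
    have "h (mdeg a) = 0"
    proof (rule poly_small_imp_0[where \<delta> = "\<delta> / norm y" and C = "C * norm y ^ (n + 1)" and n = n])
      show "\<delta> / norm y > 0" using d ny by simp
      fix s :: real assume s: "0 < s" "s < \<delta> / norm y"
      have "(\<Sum>\<alpha>\<in>{\<alpha>. mdeg \<alpha> \<le> n}. c \<alpha> * xmon (s *\<^sub>R y) \<alpha>)
         = (\<Sum>m\<le>n. \<Sum>\<alpha>\<in>{\<alpha> \<in> {\<alpha>. mdeg \<alpha> \<le> n}. mdeg \<alpha> = m}. c \<alpha> * xmon (s *\<^sub>R y) \<alpha>)"
        by (rule sum.group[symmetric]) (auto simp: finite_mdeg)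
      also have "\<dots> = (\<Sum>m\<le>n. h m * s ^ m)"
      proof (intro sum.cong refl)
        fix m assume "m \<in> {..n}"
        then have "{\<alpha> \<in> {\<alpha> :: 'd \<Rightarrow> nat. mdeg \<alpha> \<le> n}. mdeg \<alpha> = m} = {\<alpha>. mdeg \<alpha> = m}" by auto
        then show "(\<Sum>\<alpha>\<in>{\<alpha> \<in> {\<alpha>. mdeg \<alpha> \<le> n}. mdeg \<alpha> = m}. c \<alpha> * xmon (s *\<^sub>R y) \<alpha>) = h m * s ^ m"
          unfolding h_def sum_distrib_right by (intro sum.cong) (auto simp: xmon_scale)
      qed
      finally have "(\<Sum>\<alpha>\<in>{\<alpha>. mdeg \<alpha> \<le> n}. c \<alpha> * xmon (s *\<^sub>R y) \<alpha>) = (\<Sum>m\<le>n. h m * s ^ m)" .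
      moreover have "norm (s *\<^sub>R y) < \<delta>" using s ny by (simp add: pos_less_divide_eq)
      ultimately have "\<bar>\<Sum>m\<le>n. h m * s ^ m\<bar> \<le> C * norm (s *\<^sub>R y) ^ (n + 1)" using b[of "s *\<^sub>R y"] by simp
      then show "\<bar>\<Sum>m\<le>n. h m * s ^ m\<bar> \<le> C * norm y ^ (n + 1) * s ^ (n + 1)"
        using s by (simp add: power_mult_distrib mult_ac)
    qed (rule a)
    then show ?thesis unfolding h_def A_def xy .
  qed
  moreover have "inj_on \<mu> A"
    using non_resonant_inj[OF w] unfolding \<mu>_def by (rule inj_on_subset) auto
  ultimately show ?thesis
    using exp_sum_eq_0_imp[OF finA, of \<mu> c a] by (simp add: A_def)
qed

text \<open>Non-resonance is linear independence of the coordinates over the integers, the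
  hypothesis of \<open>Kronecker_thm_1\<close>. That theorem indexes them by \<open>{..<n}\<close>,
  whence the enumeration \<open>f\<close>; the l1 bound on the norm is the reason for
  \<open>\<epsilon> / real n\<close> in each coordinate.\<close>

lemma Kronecker_dense:
  fixes w a :: "real^'d"
  assumes w: "non_resonant w" and e: "\<epsilon> > 0"
  shows "\<exists>t m. int_vec m \<and> norm (t *\<^sub>R w - m - a) < \<epsilon>"
proof -
  define n where "n = CARD('d)"
  obtain f :: "nat \<Rightarrow> 'd" where f: "bij_betw f {..<n} UNIV"
    using ex_bij_betw_nat_finite[of "UNIV :: 'd set"] by (auto simp: n_def lessThan_atLeast0)
  define \<theta> where "\<theta> = (\<lambda>i. w $ f i)"
  have zero: "\<forall>i<n. u i = 0" if "(\<Sum>i<n. real_of_int (u i) * \<theta> i) = 0" for u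
  proof -
    define g where "g = the_inv_into {..<n} f"
    have gf: "g (f i) = i" if "i < n" for i
      using that f unfolding g_def by (intro the_inv_into_f_f) (auto simp: bij_betw_def)
    define v where "v = ((\<chi> x. real_of_int (u (g x))) :: real^'d)"
    have "w \<bullet> v = (\<Sum>x\<in>UNIV. w $ x * real_of_int (u (g x)))" by (simp add: inner_vec_def v_def)
    also have "\<dots> = (\<Sum>i<n. w $ f i * real_of_int (u (g (f i))))"
      by (rule sum.reindex_bij_betw[OF f, symmetric])
    also have "\<dots> = (\<Sum>i<n. real_of_int (u i) * \<theta> i)"
      by (intro sum.cong) (auto simp: gf \<theta>_def)
    finally have "w \<bullet> v = 0" using that by simp
    moreover have "int_vec v" by (simp add: int_vec_def v_def)
    ultimately have "v = 0" using w by (simp add: non_resonant_def)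
    then have "u (g x) = 0" for x by (simp add: v_def vec_eq_iff)
    then show ?thesis using gf by metis
  qed
  have inj: "inj_on \<theta> {..<n}"
  proof (rule inj_onI, rule ccontr)
    fix i m assume im: "i \<in> {..<n}" "m \<in> {..<n}" "\<theta> i = \<theta> m" "i \<noteq> m"
    let ?u = "\<lambda>x. if x = i then 1 else if x = m then - 1 else (0::int)"
    have "(\<Sum>x<n. real_of_int (?u x) * \<theta> x) = (\<Sum>x<n. (if x = i then \<theta> i else 0) + (if x = m then - \<theta> m else 0))"
      using im(4) by (intro sum.cong) auto
    also have "\<dots> = 0" using im by (simp add: sum.distrib)
    finally show False using zero[of ?u] im by auto
  qed
  \<comment> \<open>The reals as a module over the integers, so that \<open>independent\<close>
    means independence over the integers. It speaks of the set of values; injectivity of the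
    enumeration is a separate point.\<close>
  interpret module "(\<lambda>r. (*) (real_of_int r))"
    by (simp add: Modules.module.intro distrib_left mult.commute)
  have "independent (\<theta> ` {..<n})"
  proof
    assume "dependent (\<theta> ` {..<n})"
    then obtain u v where u: "v \<in> \<theta> ` {..<n}" "u v \<noteq> 0" "(\<Sum>v\<in>\<theta> ` {..<n}. real_of_int (u v) * v) = 0"
      by (subst (asm) dependent_finite) auto
    have "(\<Sum>i<n. real_of_int (u (\<theta> i)) * \<theta> i) = 0"
      using u(3) by (simp add: sum.reindex[OF inj])
    then show False using zero[of "\<lambda>i. u (\<theta> i)"] u by auto
  qed
  moreover have "\<epsilon> / real n > 0" using e by (simp add: n_def)
  ultimately obtain t h where th: "\<And>i. i < n \<Longrightarrow> \<bar>t * \<theta> i - of_int (h i) - a $ f i\<bar> < \<epsilon> / real n"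
    using Kronecker_thm_1[OF _ inj, of "\<epsilon> / real n" "\<lambda>i. a $ f i"] by blast
  define m where "m = ((\<chi> x. real_of_int (h (the_inv_into {..<n} f x))) :: real^'d)"
  have fm: "m $ f i = of_int (h i)" if "i < n" for i
    using that f by (simp add: m_def the_inv_into_f_f bij_betw_def)
  have "norm (t *\<^sub>R w - m - a) \<le> (\<Sum>x\<in>UNIV. \<bar>(t *\<^sub>R w - m - a) $ x\<bar>)" by (rule norm_le_l1_cart)
  also have "\<dots> = (\<Sum>i<n. \<bar>(t *\<^sub>R w - m - a) $ f i\<bar>)" by (rule sum.reindex_bij_betw[OF f, symmetric])
  also have "\<dots> < (\<Sum>i<n. \<epsilon> / real n)"
  proof (rule sum_strict_mono)
    show "{..<n} \<noteq> {}" by (simp add: n_def lessThan_empty_iff)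
    fix i assume "i \<in> {..<n}"
    then show "\<bar>(t *\<^sub>R w - m - a) $ f i\<bar> < \<epsilon> / real n" using th[of i] fm[of i] by (simp add: \<theta>_def)
  qed auto
  also have "\<dots> = \<epsilon>" by (simp add: n_def)
  finally have "norm (t *\<^sub>R w - m - a) < \<epsilon>" .
  moreover have "int_vec m" by (simp add: int_vec_def m_def)
  ultimately show ?thesis by blast
qed

lemma periodic_bounded:
  fixes b :: "real^'d \<Rightarrow> real"
  assumes "periodic1 b" "continuous_on UNIV b"
  shows "\<exists>M. \<forall>\<theta>. \<bar>b \<theta>\<bar> \<le> M"
proof -
  have "compact (b ` cbox 0 (\<chi> i. 1))"
    by (intro compact_continuous_image continuous_on_subset[OF assms(2)]) auto
  then have "bounded (b ` cbox 0 (\<chi> i. 1))" by (rule compact_imp_bounded)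
  then obtain M where M: "\<And>x. x \<in> cbox 0 (\<chi> i. 1) \<Longrightarrow> \<bar>b x\<bar> \<le> M"
    unfolding bounded_iff by auto
  have "\<bar>b \<theta>\<bar> \<le> M" for \<theta>
  proof -
    define m where "m = ((\<chi> i. - of_int \<lfloor>\<theta> $ i\<rfloor>) :: real^'d)"
    have "int_vec m" by (simp add: int_vec_def m_def)
    then have "b (\<theta> + m) = b \<theta>" using assms(1) by (simp add: periodic1_def)
    moreover have "\<theta> + m \<in> cbox 0 (\<chi> i. 1)"
      by (auto simp: mem_box_cart m_def) linarith
    ultimately show ?thesis using M by metis
  qed
  then show ?thesis by blast
qed

text \<open>Integration along \<open>\<theta> + t *\<^sub>R w\<close> gives the growth
  \<open>\<kappa> * t\<close>, which is impossible for a bounded function unless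
  \<open>\<kappa>\<close> is 0. Then \<open>b\<close> is constant on a line that is dense modulo the
  lattice.\<close>

lemma periodic_cohomological:
  fixes b :: "real^'d \<Rightarrow> real"
  assumes w: "non_resonant w" and D: "\<And>\<theta>. (b has_derivative D \<theta>) (at \<theta>)" and k: "\<And>\<theta>. D \<theta> w = \<kappa>" and p: "periodic1 b"
  shows "\<kappa> = 0" and "b \<theta> = b \<theta>'"
proof -
  have cont: "continuous_on UNIV b"
    using D by (meson has_derivative_continuous continuous_at_imp_continuous_on)
  obtain M where M: "\<And>\<theta>. \<bar>b \<theta>\<bar> \<le> M" using periodic_bounded[OF p cont] by blast
  have flow: "b (\<theta> + t *\<^sub>R w) = b \<theta> + \<kappa> * t" for \<theta> t
  proof -
    have "((\<lambda>t. b (\<theta> + t *\<^sub>R w) - \<kappa> * t) has_derivative (\<lambda>h. 0)) (at s within UNIV)" for s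
    proof -
      have "((\<lambda>t. \<theta> + t *\<^sub>R w) has_derivative (\<lambda>h. h *\<^sub>R w)) (at s)"
        by (auto intro!: derivative_eq_intros)
      from has_derivative_compose[OF this D]
      have "((\<lambda>t. b (\<theta> + t *\<^sub>R w)) has_derivative (\<lambda>h. D (\<theta> + s *\<^sub>R w) (h *\<^sub>R w))) (at s)" .
      moreover have "D (\<theta> + s *\<^sub>R w) (h *\<^sub>R w) = h * \<kappa>" for h
        using linear_scale[OF has_derivative_linear[OF D], of "\<theta> + s *\<^sub>R w" h w] k by simp
      ultimately have "((\<lambda>t. b (\<theta> + t *\<^sub>R w)) has_derivative (\<lambda>h. h * \<kappa>)) (at s)" by simp
      then show ?thesis by (auto intro!: derivative_eq_intros)
    qed
    from has_derivative_zero_constant[OF convex_UNIV this]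
    obtain c where "\<And>t. b (\<theta> + t *\<^sub>R w) - \<kappa> * t = c" by blast
    from this[of t] this[of 0] show ?thesis by simp
  qed
  show k0: "\<kappa> = 0"
  proof (rule ccontr)
    assume "\<kappa> \<noteq> 0"
    have "\<bar>\<kappa> * t\<bar> \<le> 2 * M" for t using flow[of 0 t] M[of "t *\<^sub>R w"] M[of 0] by simp
    from this[of "(2 * M + 1) / \<kappa>"] \<open>\<kappa> \<noteq> 0\<close> show False by simp
  qed
  show "b \<theta> = b \<theta>'"
  proof (rule ccontr)
    assume "b \<theta> \<noteq> b \<theta>'"
    then obtain d where d: "d > 0" "\<And>x. dist x \<theta>' < d \<Longrightarrow> dist (b x) (b \<theta>') < \<bar>b \<theta> - b \<theta>'\<bar>"
      using cont unfolding continuous_on_iff by (metis UNIV_I zero_less_abs_iff right_minus_eq)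
    obtain t m where tm: "int_vec m" "norm (t *\<^sub>R w - m - (\<theta>' - \<theta>)) < d"
      using Kronecker_dense[OF w d(1)] by blast
    have im: "int_vec (- m)" using tm(1) by (simp add: int_vec_def)
    have "b (\<theta> + t *\<^sub>R w + - m) = b (\<theta> + t *\<^sub>R w)" using p im unfolding periodic1_def by blast
    also have "\<dots> = b \<theta>" using flow[of \<theta> t] k0 by simp
    finally have e: "b (\<theta> + t *\<^sub>R w + - m) = b \<theta>" .
    have "dist (\<theta> + t *\<^sub>R w + - m) \<theta>' < d" using tm(2) by (simp add: dist_norm algebra_simps)
    from d(2)[OF this] show False unfolding e by (simp add: dist_real_def)
  qed
qed

lemma grad1_eqI:
  assumes "(a has_derivative D) (at \<theta>)"
  shows "grad1 a \<theta> = (\<chi> i. D (axis i 1))"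
  unfolding grad1_def using frechet_derivative_at[OF assms] by simp

lemma inner_grad1:
  fixes a :: "real^'d \<Rightarrow> real"
  assumes "(a has_derivative D) (at \<theta>)"
  shows "v \<bullet> grad1 a \<theta> = D v"
proof -
  have "D v = D (\<Sum>i\<in>UNIV. v $ i *\<^sub>R axis i 1)"
    using basis_expansion[of v] by (simp add: scalar_mult_eq_scaleR)
  also have "\<dots> = (\<Sum>i\<in>UNIV. v $ i *\<^sub>R D (axis i 1))"
    using has_derivative_linear[OF assms] by (simp add: linear_sum linear_scale)
  finally show ?thesis
    unfolding grad1_eqI[OF assms] by (simp add: inner_vec_def)
qed

section \<open>The Hamiltonian\<close>

text \<open>The growing factors in \<open>B_ge\<close> and \<open>lam_le\<close> force the ratios of
  \<open>B j\<close> to the size of \<open>k j\<close>, and of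
  \<open>- ln \<bar>w \<bullet> k j\<bar>\<close> to \<open>B j\<close>, to infinity: the first is
  used for every negative \<open>r $ l\<close>, the second for all \<open>r $ l\<close>. By
  \<open>B_step\<close> the amplitude of a term exceeds the total of the earlier ones for any fixed
  positive \<open>r $ l\<close>, once \<open>j\<close> is large. \<open>lam_step\<close> separates
  the time scales: later terms are almost at rest while term \<open>j\<close> turns.\<close>

locale sparse_frequencies =
  fixes w :: "real^'d" and l :: 'd and k :: "nat \<Rightarrow> real^'d" and B :: "nat \<Rightarrow> real"
  assumes k_l [simp]: "k j $ l = 0"
    and k_int: "int_vec (k j)"
    and k_nz: "k j \<noteq> 0"
    and lam_nz: "w \<bullet> k j \<noteq> 0"
    and B_ge: "B j \<ge> (real j + 1) * ((\<Sum>i\<in>UNIV. \<bar>k j $ i\<bar>) + real j + 2)"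
    and B_step: "B (Suc j) \<ge> (real j + 2) * (B j + real j + 3)"
    and lam_le: "\<bar>w \<bullet> k j\<bar> \<le> exp (- (real j + 1) * B j)"
    and lam_step: "\<bar>w \<bullet> k (Suc j)\<bar> \<le> \<bar>w \<bullet> k j\<bar> * exp (- (real j + 2) * B (Suc j))"
begin

definition K :: "nat \<Rightarrow> real" where "K j = (\<Sum>i\<in>UNIV. \<bar>k j $ i\<bar>)"

definition lam :: "nat \<Rightarrow> real" where "lam j = w \<bullet> k j"

definition g :: "nat \<Rightarrow> real \<Rightarrow> real" where "g j = pow_exp (j + 2) (B j)"

definition g' :: "nat \<Rightarrow> real \<Rightarrow> real" where
  "g' j x = real (j + 2) * pow_exp (j + 1) (B j) x + B j * pow_exp (j + 2) (B j) x"

definition g'' :: "nat \<Rightarrow> real \<Rightarrow> real" where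
  "g'' j x = real (j + 2) * (real (j + 1) * pow_exp j (B j) x + B j * pow_exp (j + 1) (B j) x) +
     B j * (real (j + 2) * pow_exp (j + 1) (B j) x + B j * pow_exp (j + 2) (B j) x)"

text \<open>A common bound for \<open>g j\<close>, \<open>g' j\<close> and \<open>g'' j\<close> at the points \<open>x \<le> s\<close> with \<open>\<bar>x\<bar> \<le> R\<close>.\<close>
definition bd :: "nat \<Rightarrow> real \<Rightarrow> real \<Rightarrow> real" where
  "bd j R s = (real j + 3 + B j)\<^sup>2 * ((1 + R) ^ (j + 2) * exp (B j * s))"

lemma K_nonneg: "K j \<ge> 0" unfolding K_def by (intro sum_nonneg) auto

lemma norm_k_le: "norm (k j) \<le> K j" unfolding K_def by (rule norm_le_l1_cart)

lemma k_coord_le: "\<bar>k j $ i\<bar> \<le> K j"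
  using component_le_norm_cart[of "k j" i] norm_k_le[of j] by linarith

lemma norm_k_ge_1: "norm (k j) \<ge> 1"
proof -
  obtain i where i: "k j $ i \<noteq> 0" using k_nz[of j] by (auto simp: vec_eq_iff)
  then have "\<bar>k j $ i\<bar> \<ge> 1" using k_int[of j] unfolding int_vec_def by (metis Ints_nonzero_abs_ge1)
  then show ?thesis using component_le_norm_cart[of "k j" i] by linarith
qed

lemma B_ge': "B j \<ge> (real j + 1) * (K j + real j + 2)"
  using B_ge unfolding K_def .

lemma B_ge_T: "B j \<ge> K j + real j + 2"
proof -
  have "1 * (K j + real j + 2) \<le> (real j + 1) * (K j + real j + 2)"
    using K_nonneg[of j] by (intro mult_right_mono) auto
  then show ?thesis using B_ge'[of j] by simp
qed

lemma B_ge_2: "B j \<ge> 2"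
  using B_ge_T[of j] K_nonneg[of j] by simp

lemma B_nonneg [simp]: "B j \<ge> 0"
  using B_ge_2[of j] by simp

lemma lam_pos: "\<bar>lam j\<bar> > 0" using lam_nz by (simp add: lam_def)

lemma DERIV_g: "(g j has_real_derivative g' j x) (at x)"
  unfolding g_def g'_def using DERIV_pow_exp[of "j + 1"] by simp

lemma DERIV_g': "(g' j has_real_derivative g'' j x) (at x)"
  unfolding g'_def[abs_def] g''_def using DERIV_pow_exp[of "j + 1" "B j" x] DERIV_pow_exp[of "j" "B j" x]
  by (auto intro!: derivative_eq_intros)

lemma bd_nonneg: "R \<ge> 0 \<Longrightarrow> bd j R s \<ge> 0"
  unfolding bd_def by auto

text \<open>Each derivative costs at most the factor \<open>N = j + 3 + B j\<close>, and
  \<open>bd\<close> contains \<open>N\<close> squared, enough for two derivatives.\<close>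

lemma
  assumes "\<bar>x\<bar> \<le> R" "x \<le> s"
  shows g_bound: "\<bar>g j x\<bar> \<le> bd j R s" and g'_bound: "\<bar>g' j x\<bar> \<le> bd j R s"
    and g''_bound: "\<bar>g'' j x\<bar> \<le> bd j R s"
proof -
  define N where "N = real j + 3 + B j"
  define E where "E = (1 + R) ^ (j + 2) * exp (B j * s)"
  have R: "R \<ge> 0" using assms(1) by linarith
  have E: "E \<ge> 0" unfolding E_def using R by simp
  have p: "\<bar>pow_exp m (B j) x\<bar> \<le> E" if "m \<le> j + 2" for m
    unfolding E_def by (rule pow_exp_bound) (use assms that in auto)
  have N1: "N \<ge> 1" "N \<ge> real (j + 2) + B j" "real (j + 1) \<le> real (j + 2)" unfolding N_def using B_nonneg[of j] by linarith+
  have lin: "\<bar>a * u + b * v\<bar> \<le> (a + b) * c" if "\<bar>u\<bar> \<le> c" "\<bar>v\<bar> \<le> c" "a \<ge> 0" "b \<ge> 0" for a b c u v :: real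
    using abs_triangle_ineq[of "a * u" "b * v"] mult_left_mono[OF that(1,3)] mult_left_mono[OF that(2,4)] that
    by (simp add: abs_mult algebra_simps)
  have 1: "\<bar>real (j + 2) * u + B j * v\<bar> \<le> N * c" if "\<bar>u\<bar> \<le> c" "\<bar>v\<bar> \<le> c" for c u v
  proof -
    have "c \<ge> 0" using that by linarith
    then show ?thesis
      using lin[OF that, of "real (j + 2)" "B j"] mult_right_mono[OF N1(2), of c] by simp
  qed
  have 2: "\<bar>real (j + 1) * u + B j * v\<bar> \<le> N * c" if "\<bar>u\<bar> \<le> c" "\<bar>v\<bar> \<le> c" for c u v
  proof -
    have "c \<ge> 0" using that by linarith
    then show ?thesis
      using lin[OF that, of "real (j + 1)" "B j"] mult_right_mono[of "real (j + 1) + B j" N c] N1 by simp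
  qed
  have NE2: "E \<le> N * E"
    using mult_right_mono[OF N1(1) E] by simp
  have NE1: "N * E \<le> N * (N * E)"
    using mult_left_mono[OF NE2, of N] N1(1) by simp
  note NE = NE1 NE2
  have bd: "bd j R s = N * (N * E)"
    unfolding bd_def N_def E_def by (simp add: power2_eq_square)
  show "\<bar>g j x\<bar> \<le> bd j R s" unfolding bd using p[of "j + 2"] NE by (simp add: g_def)
  show "\<bar>g' j x\<bar> \<le> bd j R s" unfolding bd g'_def
    by (rule order_trans[OF 1 NE(1)]) (use p in auto)
  show "\<bar>g'' j x\<bar> \<le> bd j R s" unfolding bd g''_def
    by (intro 1 2 p) auto
qed

lemma
  assumes "R \<ge> 0"
  defines "E \<equiv> \<lambda>j s. (1 + R) ^ (j + 2) * exp (B j * s)"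
  shows weight_le_bd: "E j s \<le> bd j R s"
    and linear_weight_le_bd: "(real (j + 2) + B j) * E j s \<le> bd j R s"
proof -
  define N where "N = real j + 3 + B j"
  have E: "E j s \<ge> 0" unfolding E_def using assms(1) by simp
  have N: "1 \<le> N" "real (j + 2) + B j \<le> N" unfolding N_def using B_nonneg[of j] by linarith+
  have "N * 1 \<le> N * N" using N by (intro mult_left_mono) auto
  then have "1 \<le> N * N" "real (j + 2) + B j \<le> N * N" using N by linarith+
  moreover have "bd j R s = N * N * E j s"
    unfolding bd_def N_def E_def by (simp add: power2_eq_square)
  ultimately show "E j s \<le> bd j R s" "(real (j + 2) + B j) * E j s \<le> bd j R s"
    using mult_right_mono[OF _ E] by fastforce+
qed

lemma
  assumes "\<bar>x0\<bar> + \<rho> \<le> R" "x0 + \<rho> \<le> s" "\<rho> \<ge> 0"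
  shows majorized_g: "majorized (g j) x0 \<rho> (bd j R s)"
    and majorized_g': "majorized (g' j) x0 \<rho> (bd j R s)"
proof -
  define E where "E = (1 + R) ^ (j + 2) * exp (B j * s)"
  have R: "R \<ge> 0" using assms by linarith
  have p: "majorized (pow_exp m (B j)) x0 \<rho> E" if "m \<le> j + 2" for m
    unfolding E_def by (rule majorized_pow_exp) (use assms that in auto)
  show "majorized (g j) x0 \<rho> (bd j R s)"
    unfolding g_def by (rule majorized_mono[OF p]) (use weight_le_bd[OF R] E_def in auto)
  have "majorized (g' j) x0 \<rho> (\<bar>real (j + 2)\<bar> * E + \<bar>B j\<bar> * E)"
    unfolding g'_def[abs_def] using assms(3)
    by (intro majorized_add majorized_mult majorized_const p) auto
  moreover have "\<bar>real (j + 2)\<bar> * E + \<bar>B j\<bar> * E = (real (j + 2) + B j) * E" by (simp add: distrib_right)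
  ultimately show "majorized (g' j) x0 \<rho> (bd j R s)"
    using linear_weight_le_bd[OF R, of j s] unfolding E_def[symmetric] by (auto intro: majorized_mono)
qed

lemma quadratic_le_B: "(real j + 3 + B j)\<^sup>2 \<le> (3 * B j)\<^sup>2"
  using B_ge_T[of j] K_nonneg[of j] by (intro power_mono) auto

text \<open>Half of the decay \<open>exp (- \<delta> * B j)\<close> cancels the quadratic prefactor.
  The other half beats the exponents \<open>a * K j\<close> and \<open>R * (j + 2)\<close> by
  \<open>B_ge\<close>, once \<open>j\<close> is large compared with
  \<open>(a + R + 1) / \<delta>\<close>.\<close>

lemma summable_neg:
  assumes d: "\<delta> > 0" and R: "R \<ge> 0" and a: "a \<ge> 0"
  shows "summable (\<lambda>j. exp (a * K j) * bd j R (- \<delta>))"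
proof -
  obtain n0 :: nat where n0: "real n0 \<ge> (a + R + 1) * 2 / \<delta>" using real_arch_simple by blast
  show ?thesis
  proof (rule summable_comparison_test'[OF summable_exp_minus[of "144 / \<delta>\<^sup>2"], of n0])
    fix j assume "n0 \<le> j"
    then have "real j + 1 \<ge> (a + R + 1) * 2 / \<delta>" using n0 by linarith
    then have j: "\<delta> / 2 * (real j + 1) \<ge> a + R + 1" using d by (simp add: field_simps)
    define T where "T = K j + real j + 2"
    have T: "T \<ge> real j" "T \<ge> 0" "a * K j \<le> a * T" "R * (real j + 2) \<le> R * T"
      unfolding T_def using K_nonneg[of j] a R by (auto intro: mult_left_mono)
    have "(a + R + 1) * T \<le> \<delta> / 2 * (real j + 1) * T"
      by (rule mult_right_mono[OF j T(2)])
    also have "\<dots> \<le> \<delta> / 2 * B j"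
      using mult_left_mono[OF B_ge'[of j], of "\<delta> / 2"] d unfolding T_def by (simp add: mult.assoc)
    finally have ex: "a * K j + R * (real j + 2) - \<delta> / 2 * B j \<le> - real j"
      using T by (simp add: algebra_simps)
    \<comment> \<open>From \<open>y \<le> exp y\<close> with \<open>y = \<delta> / 4 * B j\<close>;
      squaring \<open>3 * B j\<close> produces the constant
      \<open>144 / \<delta>\<^sup>2\<close>.\<close>
    have "\<delta> / 4 * B j \<le> exp (\<delta> / 4 * B j)"
      using exp_ge_add_one_self[of "\<delta> / 4 * B j"] by linarith
    then have "3 * B j \<le> 12 / \<delta> * exp (\<delta> / 4 * B j)" using d by (simp add: field_simps)
    then have "(3 * B j)\<^sup>2 \<le> (12 / \<delta> * exp (\<delta> / 4 * B j))\<^sup>2" using B_nonneg[of j] by (intro power_mono) auto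
    also have "\<dots> = 144 / \<delta>\<^sup>2 * exp (\<delta> / 2 * B j)"
      by (simp add: power_mult_distrib power_divide exp_double[symmetric])
    finally have q: "(real j + 3 + B j)\<^sup>2 \<le> 144 / \<delta>\<^sup>2 * exp (\<delta> / 2 * B j)"
      using quadratic_le_B[of j] by linarith
    have "bd j R (- \<delta>) \<le> 144 / \<delta>\<^sup>2 * exp (\<delta> / 2 * B j) * (exp (real (j + 2) * R) * exp (B j * (- \<delta>)))"
      unfolding bd_def using R by (intro mult_mono q one_plus_power_le) auto
    then have "exp (a * K j) * bd j R (- \<delta>) \<le>
       exp (a * K j) * (144 / \<delta>\<^sup>2 * exp (\<delta> / 2 * B j) * (exp (real (j + 2) * R) * exp (B j * (- \<delta>))))"
      by (intro mult_left_mono) auto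
    also have "\<dots> = 144 / \<delta>\<^sup>2 * exp (a * K j + R * (real j + 2) - \<delta> / 2 * B j)"
      by (simp add: exp_add[symmetric] algebra_simps)
    also have "\<dots> \<le> 144 / \<delta>\<^sup>2 * exp (- real j)"
      using ex by (intro mult_left_mono) auto
    finally show "norm (exp (a * K j) * bd j R (- \<delta>)) \<le> 144 / \<delta>\<^sup>2 * exp (- real j)"
      using bd_nonneg[OF R, of j "- \<delta>"] by simp
  qed
qed

lemma B_le_exp: "B j \<le> exp (B j)"
  using exp_ge_add_one_self[of "B j"] by linarith

lemma weight_le:
  assumes R: "R \<ge> 0" and a: "a \<ge> 0"
  shows "exp (a * K j) * bd j R s \<le> 9 * exp ((a + R + 2 + \<bar>s\<bar>) * B j)"
proof -
  have "(3 * B j)\<^sup>2 \<le> (3 * exp (B j))\<^sup>2" using B_le_exp[of j] by (intro power_mono) auto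
  then have q: "(real j + 3 + B j)\<^sup>2 \<le> 9 * exp (2 * B j)"
    using quadratic_le_B[of j] by (simp add: power_mult_distrib exp_double[symmetric])
  have T: "a * K j \<le> a * B j" "R * (real j + 2) \<le> R * B j" "B j * s \<le> \<bar>s\<bar> * B j"
    using B_ge_T[of j] K_nonneg[of j] a R
    by (auto intro!: mult_left_mono simp: mult.commute[of "B j"] mult_right_mono)
  have "bd j R s \<le> 9 * exp (2 * B j) * (exp (real (j + 2) * R) * exp (B j * s))"
    unfolding bd_def using R by (intro mult_mono q one_plus_power_le) auto
  then have "exp (a * K j) * bd j R s \<le>
     exp (a * K j) * (9 * exp (2 * B j) * (exp (real (j + 2) * R) * exp (B j * s)))"
    by (intro mult_left_mono) auto
  also have "\<dots> = 9 * exp (a * K j + R * (real j + 2) + 2 * B j + B j * s)"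
    by (simp add: exp_add[symmetric] algebra_simps)
  also have "\<dots> \<le> 9 * exp ((a + R + 2 + \<bar>s\<bar>) * B j)"
    using T by (simp add: algebra_simps)
  finally show ?thesis .
qed

text \<open>Every weight is at most the exponential of a fixed multiple of \<open>B j\<close>, while
  \<open>lam j\<close> decays with the rate \<open>(j + 1) * B j\<close>; so no sign condition on
  \<open>s\<close> is needed.\<close>

lemma summable_lam:
  assumes R: "R \<ge> 0" and a: "a \<ge> 0"
  shows "summable (\<lambda>j. \<bar>lam j\<bar> * (exp (a * K j) * bd j R s))"
proof -
  obtain n0 :: nat where n0: "real n0 \<ge> a + R + 2 + \<bar>s\<bar>" using real_arch_simple by blast
  show ?thesis
  proof (rule summable_comparison_test'[OF summable_exp_minus[of 9], of n0])
    fix j assume "n0 \<le> j"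
    then have "real j \<ge> a + R + 2 + \<bar>s\<bar>" using n0 by linarith
    then have "(a + R + 2 + \<bar>s\<bar>) * B j \<le> real j * B j" by (intro mult_right_mono) auto
    moreover have "B j \<ge> real j" using B_ge_T[of j] K_nonneg[of j] by linarith
    ultimately have ex: "- (real j + 1) * B j + (a + R + 2 + \<bar>s\<bar>) * B j \<le> - real j"
      by (simp add: algebra_simps)
    have "\<bar>lam j\<bar> * (exp (a * K j) * bd j R s) \<le> exp (- (real j + 1) * B j) * (9 * exp ((a + R + 2 + \<bar>s\<bar>) * B j))"
      using lam_le[of j] weight_le[OF R a, of j s] bd_nonneg[OF R] by (intro mult_mono[of "\<bar>lam j\<bar>"]) (auto simp: lam_def)
    also have "\<dots> = 9 * exp (- (real j + 1) * B j + (a + R + 2 + \<bar>s\<bar>) * B j)"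
      by (simp add: exp_add)
    also have "\<dots> \<le> 9 * exp (- real j)" using ex by simp
    finally show "norm (\<bar>lam j\<bar> * (exp (a * K j) * bd j R s)) \<le> 9 * exp (- real j)"
      using bd_nonneg[OF R, of j s] by simp
  qed
qed

section \<open>Trigonometric series with sparse frequencies\<close>

text \<open>Sine series have the phase \<open>\<phi> = - \<pi> / 2\<close>, so that differentiation only shifts \<open>\<phi>\<close> by \<open>\<pi> / 2\<close>.\<close>
definition trig :: "(nat \<Rightarrow> real \<Rightarrow> real) \<Rightarrow> real \<Rightarrow> (nat \<Rightarrow> 'b::banach) \<Rightarrow> real^'d \<Rightarrow> real \<Rightarrow> 'b" where
  "trig G \<phi> u \<theta> x = (\<Sum>j. (G j x * cos (2 * pi * (k j \<bullet> \<theta>) + \<phi>)) *\<^sub>R u j)"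

lemma trig_summable_norm:
  assumes "\<And>j. \<bar>G j x\<bar> \<le> M j" "summable (\<lambda>j. norm (u j) * M j)"
  shows "summable (\<lambda>j. norm ((G j x * cos (2 * pi * (k j \<bullet> \<theta>) + \<phi>)) *\<^sub>R u j))"
proof (rule summable_comparison_test'[OF assms(2)])
  fix j
  have "\<bar>G j x\<bar> * \<bar>cos (2 * pi * (k j \<bullet> \<theta>) + \<phi>)\<bar> \<le> M j * 1"
    using assms(1)[of j] by (intro mult_mono) auto
  then show "norm (norm ((G j x * cos (2 * pi * (k j \<bullet> \<theta>) + \<phi>)) *\<^sub>R u j)) \<le> norm (u j) * M j"
    using mult_left_mono[of _ "M j" "norm (u j)"] by (simp add: abs_mult mult.commute[of _ "norm (u j)"])
qed

lemma trig_summable: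
  fixes u :: "nat \<Rightarrow> 'b::banach"
  assumes "\<And>j. \<bar>G j x\<bar> \<le> M j" "summable (\<lambda>j. norm (u j) * M j)"
  shows "summable (\<lambda>j. (G j x * cos (2 * pi * (k j \<bullet> \<theta>) + \<phi>)) *\<^sub>R u j)"
  by (rule summable_norm_cancel, rule trig_summable_norm[of G x M u]) (use assms in auto)

lemma trig_inner:
  fixes u :: "nat \<Rightarrow> 'b::euclidean_space"
  assumes "\<And>j. \<bar>G j x\<bar> \<le> M j" "summable (\<lambda>j. norm (u j) * M j)"
  shows "v \<bullet> trig G \<phi> u \<theta> x = trig G \<phi> (\<lambda>j. v \<bullet> u j) \<theta> x"
  using bounded_linear.suminf[OF bounded_linear_inner_right[of v] trig_summable[of G x M u \<theta> \<phi>]] assms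
  unfolding trig_def by simp

lemma trig_nth:
  fixes u :: "nat \<Rightarrow> real^'n"
  assumes "\<And>j. \<bar>G j x\<bar> \<le> M j" "summable (\<lambda>j. norm (u j) * M j)"
  shows "trig G \<phi> u \<theta> x $ i = trig G \<phi> (\<lambda>j. u j $ i) \<theta> x"
  using bounded_linear.suminf[OF bounded_linear_vec_nth[of i] trig_summable[of G x M u \<theta> \<phi>]] assms
  unfolding trig_def by simp

lemma exp_K_ge: "1 \<le> exp (K j)" "K j \<le> exp (K j)"
  using K_nonneg[of j] exp_ge_add_one_self[of "K j"] by (simp, linarith)

text \<open>\<open>exp (K j)\<close> dominates both 1 and the norm of \<open>k j\<close>, so one
  weighted hypothesis covers the series itself and its derivative in the angles.\<close>

lemma summable_weaken:
  assumes "summable (\<lambda>j. norm (u j) * (exp (K j) * M j))" "\<And>j. M j \<ge> 0"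
  shows "summable (\<lambda>j. norm (u j) * M j)"
    and "(\<And>j. \<bar>a j\<bar> \<le> norm (u j)) \<Longrightarrow> summable (\<lambda>j. norm ((c * a j) *\<^sub>R k j) * M j)"
proof -
  show "summable (\<lambda>j. norm (u j) * M j)"
  proof (rule summable_comparison_test'[OF assms(1)])
    fix j
    have "norm (u j) * (1 * M j) \<le> norm (u j) * (exp (K j) * M j)"
      using assms(2)[of j] exp_K_ge(1)[of j] by (intro mult_left_mono mult_right_mono) auto
    then show "norm (norm (u j) * M j) \<le> norm (u j) * (exp (K j) * M j)"
      using assms(2)[of j] by simp
  qed
  assume a: "\<And>j. \<bar>a j\<bar> \<le> norm (u j)"
  show "summable (\<lambda>j. norm ((c * a j) *\<^sub>R k j) * M j)"
  proof (rule summable_comparison_test'[OF summable_mult[OF assms(1), of "\<bar>c\<bar>"]])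
    fix j
    have "\<bar>a j\<bar> * norm (k j) * M j \<le> norm (u j) * exp (K j) * M j"
      using a[of j] norm_k_le[of j] exp_K_ge[of j] assms(2)[of j] by (intro mult_mono) auto
    then have "\<bar>c\<bar> * (\<bar>a j\<bar> * norm (k j) * M j) \<le> \<bar>c\<bar> * (norm (u j) * exp (K j) * M j)"
      by (intro mult_left_mono) auto
    then show "norm (norm ((c * a j) *\<^sub>R k j) * M j) \<le> \<bar>c\<bar> * (norm (u j) * (exp (K j) * M j))"
      using assms(2)[of j] by (simp add: abs_mult mult.assoc)
  qed
qed

lemma trig_has_derivative:
  fixes u :: "nat \<Rightarrow> real"
  assumes r: "r $ l \<in> {a<..<b}"
    and D: "\<And>j y. y \<in> {a<..<b} \<Longrightarrow> (G j has_real_derivative G' j y) (at y)"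
    and M: "\<And>j y. y \<in> {a<..<b} \<Longrightarrow> \<bar>G j y\<bar> \<le> M j" "\<And>j y. y \<in> {a<..<b} \<Longrightarrow> \<bar>G' j y\<bar> \<le> M j"
    and s: "summable (\<lambda>j. norm (u j) * (exp (K j) * M j))"
  shows "((\<lambda>p. trig G \<phi> u (fst p) (snd p $ l)) has_derivative
      (\<lambda>v. snd v $ l * trig G' \<phi> u \<theta> (r $ l) +
           fst v \<bullet> trig G (\<phi> + pi / 2) (\<lambda>j. (2 * pi * u j) *\<^sub>R k j) \<theta> (r $ l))) (at (\<theta>, r))"
proof -
  define S where "S = {p :: (real^'d) \<times> (real^'d). snd p $ l \<in> {a<..<b}}"
  define f where "f = (\<lambda>j (p :: (real^'d) \<times> (real^'d)). (G j (snd p $ l) * cos (2 * pi * (k j \<bullet> fst p) + \<phi>)) *\<^sub>R u j)"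
  define f' where "f' = (\<lambda>j (p :: (real^'d) \<times> (real^'d)) v.
     (G' j (snd p $ l) * (snd v $ l) * cos (2 * pi * (k j \<bullet> fst p) + \<phi>)
      - G j (snd p $ l) * (2 * pi * (k j \<bullet> fst v)) * sin (2 * pi * (k j \<bullet> fst p) + \<phi>)) *\<^sub>R u j)"
  have M0: "M j \<ge> 0" for j using M(1)[OF r, of j] by linarith
  have "convex S"
    unfolding S_def convex_def
  proof (clarify, simp only: snd_add snd_scaleR vector_add_component vector_scaleR_component, goal_cases)
    case (1 a1 b1 a2 b2 u v)
    have "convex {a<..<b}" by (rule convex_real_interval)
    then have "u *\<^sub>R (b1 $ l) + v *\<^sub>R (b2 $ l) \<in> {a<..<b}"
      using 1 by (intro convexD) auto
    then show ?case by simp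
  qed
  have "open S"
  proof -
    have "S = (\<lambda>p. snd p $ l) -` {a<..<b}" by (auto simp: S_def)
    moreover have "open ((\<lambda>p :: (real^'d) \<times> (real^'d). snd p $ l) -` {a<..<b})"
      by (intro open_vimage continuous_intros open_greaterThanLessThan)
    ultimately show ?thesis by simp
  qed
  have pS: "(\<theta>, r) \<in> S" using r by (simp add: S_def)
  have Df: "(f j has_derivative f' j p) (at p)" if "p \<in> S" for j p
  proof -
    have 1: "((\<lambda>p. G j (snd p $ l)) has_derivative (\<lambda>v. (snd v $ l) * G' j (snd p $ l))) (at p)"
      by (rule DERIV_compose_FDERIV[OF D]) (use that in \<open>auto simp: S_def intro!: bounded_linear_imp_has_derivative
          bounded_linear_compose[OF bounded_linear_vec_nth bounded_linear_snd]\<close>)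
    show ?thesis
      unfolding f_def f'_def real_scaleR_def
      by (auto intro!: derivative_eq_intros 1 simp: fun_eq_iff algebra_simps)
  qed
  \<comment> \<open>The constant 8 is 1 for the derivative in \<open>r $ l\<close> plus 7, a bound
    for \<open>2 * pi\<close>, for the derivative in the angles.\<close>
  have bf: "norm (f' j p v) \<le> 8 * (norm (u j) * (exp (K j) * M j)) * norm v" if "p \<in> S" for j p v
  proof -
    have p: "snd p $ l \<in> {a<..<b}" using that by (simp add: S_def)
    have v: "\<bar>snd v $ l\<bar> \<le> norm v" "norm (fst v) \<le> norm v"
      using component_le_norm_cart[of "snd v" l] norm_snd_le_norm[of v] norm_fst_le_norm[of v] by auto
    have kv: "\<bar>k j \<bullet> fst v\<bar> \<le> exp (K j) * norm v"
      using Cauchy_Schwarz_ineq2[of "k j" "fst v"] norm_k_le[of j] exp_K_ge(2)[of j] v(2)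
      by (smt (verit) exp_ge_zero mult_mono norm_ge_zero)
    have "\<bar>G' j (snd p $ l) * (snd v $ l) * cos (2 * pi * (k j \<bullet> fst p) + \<phi>)\<bar> \<le> M j * norm v * 1"
      unfolding abs_mult using M(2)[OF p, of j] v M0[of j] by (intro mult_mono) auto
    also have "\<dots> \<le> M j * norm v * exp (K j)"
      using exp_K_ge(1)[of j] M0[of j] by (intro mult_left_mono) auto
    finally have t1: "\<bar>G' j (snd p $ l) * (snd v $ l) * cos (2 * pi * (k j \<bullet> fst p) + \<phi>)\<bar> \<le> M j * norm v * exp (K j)" .
    have "\<bar>G j (snd p $ l) * (2 * pi * (k j \<bullet> fst v)) * sin (2 * pi * (k j \<bullet> fst p) + \<phi>)\<bar>
      \<le> M j * (2 * pi * (exp (K j) * norm v)) * 1"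
      unfolding abs_mult using M(1)[OF p, of j] kv M0[of j] by (intro mult_mono) auto
    also have "\<dots> = (2 * pi) * (M j * exp (K j) * norm v)" by simp
    also have "\<dots> \<le> 7 * (M j * exp (K j) * norm v)"
      using M0[of j] pi_approx by (intro mult_right_mono) auto
    finally have t2: "\<bar>G j (snd p $ l) * (2 * pi * (k j \<bullet> fst v)) * sin (2 * pi * (k j \<bullet> fst p) + \<phi>)\<bar>
      \<le> 7 * (M j * exp (K j) * norm v)" .
    have "norm (f' j p v) \<le> (8 * (M j * exp (K j) * norm v)) * \<bar>u j\<bar>"
      unfolding f'_def real_scaleR_def real_norm_def abs_mult[of _ "u j"]
    proof (intro mult_right_mono)
      have "M j * norm v * exp (K j) = M j * exp (K j) * norm v" by simp
      then show "\<bar>G' j (snd p $ l) * (snd v $ l) * cos (2 * pi * (k j \<bullet> fst p) + \<phi>)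
        - G j (snd p $ l) * (2 * pi * (k j \<bullet> fst v)) * sin (2 * pi * (k j \<bullet> fst p) + \<phi>)\<bar>
        \<le> 8 * (M j * exp (K j) * norm v)"
        using t1 t2 by linarith
    qed simp
    then show ?thesis by (simp add: mult_ac)
  qed
  have "((\<lambda>p. \<Sum>j. f j p) has_derivative (\<lambda>h. \<Sum>j. f' j (\<theta>, r) h)) (at (\<theta>, r))"
  proof (rule has_derivative_suminf[OF \<open>convex S\<close> \<open>open S\<close> pS Df bf _ pS])
    show "summable (\<lambda>j. 8 * (norm (u j) * (exp (K j) * M j)))" by (intro summable_mult s)
    show "summable (\<lambda>j. f j (\<theta>, r))"
      unfolding f_def using trig_summable[of G "r $ l" M u] M(1)[OF r] summable_weaken(1)[OF s M0] by simp
  qed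
  moreover have "(\<Sum>j. f' j (\<theta>, r) v) = snd v $ l * trig G' \<phi> u \<theta> (r $ l) +
           fst v \<bullet> trig G (\<phi> + pi / 2) (\<lambda>j. (2 * pi * u j) *\<^sub>R k j) \<theta> (r $ l)" for v
  proof -
    have s1: "summable (\<lambda>j. (G' j (r $ l) * cos (2 * pi * (k j \<bullet> \<theta>) + \<phi>)) *\<^sub>R u j)"
      by (rule trig_summable[where M = M]) (use M(2)[OF r] summable_weaken(1)[OF s M0] in auto)
    have sm: "summable (\<lambda>j. norm ((2 * pi * u j) *\<^sub>R k j) * M j)"
      by (rule summable_weaken(2)[OF s M0]) auto
    have s2: "summable (\<lambda>j. (G j (r $ l) * cos (2 * pi * (k j \<bullet> \<theta>) + (\<phi> + pi / 2))) *\<^sub>R (2 * pi * u j) *\<^sub>R k j)"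
      by (rule trig_summable[where M = M]) (use M(1)[OF r] sm in auto)
    have s2': "summable (\<lambda>j. fst v \<bullet> (G j (r $ l) * cos (2 * pi * (k j \<bullet> \<theta>) + (\<phi> + pi / 2))) *\<^sub>R (2 * pi * u j) *\<^sub>R k j)"
      by (rule bounded_linear.summable[OF bounded_linear_inner_right s2])
    have c: "cos (y + (\<phi> + pi / 2)) = - sin (y + \<phi>)" for y
      using minus_sin_cos_eq[of "y + \<phi>"] by (simp add: add.assoc)
    have "(\<Sum>j. f' j (\<theta>, r) v) = (\<Sum>j. snd v $ l * ((G' j (r $ l) * cos (2 * pi * (k j \<bullet> \<theta>) + \<phi>)) *\<^sub>R u j) +
       fst v \<bullet> (G j (r $ l) * cos (2 * pi * (k j \<bullet> \<theta>) + (\<phi> + pi / 2))) *\<^sub>R (2 * pi * u j) *\<^sub>R k j)"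
      unfolding f'_def c by (simp add: algebra_simps inner_commute)
    also have "\<dots> = snd v $ l * trig G' \<phi> u \<theta> (r $ l) +
        (\<Sum>j. fst v \<bullet> (G j (r $ l) * cos (2 * pi * (k j \<bullet> \<theta>) + (\<phi> + pi / 2))) *\<^sub>R (2 * pi * u j) *\<^sub>R k j)"
      unfolding trig_def suminf_mult[OF s1, symmetric]
      by (rule suminf_add[symmetric, OF summable_mult[OF s1] s2'])
    also have "(\<Sum>j. fst v \<bullet> (G j (r $ l) * cos (2 * pi * (k j \<bullet> \<theta>) + (\<phi> + pi / 2))) *\<^sub>R (2 * pi * u j) *\<^sub>R k j)
       = fst v \<bullet> trig G (\<phi> + pi / 2) (\<lambda>j. (2 * pi * u j) *\<^sub>R k j) \<theta> (r $ l)"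
      unfolding trig_def by (rule bounded_linear.suminf[OF bounded_linear_inner_right s2, symmetric])
    finally show ?thesis .
  qed
  ultimately show ?thesis
    by (simp add: f_def trig_def)
qed

text \<open>The coefficient family depends on \<open>p0\<close> only, whereas \<open>\<rho>\<close>
  and \<open>M\<close> may be chosen for each \<open>p\<close>. One family can thus serve at all
  points of space, as real entireness demands.\<close>

lemma trig_ps_at:
  fixes u :: "nat \<Rightarrow> real" and p0 p :: "(real^'d) \<times> (real^'d)"
  defines "y \<equiv> snd p $ l - snd p0 $ l"
  assumes sy: "\<And>j. summable (\<lambda>m. \<bar>c j m\<bar> * \<bar>y\<bar> ^ m)"
    and My: "\<And>j. (\<Sum>m. \<bar>c j m\<bar> * \<bar>y\<bar> ^ m) \<le> M j"
    and Gy: "\<And>j. (\<lambda>m. c j m * y ^ m) sums G j (snd p $ l)"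
    and p: "norm (p - p0) \<le> \<rho>"
    and s: "summable (\<lambda>j. \<bar>u j\<bar> * (exp (2 * pi * \<rho> * K j) * M j))"
  shows "ps_at (\<lambda>x. \<Sum>j. trig_term_coeff l (k j) (2 * pi * (k j \<bullet> fst p0) + \<phi>) (u j) (c j) x)
     (\<lambda>p. trig G \<phi> u (fst p) (snd p $ l)) p0 p"
proof -
  have h: "\<bar>fst p $ i - fst p0 $ i\<bar> \<le> \<rho>" for i
    using component_le_norm_cart[of "fst p - fst p0" i] norm_fst_le_norm[of "p - p0"] p by simp
  have tr: "(\<lambda>p. trig G \<phi> u (fst p) (snd p $ l)) =
     (\<lambda>p. \<Sum>j. u j * (G j (snd p $ l) * cos (2 * pi * (k j \<bullet> fst p) + \<phi>)))"
    unfolding trig_def by (simp add: mult.commute)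
  show ?thesis
    unfolding tr
  proof (rule ps_at_suminf)
    show "ps_at (trig_term_coeff l (k j) (2 * pi * (k j \<bullet> fst p0) + \<phi>) (u j) (c j))
         (\<lambda>p. u j * (G j (snd p $ l) * cos (2 * pi * (k j \<bullet> fst p) + \<phi>))) p0 p" for j
      by (rule ps_at_trig_term(1)) (use sy My Gy h in \<open>auto simp: y_def\<close>)
    show "(\<Sum>(\<alpha>, \<beta>)\<in>F. \<bar>trig_term_coeff l (k j) (2 * pi * (k j \<bullet> fst p0) + \<phi>) (u j) (c j) (\<alpha>, \<beta>) *
        xmon (fst p - fst p0) \<alpha> * xmon (snd p - snd p0) \<beta>\<bar>)
        \<le> \<bar>u j\<bar> * (exp (2 * pi * \<rho> * K j) * M j)" if "finite F" for j F
      unfolding K_def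
      by (rule ps_at_trig_term(2)[OF _ _ _ _ that]) (use sy My Gy h in \<open>auto simp: y_def\<close>)
    show "summable (\<lambda>j. \<bar>u j\<bar> * (exp (2 * pi * \<rho> * K j) * M j))" by (rule s)
  qed
qed

lemma trig_ps_at_local:
  fixes u :: "nat \<Rightarrow> real" and p0 :: "(real^'d) \<times> (real^'d)"
  assumes m: "\<And>j. majorized (G j) (snd p0 $ l) \<rho> (M j)"
    and s: "summable (\<lambda>j. \<bar>u j\<bar> * (exp (2 * pi * \<rho> * K j) * M j))"
  shows "\<exists>c. \<forall>p. norm (p - p0) < \<rho> \<longrightarrow> ps_at c (\<lambda>p. trig G \<phi> u (fst p) (snd p $ l)) p0 p"
proof -
  obtain c where c: "\<And>j. summable (\<lambda>m. \<bar>c j m\<bar> * \<rho> ^ m)" "\<And>j. (\<Sum>m. \<bar>c j m\<bar> * \<rho> ^ m) \<le> M j"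
      "\<And>j y. \<bar>y\<bar> \<le> \<rho> \<Longrightarrow> (\<lambda>m. c j m * y ^ m) sums G j (snd p0 $ l + y)"
    using m unfolding majorized_def by metis
  have "ps_at (\<lambda>x. \<Sum>j. trig_term_coeff l (k j) (2 * pi * (k j \<bullet> fst p0) + \<phi>) (u j) (c j) x)
     (\<lambda>p. trig G \<phi> u (fst p) (snd p $ l)) p0 p" if p: "norm (p - p0) < \<rho>" for p
  proof (rule trig_ps_at[OF _ _ _ _ s])
    define y where "y = snd p $ l - snd p0 $ l"
    have y: "\<bar>y\<bar> \<le> \<rho>"
      using component_le_norm_cart[of "snd p - snd p0" l] norm_snd_le_norm[of "p - p0"] p by (simp add: y_def)
    have le: "\<bar>c j m\<bar> * \<bar>y\<bar> ^ m \<le> \<bar>c j m\<bar> * \<rho> ^ m" for j m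
      using y by (intro mult_left_mono power_mono) auto
    have sy: "summable (\<lambda>m. \<bar>c j m\<bar> * \<bar>y\<bar> ^ m)" for j
      by (rule summable_comparison_test'[OF c(1)[of j]]) (use le in auto)
    then show "summable (\<lambda>m. \<bar>c j m\<bar> * \<bar>snd p $ l - snd p0 $ l\<bar> ^ m)" for j
      by (simp add: y_def)
    show "(\<Sum>m. \<bar>c j m\<bar> * \<bar>snd p $ l - snd p0 $ l\<bar> ^ m) \<le> M j" for j
      using order_trans[OF suminf_le[OF le sy c(1)] c(2)] by (simp add: y_def)
    show "(\<lambda>m. c j m * (snd p $ l - snd p0 $ l) ^ m) sums G j (snd p $ l)" for j
      using c(3)[OF y, of j] by (simp add: y_def)
  qed (use p in auto)
  then show ?thesis by blast
qed

lemma trig_add_axis [simp]: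
  "trig G \<phi> u (\<theta> + axis l c) x = trig G \<phi> u \<theta> x"
  "trig G \<phi> u (\<theta> - axis l c) x = trig G \<phi> u \<theta> x"
  unfolding trig_def by (simp_all add: inner_add_right inner_diff_right inner_axis)

lemma trig_periodic: "int_vec m \<Longrightarrow> trig G \<phi> u (\<theta> + m) x = trig G \<phi> u \<theta> x"
  unfolding trig_def inner_add_right by (simp add: cos_add_Ints[OF inner_int_vec[OF k_int]])

text \<open>The derivative of \<open>f\<close> along \<open>w\<close>: differentiating the sine
  brings down \<open>2 * pi * lam j\<close>, and the \<open>1 / (2 * pi)\<close> in \<open>f\<close>
  leaves \<open>lam j\<close>.\<close>

definition Q :: "real^'d \<Rightarrow> real \<Rightarrow> real" where
  "Q = trig g 0 lam"

definition H :: "(real^'d) \<times> (real^'d) \<Rightarrow> real" where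
  "H p = w \<bullet> snd p - Q (fst p) (snd p $ l)"

text \<open>The Taylor coefficients of \<open>g j\<close> at \<open>0\<close>.\<close>
definition gc :: "nat \<Rightarrow> nat \<Rightarrow> real" where
  "gc j m = (if m < j + 2 then 0 else B j ^ (m - (j + 2)) / fact (m - (j + 2)))"

lemma gc_nonneg: "gc j m \<ge> 0"
  unfolding gc_def by simp

lemma gc_sums: "(\<lambda>m. gc j m * x ^ m) sums g j x"
proof -
  have "(\<lambda>i. x ^ (j + 2) * ((B j * x) ^ i /\<^sub>R fact i)) sums (x ^ (j + 2) * exp (B j * x))"
    by (intro sums_mult exp_converges)
  moreover have "gc j (i + (j + 2)) * x ^ (i + (j + 2)) = x ^ (j + 2) * ((B j * x) ^ i /\<^sub>R fact i)" for i
    by (simp add: gc_def power_add power_mult_distrib divide_inverse mult_ac)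
  ultimately have "(\<lambda>i. gc j (i + (j + 2)) * x ^ (i + (j + 2))) sums g j x"
    by (simp only: g_def pow_exp_def)
  then show ?thesis
    by (subst (asm) sums_zero_iff_shift) (auto simp: gc_def)
qed

lemma H_entire: "real_entire2 H"
proof -
  define cQ where "cQ = (\<lambda>x. \<Sum>j. trig_term_coeff l (k j) (2 * pi * (k j \<bullet> fst (0 :: (real^'d) \<times> (real^'d))) + 0) (lam j) (gc j) x)"
  have "ps_at cQ (\<lambda>p. trig g 0 lam (fst p) (snd p $ l)) 0 p" for p
    unfolding cQ_def
  proof (rule trig_ps_at)
    define \<rho> where "\<rho> = norm p"
    define y where "y = snd p $ l - snd (0::(real^'d) \<times> (real^'d)) $ l"
    have y: "\<bar>y\<bar> \<le> \<rho>"
      using component_le_norm_cart[of "snd p" l] norm_snd_le_norm[of p] by (simp add: \<rho>_def y_def)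
    \<comment> \<open>The coefficients are nonnegative, so the series of absolute values is
      \<open>g j\<close> at \<open>\<bar>y\<bar>\<close> and inherits its bound.\<close>
    have s: "(\<lambda>m. \<bar>gc j m\<bar> * \<bar>y\<bar> ^ m) sums g j \<bar>y\<bar>" for j
      using gc_sums[of j "\<bar>y\<bar>"] gc_nonneg by simp
    then show "summable (\<lambda>m. \<bar>gc j m\<bar> * \<bar>snd p $ l - snd 0 $ l\<bar> ^ m)" for j
      by (simp add: sums_iff y_def)
    have "g j \<bar>y\<bar> \<le> bd j \<rho> \<rho>" for j using g_bound[of "\<bar>y\<bar>" \<rho> \<rho> j] y by simp
    then show "(\<Sum>m. \<bar>gc j m\<bar> * \<bar>snd p $ l - snd 0 $ l\<bar> ^ m) \<le> bd j \<rho> \<rho>" for j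
      using s[of j] by (simp add: sums_iff y_def)
    show "(\<lambda>m. gc j m * (snd p $ l - snd 0 $ l) ^ m) sums g j (snd p $ l)" for j
      using gc_sums[of j "snd p $ l"] by simp
    show "norm (p - 0) \<le> \<rho>" by (simp add: \<rho>_def)
    show "summable (\<lambda>j. \<bar>lam j\<bar> * (exp (2 * pi * \<rho> * K j) * bd j \<rho> \<rho>))"
      by (rule summable_lam) (auto simp: \<rho>_def)
  qed
  then have Qps: "ps_at (\<lambda>x. - 1 * cQ x) (\<lambda>p. - 1 * trig g 0 lam (fst p) (snd p $ l)) 0 p" for p
    by (rule ps_at_cmult)
  define cS :: "'d \<Rightarrow> ('d \<Rightarrow> nat) \<times> ('d \<Rightarrow> nat) \<Rightarrow> real" where
    "cS i = (\<lambda>x. if x = (\<lambda>_. 0, \<lambda>_. 0) then snd (0 :: (real^'d) \<times> (real^'d)) $ i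
       else if x = (\<lambda>_. 0, single i 1) then 1 else 0)" for i
  have "ps_at (cS i) (\<lambda>p. snd p $ i) 0 p" for i and p :: "(real^'d) \<times> (real^'d)"
    unfolding cS_def by (rule ps_at_snd)
  then have Sps: "ps_at (\<lambda>x. \<Sum>i\<in>UNIV. w $ i * cS i x) (\<lambda>p. \<Sum>i\<in>UNIV. w $ i * (snd p $ i)) 0 p"
    for p :: "(real^'d) \<times> (real^'d)"
    by (intro ps_at_sum ps_at_cmult) auto
  have H: "H = (\<lambda>p. (\<Sum>i\<in>UNIV. w $ i * (snd p $ i)) + - 1 * trig g 0 lam (fst p) (snd p $ l))"
    unfolding H_def[abs_def] Q_def inner_vec_def by simp
  show ?thesis
    unfolding H by (rule real_entire2I[OF ps_at_add[OF Sps Qps]])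
qed

lemma H_periodic: "angle_periodic H"
  unfolding angle_periodic_def H_def Q_def by (simp add: trig_periodic)

lemma Q_summable: "summable (\<lambda>j. norm (g j x * cos (2 * pi * (k j \<bullet> \<theta>)) * lam j))"
proof -
  have "summable (\<lambda>j. norm (lam j) * bd j \<bar>x\<bar> \<bar>x\<bar>)"
    using summable_lam[of "\<bar>x\<bar>" 0 "\<bar>x\<bar>"] by simp
  then show ?thesis
    using trig_summable_norm[of g x "\<lambda>j. bd j \<bar>x\<bar> \<bar>x\<bar>" lam \<theta> 0] g_bound[of x "\<bar>x\<bar>" "\<bar>x\<bar>"] by simp
qed

lemma Q_eq: "Q \<theta> x = (\<Sum>j. g j x * cos (2 * pi * (k j \<bullet> \<theta>)) * lam j)"
  unfolding Q_def trig_def by simp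

lemma summable_lam_exp: "summable (\<lambda>j. \<bar>lam j\<bar> * exp (B j))"
proof (rule summable_comparison_test'[OF summable_lam[of 0 0 1]])
  fix j
  have "1 * exp (B j) \<le> (real j + 3 + B j)\<^sup>2 * exp (B j)"
    using B_nonneg[of j] by (intro mult_right_mono) (auto intro!: one_le_power)
  then have "exp (B j) \<le> exp (0 * K j) * bd j 0 1" by (simp add: bd_def)
  then show "norm (\<bar>lam j\<bar> * exp (B j)) \<le> \<bar>lam j\<bar> * (exp (0 * K j) * bd j 0 1)"
    by (simp add: abs_mult mult_left_mono)
qed auto

text \<open>The nonnegative Taylor coefficients add up to \<open>g j 1 = exp (B j)\<close>; for
  \<open>\<bar>x\<bar> \<le> 1\<close> the factor \<open>\<bar>x\<bar> ^ (n + 1)\<close> comes out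
  of the tail.\<close>

lemma g_taylor:
  assumes "\<bar>x\<bar> \<le> 1"
  shows "\<bar>g j x - (\<Sum>m\<le>n. gc j m * x ^ m)\<bar> \<le> exp (B j) * \<bar>x\<bar> ^ (n + 1)"
proof -
  have s1: "(\<lambda>m. gc j m) sums exp (B j)"
    using gc_sums[of j 1] by (simp add: g_def pow_exp_def)
  have s: "summable (\<lambda>m. gc j m * x ^ m)" using gc_sums by (rule sums_summable)
  have sg: "summable (\<lambda>i. gc j (i + (n + 1)))"
    using summable_ignore_initial_segment[OF sums_summable[OF s1]] .
  have le: "norm (gc j (i + (n + 1)) * x ^ (i + (n + 1))) \<le> gc j (i + (n + 1)) * \<bar>x\<bar> ^ (n + 1)" for i
  proof -
    have "\<bar>x\<bar> ^ i * \<bar>x\<bar> ^ (n + 1) \<le> 1 * \<bar>x\<bar> ^ (n + 1)"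
      using assms by (intro mult_right_mono) (auto intro: power_le_one)
    from mult_left_mono[OF this gc_nonneg[of j "i + (n + 1)"]] show ?thesis
      using gc_nonneg[of j "i + (n + 1)"]
      by (simp only: real_norm_def abs_mult power_abs power_add abs_of_nonneg mult_1_left mult_ac)
  qed
  have sn: "summable (\<lambda>i. norm (gc j (i + (n + 1)) * x ^ (i + (n + 1))))"
    by (rule summable_comparison_test'[OF summable_mult2[OF sg]]) (use le in auto)
  have "g j x - (\<Sum>m\<le>n. gc j m * x ^ m) = (\<Sum>i. gc j (i + (n + 1)) * x ^ (i + (n + 1)))"
    using suminf_minus_initial_segment[OF s, of "n + 1"] sums_unique[OF gc_sums[of j x]]
    by (simp add: lessThan_Suc_atMost)
  also have "\<bar>\<dots>\<bar> \<le> (\<Sum>i. norm (gc j (i + (n + 1)) * x ^ (i + (n + 1))))"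
    using summable_norm[OF sn] by simp
  also have "\<dots> \<le> (\<Sum>i. gc j (i + (n + 1)) * \<bar>x\<bar> ^ (n + 1))"
    by (rule suminf_le[OF le sn summable_mult2[OF sg]])
  also have "\<dots> = (\<Sum>i. gc j (i + (n + 1))) * \<bar>x\<bar> ^ (n + 1)"
    by (rule suminf_mult2[OF sg, symmetric])
  also have "\<dots> \<le> exp (B j) * \<bar>x\<bar> ^ (n + 1)"
  proof (rule mult_right_mono)
    have "(\<Sum>i. gc j (i + (n + 1))) = exp (B j) - (\<Sum>i<n + 1. gc j i)"
      using suminf_minus_initial_segment[OF sums_summable[OF s1], of "n + 1"] sums_unique[OF s1] by simp
    then show "(\<Sum>i. gc j (i + (n + 1))) \<le> exp (B j)"
      using sum_nonneg[of "{..<n + 1}" "gc j"] gc_nonneg by simp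
  qed auto
  finally show ?thesis .
qed

text \<open>The coefficient of \<open>x\<^sup>m\<close> in \<open>Q \<theta> x\<close>; only \<open>j < m\<close> contribute, as \<open>g j\<close> vanishes to order \<open>j + 2\<close>.\<close>
definition q :: "nat \<Rightarrow> real^'d \<Rightarrow> real" where
  "q m \<theta> = (\<Sum>j<m. gc j m * cos (2 * pi * (k j \<bullet> \<theta>)) * lam j)"

definition cQ :: real where "cQ = (\<Sum>j. \<bar>lam j\<bar> * exp (B j))"

lemma cQ_nonneg: "cQ \<ge> 0"
  unfolding cQ_def by (intro suminf_nonneg summable_lam_exp) auto

lemma Q_sums: "(\<lambda>j. g j x * (cos (2 * pi * (k j \<bullet> \<theta>)) * lam j)) sums Q \<theta> x"
  using summable_sums[OF summable_norm_cancel[OF Q_summable[of x \<theta>]]] unfolding Q_eq by (simp only: mult.assoc)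

text \<open>The numbers \<open>d j\<close> are Taylor remainders of \<open>g j\<close> in one use
  and increments of \<open>g j\<close> in the other.\<close>

lemma lam_series_bound:
  assumes S: "(\<lambda>j. d j * (cos (2 * pi * (k j \<bullet> \<theta>)) * lam j)) sums S"
    and d: "\<And>j. \<bar>d j\<bar> \<le> b j * t" and sb: "summable (\<lambda>j. \<bar>lam j\<bar> * b j)"
  shows "\<bar>S\<bar> \<le> (\<Sum>j. \<bar>lam j\<bar> * b j) * t"
proof -
  let ?c = "\<lambda>j. cos (2 * pi * (k j \<bullet> \<theta>)) * lam j"
  have le: "norm (d j * ?c j) \<le> \<bar>lam j\<bar> * b j * t" for j
  proof -
    have "\<bar>?c j\<bar> \<le> 1 * \<bar>lam j\<bar>" unfolding abs_mult by (intro mult_right_mono) auto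
    then have "\<bar>d j\<bar> * \<bar>?c j\<bar> \<le> (b j * t) * \<bar>lam j\<bar>"
      using d[of j] by (intro mult_mono) auto
    then show ?thesis by (simp only: real_norm_def abs_mult mult_ac)
  qed
  have sn: "summable (\<lambda>j. norm (d j * ?c j))"
    by (rule summable_comparison_test'[OF summable_mult2[OF sb]]) (use le in auto)
  have "\<bar>S\<bar> \<le> (\<Sum>j. norm (d j * ?c j))"
    using summable_norm[OF sn] sums_unique[OF S] by simp
  also have "\<dots> \<le> (\<Sum>j. \<bar>lam j\<bar> * b j * t)"
    by (rule suminf_le[OF le sn summable_mult2[OF sb]])
  also have "\<dots> = (\<Sum>j. \<bar>lam j\<bar> * b j) * t"
    by (rule suminf_mult2[OF sb, symmetric])
  finally show ?thesis .
qed

lemma Q_taylor: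
  assumes x: "\<bar>x\<bar> \<le> 1"
  shows "\<bar>Q \<theta> x - (\<Sum>m\<le>n. q m \<theta> * x ^ m)\<bar> \<le> cQ * \<bar>x\<bar> ^ (n + 1)"
proof -
  let ?c = "\<lambda>j. cos (2 * pi * (k j \<bullet> \<theta>)) * lam j"
  \<comment> \<open>Since \<open>gc j m\<close> vanishes for \<open>m < j + 2\<close>, the Taylor
    polynomial of degree \<open>n\<close> is 0 for \<open>j \<ge> n\<close>, and the range
    \<open>j < m\<close> in \<open>q\<close> can be enlarged to \<open>j < n\<close>.\<close>
  have fin: "(\<lambda>j. (\<Sum>m\<le>n. gc j m * x ^ m) * ?c j) sums (\<Sum>j<n. (\<Sum>m\<le>n. gc j m * x ^ m) * ?c j)"
  proof (rule sums_finite)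
    fix j assume "j \<notin> {..<n}"
    then have "(\<Sum>m\<le>n. gc j m * x ^ m) = 0" by (intro sum.neutral) (auto simp: gc_def)
    then show "(\<Sum>m\<le>n. gc j m * x ^ m) * ?c j = 0" by simp
  qed auto
  have "(\<Sum>m\<le>n. q m \<theta> * x ^ m) = (\<Sum>m\<le>n. (\<Sum>j<n. gc j m * ?c j) * x ^ m)"
  proof (intro sum.cong refl)
    fix m assume "m \<in> {..n}"
    then have "(\<Sum>j<m. gc j m * ?c j) = (\<Sum>j<n. gc j m * ?c j)"
      by (intro sum.mono_neutral_left) (auto simp: gc_def)
    then show "q m \<theta> * x ^ m = (\<Sum>j<n. gc j m * ?c j) * x ^ m" by (simp add: q_def mult.assoc)
  qed
  also have "\<dots> = (\<Sum>j<n. (\<Sum>m\<le>n. gc j m * x ^ m) * ?c j)"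
    unfolding sum_distrib_right by (subst sum.swap) (simp add: mult_ac)
  finally have q: "(\<lambda>j. (\<Sum>m\<le>n. gc j m * x ^ m) * ?c j) sums (\<Sum>m\<le>n. q m \<theta> * x ^ m)"
    using fin by simp
  from sums_diff[OF Q_sums q]
  have "(\<lambda>j. (g j x - (\<Sum>m\<le>n. gc j m * x ^ m)) * ?c j) sums (Q \<theta> x - (\<Sum>m\<le>n. q m \<theta> * x ^ m))"
    by (simp add: left_diff_distrib)
  then show ?thesis
    unfolding cQ_def by (rule lam_series_bound[OF _ g_taylor[OF x] summable_lam_exp])
qed

lemma q_01: "q 0 \<theta> = 0" "q (Suc 0) \<theta> = 0"
  unfolding q_def by (simp_all add: gc_def)

lemma H_quadratic: "\<exists>C>0. \<exists>\<delta>>0. \<forall>\<theta> r. norm r \<le> \<delta> \<longrightarrow> \<bar>H (\<theta>, r) - w \<bullet> r\<bar> \<le> C * (norm r)\<^sup>2"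
proof (rule exI[of _ "cQ + 1"], intro exI[of _ "1::real"] conjI allI impI)
  fix \<theta> r :: "real^'d" assume r: "norm r \<le> 1"
  have x: "\<bar>r $ l\<bar> \<le> norm r" by (rule component_le_norm_cart)
  have "\<bar>Q \<theta> (r $ l) - (\<Sum>m\<le>1. q m \<theta> * (r $ l) ^ m)\<bar> \<le> cQ * \<bar>r $ l\<bar> ^ (1 + 1)"
    by (rule Q_taylor) (use x r in linarith)
  then have "\<bar>Q \<theta> (r $ l)\<bar> \<le> cQ * \<bar>r $ l\<bar>\<^sup>2"
    by (simp add: q_01 power2_eq_square)
  also have "\<dots> \<le> (cQ + 1) * (norm r)\<^sup>2"
    using x cQ_nonneg by (intro mult_mono power_mono) auto
  finally show "\<bar>H (\<theta>, r) - w \<bullet> r\<bar> \<le> (cQ + 1) * (norm r)\<^sup>2" by (simp add: H_def)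
qed (use cQ_nonneg in auto)

section \<open>Linearization on the negative side\<close>

text \<open>\<open>F\<close> and \<open>V\<close> are the derivatives of the generating function \<open>f\<close> with respect to \<open>r\<^sub>l\<close> and \<open>\<theta>\<close>.\<close>
definition F :: "real^'d \<Rightarrow> real \<Rightarrow> real" where
  "F = trig g' (- (pi / 2)) (\<lambda>_. 1 / (2 * pi))"

definition V :: "real^'d \<Rightarrow> real \<Rightarrow> real^'d" where
  "V \<theta> x = (\<chi> i. trig g 0 (\<lambda>j. k j $ i) \<theta> x)"

text \<open>Along the flow of \<open>- f\<close> the action \<open>r $ l\<close> and all angles but
  the \<open>l\<close>-th stay fixed. The vector field is thus constant on each orbit, and the
  time-one map is a single Euler step.\<close>

definition \<Psi> :: "(real^'d) \<times> (real^'d) \<Rightarrow> (real^'d) \<times> (real^'d)" where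
  "\<Psi> p = (fst p - axis l (F (fst p) (snd p $ l)), snd p + V (fst p) (snd p $ l))"

lemma V_l [simp]: "V \<theta> x $ l = 0"
  unfolding V_def trig_def by simp

lemma V_axis [simp]: "V (\<theta> + axis l c) x = V \<theta> x" "V (\<theta> - axis l c) x = V \<theta> x"
  unfolding V_def by simp_all

lemma F_axis [simp]: "F (\<theta> + axis l c) x = F \<theta> x" "F (\<theta> - axis l c) x = F \<theta> x"
  unfolding F_def by simp_all

lemma summable_neg':
  assumes "x < 0" "R \<ge> 0" "a \<ge> 0"
  shows "summable (\<lambda>j. exp (a * K j) * bd j R x)"
  using summable_neg[of "- x" R a] assms by simp

text \<open>Coefficients growing like \<open>exp (K j)\<close> cost one unit in \<open>a\<close>.
  This covers constants, \<open>k j\<close> and its coordinates alike.\<close>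

lemma summable_weight:
  assumes u: "\<And>j. norm (u j) \<le> C * exp (K j)" and x: "x < 0" and R: "R \<ge> 0" and a: "a \<ge> 0"
  shows "summable (\<lambda>j. norm (u j) * (exp (a * K j) * bd j R x))"
proof (rule summable_comparison_test'[OF summable_mult[OF summable_neg'[OF x R, of "a + 1"], of C]])
  fix j
  have "norm (u j) * (exp (a * K j) * bd j R x) \<le> (C * exp (K j)) * (exp (a * K j) * bd j R x)"
    using u[of j] bd_nonneg[OF R, of j x] by (intro mult_right_mono) auto
  also have "\<dots> = C * (exp ((a + 1) * K j) * bd j R x)"
    by (simp add: distrib_right exp_add mult_ac)
  finally show "norm (norm (u j) * (exp (a * K j) * bd j R x)) \<le> C * (exp ((a + 1) * K j) * bd j R x)"
    using bd_nonneg[OF R, of j x] by (simp add: abs_mult)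
qed (use a in auto)

lemma k_le_exp: "norm (k j $ i) \<le> 1 * exp (K j)" "norm (k j) \<le> 1 * exp (K j)"
  using k_coord_le[of j i] norm_k_le[of j] exp_K_ge(2)[of j] by auto

lemma const_le_exp: "norm (c::real) \<le> \<bar>c\<bar> * exp (K j)"
  using exp_K_ge(1)[of j] mult_left_mono[of 1 "exp (K j)" "\<bar>c\<bar>"] by simp

lemma summable_weight0:
  assumes "\<And>j. norm (u j) \<le> C * exp (K j)" "x < 0"
  shows "summable (\<lambda>j. norm (u j) * bd j \<bar>x\<bar> x)"
  using summable_weight[OF assms, of "\<bar>x\<bar>" 0] by simp

lemma inner_V:
  assumes "x < 0"
  shows "w \<bullet> V \<theta> x = Q \<theta> x"
proof -
  have s: "summable (\<lambda>j. norm (k j) * bd j \<bar>x\<bar> x)"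
    using summable_weight0[OF k_le_exp(2) assms] .
  have b: "\<bar>g j x\<bar> \<le> bd j \<bar>x\<bar> x" for j by (rule g_bound) auto
  have "V \<theta> x = trig g 0 k \<theta> x"
    unfolding V_def vec_eq_iff using trig_nth[of g x "\<lambda>j. bd j \<bar>x\<bar> x" k] b s by simp
  then show ?thesis
    unfolding Q_def lam_def using trig_inner[of g x "\<lambda>j. bd j \<bar>x\<bar> x" k] b s by simp
qed

text \<open>The shear adds \<open>w \<bullet> V\<close>, which equals \<open>Q\<close>, to the
  linear part and changes neither argument that \<open>Q\<close> depends on.\<close>

lemma H_\<Psi>: "snd p $ l < 0 \<Longrightarrow> H (\<Psi> p) = w \<bullet> snd p"
proof -
  assume p: "snd p $ l < 0"
  have "Q (fst p - axis l c) x = Q (fst p) x" for c x unfolding Q_def by simp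
  then show ?thesis
    unfolding H_def \<Psi>_def using inner_V[OF p, of "fst p"] by (simp add: inner_add_right)
qed

lemma \<Psi>_add_int:
  assumes "int_vec m"
  shows "\<Psi> (p + (m, 0)) = \<Psi> p + (m, 0)"
proof -
  have "F (fst p + m) x = F (fst p) x" "V (fst p + m) x = V (fst p) x" for x
    unfolding F_def V_def by (simp_all add: trig_periodic[OF assms])
  then show ?thesis by (simp add: \<Psi>_def prod_eq_iff)
qed

text \<open>Pure algebra, valid on both sides: \<open>F\<close> and \<open>V\<close> ignore the
  \<open>l\<close>-th angle and \<open>V\<close> has no \<open>l\<close>-component, so subtracting
  the same quantities inverts the shear. Convergence of the series does not enter.\<close>

lemma \<Psi>_surj: "\<exists>p. snd p $ l = snd p' $ l \<and> \<Psi> p = p'"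
  by (intro exI[of _ "(fst p' + axis l (F (fst p') (snd p' $ l)), snd p' - V (fst p') (snd p' $ l))"])
    (simp add: \<Psi>_def)

lemma \<Psi>_inj: "\<Psi> p = \<Psi> p' \<Longrightarrow> p = p'"
proof -
  assume eq: "\<Psi> p = \<Psi> p'"
  define iv where "iv = (\<lambda>p' :: (real^'d) \<times> (real^'d). (fst p' + axis l (F (fst p') (snd p' $ l)), snd p' - V (fst p') (snd p' $ l)))"
  have "iv (\<Psi> p) = p" for p by (simp add: iv_def \<Psi>_def)
  then show "p = p'" using eq by metis
qed

lemma trig_has_derivative_neg:
  fixes u :: "nat \<Rightarrow> real"
  assumes x: "r $ l < 0"
    and D: "\<And>j y. (G j has_real_derivative G' j y) (at y)"
    and M: "\<And>j y R s. \<bar>y\<bar> \<le> R \<Longrightarrow> y \<le> s \<Longrightarrow> \<bar>G j y\<bar> \<le> bd j R s"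
           "\<And>j y R s. \<bar>y\<bar> \<le> R \<Longrightarrow> y \<le> s \<Longrightarrow> \<bar>G' j y\<bar> \<le> bd j R s"
    and u: "\<And>j. norm (u j) \<le> C * exp (K j)"
  shows "((\<lambda>p. trig G \<phi> u (fst p) (snd p $ l)) has_derivative
      (\<lambda>v. snd v $ l * trig G' \<phi> u \<theta> (r $ l) +
           fst v \<bullet> trig G (\<phi> + pi / 2) (\<lambda>j. (2 * pi * u j) *\<^sub>R k j) \<theta> (r $ l))) (at (\<theta>, r))"
proof (rule trig_has_derivative[where M = "\<lambda>j. bd j (2 * \<bar>r $ l\<bar>) (r $ l / 2)"])
  \<comment> \<open>The right end stays below 0, so that \<open>bd\<close> is taken with a negative
    \<open>s\<close>.\<close>
  show "r $ l \<in> {2 * r $ l<..<r $ l / 2}" using x by auto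
  show "summable (\<lambda>j. norm (u j) * (exp (K j) * bd j (2 * \<bar>r $ l\<bar>) (r $ l / 2)))"
    using summable_weight[OF u, of "r $ l / 2" "2 * \<bar>r $ l\<bar>" 1] x by simp
qed (use x in \<open>auto intro!: D M\<close>)

text \<open>\<open>E\<close>, \<open>C\<close> and \<open>S\<close> are the blocks of the Hessian of
  \<open>f\<close> in \<open>(r $ l, \<theta>)\<close>. Its symmetry makes the first-order terms
  cancel: \<open>C\<close> occurs in both derivatives and \<open>S\<close> is symmetric. The product
  of the two shears vanishes since \<open>DV v\<close> has no \<open>l\<close>-component.\<close>

lemma \<Psi>_symplectic:
  assumes x: "snd p $ l < 0"
  shows "\<exists>D. (\<Psi> has_derivative D) (at p) \<and> (\<forall>u v. symp (D u) (D v) = symp u v)"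
proof -
  obtain \<theta> r where p: "p = (\<theta>, r)" by (cases p)
  have x: "r $ l < 0" using x p by simp
  define y where "y = r $ l"
  have y: "y < 0" using x by (simp add: y_def)
  define C where "C = trig g' 0 k \<theta> y"
  define E where "E = trig g'' (- (pi / 2)) (\<lambda>_. 1 / (2 * pi)) \<theta> y"
  define S where "S = (\<lambda>i m. trig g (pi / 2) (\<lambda>j. 2 * pi * k j $ i * k j $ m) \<theta> y)"
  have bg: "\<bar>g j y\<bar> \<le> bd j \<bar>y\<bar> y" and bg': "\<bar>g' j y\<bar> \<le> bd j \<bar>y\<bar> y" for j
    by (rule g_bound g'_bound; simp)+
  have sk: "summable (\<lambda>j. norm (k j) * bd j \<bar>y\<bar> y)"
    using summable_weight0[OF k_le_exp(2) y] .
  have Ci: "C $ i = trig g' 0 (\<lambda>j. k j $ i) \<theta> y" for i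
    unfolding C_def using trig_nth[of g' y "\<lambda>j. bd j \<bar>y\<bar> y" k] bg' sk by simp
  have Si: "v \<bullet> trig g (pi / 2) (\<lambda>j. (2 * pi * k j $ i) *\<^sub>R k j) \<theta> y = (\<Sum>m\<in>UNIV. v $ m * S i m)" for v i
  proof -
    have "summable (\<lambda>j. norm ((2 * pi * k j $ i) *\<^sub>R k j) * bd j \<bar>y\<bar> y)"
      by (rule summable_weaken(2)[of "\<lambda>j. k j $ i"])
        (use summable_weight[OF k_le_exp(1)[of _ i] y, of "\<bar>y\<bar>" 1] bd_nonneg[of "\<bar>y\<bar>"] in auto)
    then have "trig g (pi / 2) (\<lambda>j. (2 * pi * k j $ i) *\<^sub>R k j) \<theta> y $ m = S i m" for m
      using trig_nth[of g y "\<lambda>j. bd j \<bar>y\<bar> y" "\<lambda>j. (2 * pi * k j $ i) *\<^sub>R k j"] bg unfolding S_def by simp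
    then show ?thesis by (simp add: inner_vec_def)
  qed
  have S_sym: "S i m = S m i" for i m
    unfolding S_def by (simp only: mult.assoc mult.commute[of "k _ $ i"])
  define DF where "DF = (\<lambda>v :: (real^'d) \<times> (real^'d). snd v $ l * E + fst v \<bullet> C)"
  define DV where "DV = (\<lambda>v :: (real^'d) \<times> (real^'d). \<chi> i. snd v $ l * C $ i + (\<Sum>m\<in>UNIV. fst v $ m * S i m))"
  have F: "((\<lambda>p. F (fst p) (snd p $ l)) has_derivative DF) (at p)"
    using trig_has_derivative_neg[OF x DERIV_g' g'_bound g''_bound const_le_exp,
        of "- (pi / 2)" "1 / (2 * pi)" \<theta>]
    unfolding F_def DF_def E_def C_def p y_def by simp
  have V: "((\<lambda>p. V (fst p) (snd p $ l)) has_derivative DV) (at p)"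
    unfolding has_derivative_componentwise_within[where f' = DV]
  proof
    fix b :: "real^'d" assume "b \<in> Basis"
    then obtain i where i: "b = axis i 1" by (auto simp: Basis_vec_def)
    show "((\<lambda>p. V (fst p) (snd p $ l) \<bullet> b) has_derivative (\<lambda>v. DV v \<bullet> b)) (at p)"
      using trig_has_derivative_neg[OF x DERIV_g g_bound g'_bound k_le_exp(1)[of _ i], of 0 \<theta>] Ci[of i]
      unfolding V_def DV_def i p y_def[symmetric] by (simp add: inner_axis Si)
  qed
  define D where "D = (\<lambda>v. (fst v - axis l (DF v), snd v + DV v))"
  have ax: "((\<lambda>p. axis l (F (fst p) (snd p $ l))) has_derivative (\<lambda>v. axis l (DF v))) (at p)"
  proof -
    have "(\<lambda>p. axis l (f p)) = (\<lambda>p. f p *\<^sub>R axis l (1::real))" for f :: "(real^'d) \<times> (real^'d) \<Rightarrow> real"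
      by (simp add: fun_eq_iff vec_eq_iff axis_def)
    note eq = this[of "\<lambda>p. F (fst p) (snd p $ l)"] this[of DF]
    show ?thesis unfolding eq by (rule has_derivative_scaleR_left[OF F])
  qed
  have "(\<Psi> has_derivative D) (at p)"
    unfolding \<Psi>_def[abs_def] D_def
    by (intro has_derivative_Pair has_derivative_diff has_derivative_add has_derivative_fst
        has_derivative_snd has_derivative_ident ax V)
  moreover have "symp (D u) (D v) = symp u v" for u v
  proof -
    have 1: "h \<bullet> DV v = snd v $ l * (h \<bullet> C) + (\<Sum>i\<in>UNIV. \<Sum>m\<in>UNIV. h $ i * fst v $ m * S i m)" for h v
      unfolding DV_def inner_vec_def
      by (simp only: vec_lambda_beta inner_real_def distrib_left sum.distrib sum_distrib_left mult_ac)
    have 2: "(\<Sum>i\<in>UNIV. \<Sum>m\<in>UNIV. fst u $ i * fst v $ m * S i m) = (\<Sum>i\<in>UNIV. \<Sum>m\<in>UNIV. fst v $ i * fst u $ m * S i m)"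
    proof (subst sum.swap, intro sum.cong refl)
      fix i m show "fst u $ m * fst v $ i * S m i = fst v $ i * fst u $ m * S i m"
        using S_sym[of i m] by simp
    qed
    have 3: "DV v $ l = 0" for v
    proof -
      have "C $ l = 0" "S l m = 0" for m unfolding Ci S_def by (simp_all add: trig_def)
      then show ?thesis by (simp add: DV_def)
    qed
    have e: "(a - axis l c) \<bullet> (b + DV v) = a \<bullet> b - c * b $ l + a \<bullet> DV v" for a b c v
      by (simp add: inner_diff_left inner_add_right 3 inner_axis')
    have "symp (D u) (D v) = fst u \<bullet> snd v - DF u * snd v $ l + fst u \<bullet> DV v
        - (fst v \<bullet> snd u - DF v * snd u $ l + fst v \<bullet> DV u)"
      unfolding symp_def D_def fst_conv snd_conv e[symmetric]
      by (simp only: inner_commute[of "snd u + DV u"])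
    also have "\<dots> = symp u v"
      unfolding 1 2 DF_def symp_def by (simp add: algebra_simps inner_commute)
    finally show ?thesis .
  qed
  ultimately show ?thesis by blast
qed

lemma trig_analytic_neg:
  fixes u :: "nat \<Rightarrow> real" and p0 :: "(real^'d) \<times> (real^'d)"
  assumes x: "snd p0 $ l < 0"
    and m: "\<And>j x0 \<rho> R s. \<bar>x0\<bar> + \<rho> \<le> R \<Longrightarrow> x0 + \<rho> \<le> s \<Longrightarrow> \<rho> \<ge> 0 \<Longrightarrow> majorized (G j) x0 \<rho> (bd j R s)"
    and u: "\<And>j. norm (u j) \<le> C * exp (K j)"
  shows "\<exists>e>0. \<exists>c. \<forall>p. norm (p - p0) < e \<longrightarrow> ps_at c (\<lambda>p. trig G \<phi> u (fst p) (snd p $ l)) p0 p"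
proof -
  define x where "x = snd p0 $ l"
  have "\<exists>c. \<forall>p. norm (p - p0) < \<bar>x\<bar> / 2 \<longrightarrow> ps_at c (\<lambda>p. trig G \<phi> u (fst p) (snd p $ l)) p0 p"
  proof (rule trig_ps_at_local[where M = "\<lambda>j. bd j (2 * \<bar>x\<bar>) (x / 2)"])
    show "majorized (G j) (snd p0 $ l) (\<bar>x\<bar> / 2) (bd j (2 * \<bar>x\<bar>) (x / 2))" for j
      by (rule m) (use x in \<open>auto simp: x_def\<close>)
    show "summable (\<lambda>j. \<bar>u j\<bar> * (exp (2 * pi * (\<bar>x\<bar> / 2) * K j) * bd j (2 * \<bar>x\<bar>) (x / 2)))"
    proof -
      have "0 \<le> 2 * pi * (\<bar>x\<bar> / 2)" "x / 2 < 0" "0 \<le> 2 * \<bar>x\<bar>"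
        using x by (auto simp: x_def mult_le_0_iff)
      from summable_weight[OF u this(2,3,1)] show ?thesis by simp
    qed
  qed
  then show ?thesis using x by (intro exI[of _ "\<bar>x\<bar> / 2"]) (auto simp: x_def)
qed

lemma \<Psi>_analytic:
  assumes S: "\<And>p. p \<in> S \<Longrightarrow> snd p $ l < 0"
  shows "real_analytic2 (\<lambda>p. fst (\<Psi> p) $ i) S" "real_analytic2 (\<lambda>p. snd (\<Psi> p) $ i) S"
proof -
  show "real_analytic2 (\<lambda>p. fst (\<Psi> p) $ i) S"
  proof (rule real_analytic2I)
    fix p0 assume "p0 \<in> S"
    have "\<exists>e>0. \<exists>c. \<forall>p. norm (p - p0) < e \<longrightarrow> ps_at c (\<lambda>p. F (fst p) (snd p $ l)) p0 p"
      unfolding F_def by (rule trig_analytic_neg[OF S[OF \<open>p0 \<in> S\<close>] majorized_g' const_le_exp])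
    then obtain e c where e: "e > 0" "\<And>p. norm (p - p0) < e \<Longrightarrow> ps_at c (\<lambda>p. F (fst p) (snd p $ l)) p0 p"
      by blast
    define c0 :: "('d \<Rightarrow> nat) \<times> ('d \<Rightarrow> nat) \<Rightarrow> real" where
      "c0 = (\<lambda>x. if x = (\<lambda>_. 0, \<lambda>_. 0) then fst p0 $ i else if x = (single i 1, \<lambda>_. 0) then 1 else 0)"
    have eq: "(\<lambda>p. fst (\<Psi> p) $ i) = (\<lambda>p. fst p $ i + (if i = l then - 1 else 0) * F (fst p) (snd p $ l))"
      by (auto simp: \<Psi>_def axis_def)
    have "ps_at (\<lambda>x. c0 x + (if i = l then - 1 else 0) * c x) (\<lambda>p. fst (\<Psi> p) $ i) p0 p" if "norm (p - p0) < e" for p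
      unfolding eq c0_def by (intro ps_at_add ps_at_cmult ps_at_fst e(2) that)
    then show "\<exists>e>0. \<exists>c. \<forall>p. norm (p - p0) < e \<longrightarrow> ps_at c (\<lambda>p. fst (\<Psi> p) $ i) p0 p"
      using e(1) by blast
  qed
  show "real_analytic2 (\<lambda>p. snd (\<Psi> p) $ i) S"
  proof (rule real_analytic2I)
    fix p0 assume "p0 \<in> S"
    have "\<exists>e>0. \<exists>c. \<forall>p. norm (p - p0) < e \<longrightarrow> ps_at c (\<lambda>p. V (fst p) (snd p $ l) $ i) p0 p"
      unfolding V_def vec_lambda_beta by (rule trig_analytic_neg[OF S[OF \<open>p0 \<in> S\<close>] majorized_g k_le_exp(1)])
    then obtain e c where e: "e > 0" "\<And>p. norm (p - p0) < e \<Longrightarrow> ps_at c (\<lambda>p. V (fst p) (snd p $ l) $ i) p0 p"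
      by blast
    define c0 :: "('d \<Rightarrow> nat) \<times> ('d \<Rightarrow> nat) \<Rightarrow> real" where
      "c0 = (\<lambda>x. if x = (\<lambda>_. 0, \<lambda>_. 0) then snd p0 $ i else if x = (\<lambda>_. 0, single i 1) then 1 else 0)"
    have eq: "(\<lambda>p. snd (\<Psi> p) $ i) = (\<lambda>p. snd p $ i + V (fst p) (snd p $ l) $ i)"
      by (auto simp: \<Psi>_def)
    have "ps_at (\<lambda>x. c0 x + c x) (\<lambda>p. snd (\<Psi> p) $ i) p0 p" if "norm (p - p0) < e" for p
      unfolding eq c0_def by (intro ps_at_add ps_at_snd e(2) that)
    then show "\<exists>e>0. \<exists>c. \<forall>p. norm (p - p0) < e \<longrightarrow> ps_at c (\<lambda>p. snd (\<Psi> p) $ i) p0 p"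
      using e(1) by blast
  qed
qed

section \<open>Unbounded orbits on the positive side\<close>

lemma H_has_derivative:
  "(H has_derivative (\<lambda>v. w \<bullet> snd v - (snd v $ l * trig g' 0 lam \<theta> (r $ l)
      + fst v \<bullet> trig g (pi / 2) (\<lambda>j. (2 * pi * lam j) *\<^sub>R k j) \<theta> (r $ l)))) (at (\<theta>, r))"
proof -
  define x where "x = r $ l"
  have "((\<lambda>p. trig g 0 lam (fst p) (snd p $ l)) has_derivative
      (\<lambda>v. snd v $ l * trig g' 0 lam \<theta> (r $ l) +
           fst v \<bullet> trig g (0 + pi / 2) (\<lambda>j. (2 * pi * lam j) *\<^sub>R k j) \<theta> (r $ l))) (at (\<theta>, r))"
  proof (rule trig_has_derivative[where M = "\<lambda>j. bd j (\<bar>x\<bar> + 1) (\<bar>x\<bar> + 1)"])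
    show "r $ l \<in> {x - 1<..<x + 1}" by (simp add: x_def)
    show "summable (\<lambda>j. norm (lam j) * (exp (K j) * bd j (\<bar>x\<bar> + 1) (\<bar>x\<bar> + 1)))"
      using summable_lam[of "\<bar>x\<bar> + 1" 1] by simp
  qed (auto intro!: DERIV_g g_bound g'_bound)
  from has_derivative_diff[OF has_derivative_inner_right[OF has_derivative_snd[OF has_derivative_ident], of w] this]
  show ?thesis unfolding H_def[abs_def] Q_def by simp
qed

text \<open>Subtracting the value at time 0 makes every term vanish there, so only the derivatives
  have to be dominated, and these contain the small factor \<open>lam j\<close>. The series without
  the subtraction may diverge.\<close>

lemma jump_derivative:
  fixes u :: "nat \<Rightarrow> 'b::banach"
  assumes s: "summable (\<lambda>j. norm (u j) * \<bar>lam j\<bar>)"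
  shows "((\<lambda>t. \<Sum>j. (cos (2 * pi * (k j \<bullet> \<theta>) + \<phi> + 2 * pi * lam j * t) - cos (2 * pi * (k j \<bullet> \<theta>) + \<phi>)) *\<^sub>R u j)
     has_vector_derivative
     (\<Sum>j. (cos (2 * pi * (k j \<bullet> \<theta>) + \<phi> + 2 * pi * lam j * t + pi / 2) * (2 * pi * lam j)) *\<^sub>R u j)) (at t)"
proof -
  let ?a = "\<lambda>j. 2 * pi * (k j \<bullet> \<theta>) + \<phi>"
  let ?f = "\<lambda>j t. (cos (?a j + 2 * pi * lam j * t) - cos (?a j)) *\<^sub>R u j"
  let ?c = "\<lambda>j t. - sin (?a j + 2 * pi * lam j * t) * (2 * pi * lam j)"
  let ?f' = "\<lambda>j t h. (h * ?c j t) *\<^sub>R u j"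
  have bc: "norm (?c j t *\<^sub>R u j) \<le> 2 * pi * (norm (u j) * \<bar>lam j\<bar>)" for j t
  proof -
    have "\<bar>sin (?a j + 2 * pi * lam j * t)\<bar> * (2 * pi * \<bar>lam j\<bar>) \<le> 1 * (2 * pi * \<bar>lam j\<bar>)"
      by (intro mult_right_mono) auto
    from mult_right_mono[OF this norm_ge_zero[of "u j"]] show ?thesis
      by (simp add: abs_mult mult_ac)
  qed
  define f where "f = ?f"
  define f' where "f' = ?f'"
  have "((\<lambda>t. \<Sum>j. f j t) has_derivative (\<lambda>h. \<Sum>j. f' j t h)) (at t)"
  proof (rule has_derivative_suminf[of UNIV t f f' "\<lambda>j. 2 * pi * (norm (u j) * \<bar>lam j\<bar>)" 0])
    fix j t h
    have 1: "((\<lambda>t. cos (?a j + 2 * pi * lam j * t) - cos (?a j)) has_derivative (\<lambda>h. h * ?c j t)) (at t)"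
      by (auto intro!: derivative_eq_intros simp: fun_eq_iff algebra_simps)
    show "(f j has_derivative f' j t) (at t)"
      unfolding f_def f'_def by (rule has_derivative_scaleR_left[OF 1])
    have "norm (f' j t h) = \<bar>h\<bar> * norm (?c j t *\<^sub>R u j)" by (simp add: f'_def abs_mult)
    also have "\<dots> \<le> \<bar>h\<bar> * (2 * pi * (norm (u j) * \<bar>lam j\<bar>))"
      by (intro mult_left_mono bc) auto
    finally show "norm (f' j t h) \<le> 2 * pi * (norm (u j) * \<bar>lam j\<bar>) * norm h" by (simp add: mult.commute)
  qed (use s in \<open>auto simp: f_def intro!: summable_mult\<close>)
  moreover have "(\<lambda>h. \<Sum>j. f' j t h) = (\<lambda>h. h *\<^sub>R (\<Sum>j. ?c j t *\<^sub>R u j))"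
  proof -
    have "summable (\<lambda>j. ?c j t *\<^sub>R u j)"
      by (rule summable_norm_cancel, rule summable_comparison_test'[OF summable_mult[OF s, of "2 * pi"]])
        (use bc in auto)
    from suminf_scaleR_right[OF this] show ?thesis by (simp add: f'_def fun_eq_iff)
  qed
  moreover have c: "cos (?a j + 2 * pi * lam j * t + pi / 2) * (2 * pi * lam j) = ?c j t" for j
    using minus_sin_cos_eq[of "?a j + 2 * pi * lam j * t"] by simp
  ultimately show ?thesis
    unfolding has_vector_derivative_def c by (simp only: f_def)
qed

text \<open>\<open>drift\<close> and \<open>twist\<close> are the formal differences of
  \<open>V\<close> and of \<open>F\<close> between \<open>\<theta> + t *\<^sub>R w\<close> and
  \<open>\<theta>\<close>. They converge for every \<open>x\<close>, even where \<open>V\<close> and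
  \<open>F\<close> themselves need not. The idle \<open>+ 0\<close> matches the phase
  \<open>\<phi>\<close> in \<open>jump_derivative\<close>.\<close>

definition drift :: "real^'d \<Rightarrow> real \<Rightarrow> real \<Rightarrow> real^'d" where
  "drift \<theta> x t = (\<Sum>j. (cos (2 * pi * (k j \<bullet> \<theta>) + 0 + 2 * pi * lam j * t) - cos (2 * pi * (k j \<bullet> \<theta>) + 0)) *\<^sub>R g j x *\<^sub>R k j)"

definition twist :: "real^'d \<Rightarrow> real \<Rightarrow> real \<Rightarrow> real" where
  "twist \<theta> x t = (\<Sum>j. (cos (2 * pi * (k j \<bullet> \<theta>) + - (pi / 2) + 2 * pi * lam j * t) - cos (2 * pi * (k j \<bullet> \<theta>) + - (pi / 2)))
     *\<^sub>R (g' j x / (2 * pi)))"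

definition orbit :: "real^'d \<Rightarrow> real^'d \<Rightarrow> real \<Rightarrow> (real^'d) \<times> (real^'d)" where
  "orbit \<theta> r t = (\<theta> + t *\<^sub>R w - twist \<theta> (r $ l) t *\<^sub>R axis l 1, r + drift \<theta> (r $ l) t)"

lemma summable_lam_g:
  "summable (\<lambda>j. norm (g j x *\<^sub>R k j) * \<bar>lam j\<bar>)"
  "summable (\<lambda>j. norm (g' j x / (2 * pi)) * \<bar>lam j\<bar>)"
proof -
  have s: "summable (\<lambda>j. \<bar>lam j\<bar> * (exp (1 * K j) * bd j \<bar>x\<bar> \<bar>x\<bar>))"
    by (rule summable_lam) auto
  show "summable (\<lambda>j. norm (g j x *\<^sub>R k j) * \<bar>lam j\<bar>)"
  proof (rule summable_comparison_test'[OF s])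
    fix j
    have "\<bar>g j x\<bar> * norm (k j) \<le> bd j \<bar>x\<bar> \<bar>x\<bar> * exp (K j)"
      using g_bound[of x "\<bar>x\<bar>" "\<bar>x\<bar>" j] norm_k_le[of j] exp_K_ge(2)[of j] bd_nonneg[of "\<bar>x\<bar>" j "\<bar>x\<bar>"]
      by (intro mult_mono) auto
    from mult_right_mono[OF this abs_ge_zero[of "lam j"]]
    show "norm (norm (g j x *\<^sub>R k j) * \<bar>lam j\<bar>) \<le> \<bar>lam j\<bar> * (exp (1 * K j) * bd j \<bar>x\<bar> \<bar>x\<bar>)"
      by (simp add: mult_ac)
  qed
  show "summable (\<lambda>j. norm (g' j x / (2 * pi)) * \<bar>lam j\<bar>)"
  proof (rule summable_comparison_test'[OF s])
    fix j
    have "\<bar>g' j x\<bar> / (2 * pi) \<le> \<bar>g' j x\<bar> / 1"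
      using pi_ge_two by (intro divide_left_mono) auto
    also have "\<dots> \<le> 1 * bd j \<bar>x\<bar> \<bar>x\<bar>"
      using g'_bound[of x "\<bar>x\<bar>" "\<bar>x\<bar>" j] by simp
    also have "\<dots> \<le> exp (K j) * bd j \<bar>x\<bar> \<bar>x\<bar>"
      using exp_K_ge(1)[of j] bd_nonneg[of "\<bar>x\<bar>" j "\<bar>x\<bar>"] by (intro mult_right_mono) auto
    finally have "\<bar>g' j x\<bar> / (2 * pi) \<le> exp (K j) * bd j \<bar>x\<bar> \<bar>x\<bar>" .
    from mult_right_mono[OF this abs_ge_zero[of "lam j"]]
    show "norm (norm (g' j x / (2 * pi)) * \<bar>lam j\<bar>) \<le> \<bar>lam j\<bar> * (exp (1 * K j) * bd j \<bar>x\<bar> \<bar>x\<bar>)"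
      by (simp add: mult_ac)
  qed
qed

lemma summable_drift:
  "summable (\<lambda>j. norm ((cos (2 * pi * (k j \<bullet> \<theta>) + 0 + 2 * pi * lam j * t) - cos (2 * pi * (k j \<bullet> \<theta>) + 0)) *\<^sub>R g j x *\<^sub>R k j))"
proof (rule summable_comparison_test'[OF summable_mult[OF summable_lam_g(1)[of x], of "2 * pi * \<bar>t\<bar>"]])
  fix j
  let ?d = "cos (2 * pi * (k j \<bullet> \<theta>) + 0 + 2 * pi * lam j * t) - cos (2 * pi * (k j \<bullet> \<theta>) + 0)"
  have "\<bar>?d\<bar> \<le> 2 * pi * \<bar>lam j\<bar> * \<bar>t\<bar>"
    using cos_diff_le(2)[of "2 * pi * (k j \<bullet> \<theta>) + 0" "2 * pi * lam j * t"] by (simp add: abs_mult)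
  from mult_right_mono[OF this norm_ge_zero[of "g j x *\<^sub>R k j"]]
  show "norm (norm (?d *\<^sub>R g j x *\<^sub>R k j)) \<le> 2 * pi * \<bar>t\<bar> * (norm (g j x *\<^sub>R k j) * \<bar>lam j\<bar>)"
    by (simp add: abs_mult mult_ac)
qed

lemma drift_l: "drift \<theta> x t $ l = 0"
  using bounded_linear.suminf[OF bounded_linear_vec_nth[of l] summable_norm_cancel[OF summable_drift[of \<theta> t x]]]
  unfolding drift_def by simp

lemma orbit_is_solution: "orbit \<theta> r 0 = (\<theta>, r)" "ham_solution H (orbit \<theta> r)"
proof -
  show "orbit \<theta> r 0 = (\<theta>, r)" by (simp add: orbit_def twist_def drift_def)
  show "ham_solution H (orbit \<theta> r)"
    unfolding ham_solution_def
  proof (intro allI impI)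
    fix t :: real assume "t \<ge> 0"
    define x where "x = r $ l"
    define th where "th = fst (orbit \<theta> r t)"
    define R where "R = snd (orbit \<theta> r t)"
    have o: "orbit \<theta> r t = (th, R)" by (simp add: th_def R_def)
    have Rl: "R $ l = x" by (simp add: R_def orbit_def drift_l x_def)
    \<comment> \<open>The twist acts on the \<open>l\<close>-th angle only, which no
      \<open>k j\<close> sees. All phases are therefore affine in \<open>t\<close>, and the
      equations integrate explicitly.\<close>
    have kth: "k j \<bullet> th = k j \<bullet> \<theta> + lam j * t" for j
      by (simp add: th_def orbit_def inner_add_right inner_diff_right inner_axis lam_def inner_commute[of w] mult.commute)
    have ph: "2 * pi * (k j \<bullet> \<theta>) + \<phi> + 2 * pi * lam j * t = 2 * pi * (k j \<bullet> th) + \<phi>" for j \<phi>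
      by (simp add: kth algebra_simps)
    define A where "A = trig g' 0 lam th x"
    define W where "W = trig g (pi / 2) (\<lambda>j. (2 * pi * lam j) *\<^sub>R k j) th x"
    have "(drift \<theta> x has_vector_derivative W) (at t)"
      using jump_derivative[OF summable_lam_g(1)[of x], of \<theta> 0 t]
      unfolding drift_def[abs_def] ph W_def trig_def by (simp add: mult_ac)
    then have dr: "((\<lambda>t. r + drift \<theta> x t) has_vector_derivative W) (at t)"
      using has_vector_derivative_add[OF has_vector_derivative_const[of r]] by fastforce
    have "(twist \<theta> x has_vector_derivative A) (at t)"
      using jump_derivative[OF summable_lam_g(2)[of x], of \<theta> "- (pi / 2)" t]
      unfolding twist_def[abs_def] ph A_def trig_def by (simp add: mult_ac)
    then have tw: "((\<lambda>t. \<theta> + t *\<^sub>R w - twist \<theta> x t *\<^sub>R axis l 1) has_vector_derivative (w - A *\<^sub>R axis l 1)) (at t)"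
      unfolding has_vector_derivative_def
      by (auto intro!: derivative_eq_intros simp: fun_eq_iff scaleR_diff_right)
    have "(orbit \<theta> r has_vector_derivative (w - A *\<^sub>R axis l 1, W)) (at t)"
      unfolding orbit_def[abs_def] x_def[symmetric] by (rule has_vector_derivative_Pair[OF tw dr])
    then have "(orbit \<theta> r has_vector_derivative (w - A *\<^sub>R axis l 1, W)) (at t within {0..})"
      by (rule has_vector_derivative_at_within)
    moreover have "(H has_derivative (\<lambda>v. w \<bullet> snd v - (snd v $ l * A + fst v \<bullet> W))) (at (orbit \<theta> r t))"
      using H_has_derivative[of th R] unfolding o Rl A_def W_def .
    moreover have "w \<bullet> snd v - (snd v $ l * A + fst v \<bullet> W) = symp (w - A *\<^sub>R axis l 1, W) v" for v
      by (simp add: symp_def inner_diff_left inner_axis' inner_commute[of W] mult.commute)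
    ultimately show "\<exists>D X. (H has_derivative D) (at (orbit \<theta> r t)) \<and>
      (orbit \<theta> r has_vector_derivative X) (at t within {0..}) \<and> (\<forall>v. D v = symp X v)"
      by blast
  qed
qed

section \<open>Separation of amplitudes and time scales\<close>

lemma lam_antimono: "i \<le> j \<Longrightarrow> \<bar>lam j\<bar> \<le> \<bar>lam i\<bar>"
proof (induction j rule: dec_induct)
  case (step j)
  have "- (real j + 2) * B (Suc j) \<le> 0" by (intro mult_nonpos_nonneg) auto
  then have "exp (- (real j + 2) * B (Suc j)) \<le> 1" by (simp only: exp_le_one_iff)
  then have "\<bar>lam j\<bar> * exp (- (real j + 2) * B (Suc j)) \<le> \<bar>lam j\<bar> * 1" by (intro mult_left_mono) auto
  then show ?case using lam_step[of j] step.IH unfolding lam_def by linarith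
qed simp

lemma lam_less:
  assumes "j < i" shows "\<bar>lam i\<bar> \<le> \<bar>lam j\<bar> * exp (- (real i + 1) * B i)"
proof -
  obtain m where m: "i = Suc m" using assms by (cases i) auto
  have "\<bar>lam i\<bar> \<le> \<bar>lam m\<bar> * exp (- (real i + 1) * B i)"
    using lam_step[of m] unfolding lam_def m by (simp add: algebra_simps)
  also have "\<dots> \<le> \<bar>lam j\<bar> * exp (- (real i + 1) * B i)"
    using lam_antimono[of j m] assms m by (intro mult_right_mono) auto
  finally show ?thesis .
qed

lemma B_mono: "i \<le> j \<Longrightarrow> B i \<le> B j"
proof (induction j rule: dec_induct)
  case (step j)
  have "1 * B j \<le> (real j + 2) * (B j + real j + 3)" by (intro mult_mono) auto
  then show ?case using B_step[of j] step.IH by linarith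
qed simp

lemma g_pos: "x > 0 \<Longrightarrow> g j x > 0"
  unfolding g_def pow_exp_def by simp

lemma g_K_le:
  assumes "x \<ge> 0"
  shows "\<bar>g j x\<bar> * K j \<le> 9 * exp ((3 + 2 * x) * B j)"
proof -
  have "\<bar>g j x\<bar> * K j \<le> bd j x x * exp (1 * K j)"
    using g_bound[of x x x j] exp_K_ge(2)[of j] K_nonneg[of j] bd_nonneg[of x j x] assms by (intro mult_mono) auto
  also have "\<dots> \<le> 9 * exp ((1 + x + 2 + \<bar>x\<bar>) * B j)"
    using weight_le[of x 1 j x] assms by (simp add: mult.commute)
  finally show ?thesis using assms by (simp add: algebra_simps)
qed

text \<open>The left side, divided by \<open>\<bar>lam j\<bar>\<close>, bounds what term
  \<open>i\<close> has contributed up to time \<open>1 / \<bar>lam j\<bar>\<close>. By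
  \<open>lam_less\<close> the loss \<open>exp ((3 + 2 * x) * B i)\<close> is absorbed once
  \<open>i\<close> exceeds \<open>3 + 2 * x\<close>. The constant 63 is 7, a bound for
  \<open>2 * pi\<close>, times the 9 of \<open>g_K_le\<close>.\<close>

lemma tail_small:
  assumes x: "x > 0" and i: "real i \<ge> 3 + 2 * x" and ij: "j < i"
  shows "2 * pi * (\<bar>g i x\<bar> * K i) * \<bar>lam i\<bar> \<le> \<bar>lam j\<bar> * (63 * exp (- real i))"
proof -
  have "(3 + 2 * x) * B i \<le> real i * B i" using i by (intro mult_right_mono) auto
  moreover have "B i \<ge> real i" using B_ge_T[of i] K_nonneg[of i] by linarith
  ultimately have ex: "(3 + 2 * x) * B i + - (real i + 1) * B i \<le> - real i" by (simp add: algebra_simps)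
  have "2 * pi * (\<bar>g i x\<bar> * K i) * \<bar>lam i\<bar> \<le> 7 * (9 * exp ((3 + 2 * x) * B i)) * (\<bar>lam j\<bar> * exp (- (real i + 1) * B i))"
  proof (rule mult_mono[OF _ lam_less[OF ij]])
    show "2 * pi * (\<bar>g i x\<bar> * K i) \<le> 7 * (9 * exp ((3 + 2 * x) * B i))"
      by (rule mult_mono) (use g_K_le[of x i] x pi_approx K_nonneg[of i] in auto)
  qed auto
  also have "\<dots> = \<bar>lam j\<bar> * (63 * exp ((3 + 2 * x) * B i + - (real i + 1) * B i))"
    by (simp only: exp_add) simp
  also have "\<dots> \<le> \<bar>lam j\<bar> * (63 * exp (- real i))"
    using ex by (intro mult_left_mono) auto
  finally show ?thesis .
qed

text \<open>\<open>B_step\<close> makes \<open>B (Suc m) * x\<close> exceed any fixed multiple of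
  \<open>B m + m + 3\<close> for large \<open>m\<close>, however small \<open>x\<close> is. In the
  hypothesis \<open>1 / x\<close> pays for the factor \<open>x ^ (m + 3)\<close>, and
  \<open>25 + 2 * x\<close> generously for the earlier amplitudes.\<close>

lemma head_small:
  assumes x: "x > 0" and m: "(real m + 2) * x \<ge> 1 / x + 25 + 2 * x"
  shows "(\<Sum>i<Suc m. 2 * (\<bar>g i x\<bar> * K i)) + real m \<le> g (Suc m) x"
proof -
  define E where "E = exp (real m + (3 + 2 * x) * B m)"
  have E: "E \<ge> 1" unfolding E_def using x by simp
  have "(\<Sum>i<Suc m. 2 * (\<bar>g i x\<bar> * K i)) \<le> (\<Sum>i<Suc m. 18 * exp ((3 + 2 * x) * B m))"
  proof (rule sum_mono)
    fix i assume "i \<in> {..<Suc m}"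
    then have "(3 + 2 * x) * B i \<le> (3 + 2 * x) * B m" using B_mono[of i m] x by (intro mult_left_mono) auto
    then have "9 * exp ((3 + 2 * x) * B i) \<le> 9 * exp ((3 + 2 * x) * B m)" by simp
    then show "2 * (\<bar>g i x\<bar> * K i) \<le> 18 * exp ((3 + 2 * x) * B m)" using g_K_le[of x i] x by linarith
  qed
  also have "\<dots> = 18 * (exp ((3 + 2 * x) * B m) * (real m + 1))" by simp
  also have "\<dots> \<le> 18 * (exp ((3 + 2 * x) * B m) * exp (real m))"
    using exp_ge_add_one_self[of "real m"] by (intro mult_left_mono) (auto simp: add.commute)
  also have "\<dots> = 18 * E" unfolding E_def exp_add by simp
  finally have 1: "(\<Sum>i<Suc m. 2 * (\<bar>g i x\<bar> * K i)) \<le> 18 * E" .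
  have "(B m + real m + 3) * (25 + 2 * x) \<le> (B m + real m + 3) * ((real m + 2) * x - 1 / x)"
    using m by (intro mult_left_mono) (auto simp: algebra_simps)
  also have "\<dots> \<le> ((real m + 2) * (B m + real m + 3)) * x - (real m + 3) / x"
    using x B_nonneg[of m] by (simp add: field_simps)
  also have "\<dots> \<le> B (Suc m) * x - (real m + 3) / x"
    using B_step[of m] x by (intro diff_right_mono mult_right_mono) auto
  finally have ex: "(B m + real m + 3) * (25 + 2 * x) \<le> B (Suc m) * x - (real m + 3) / x" .
  have "real m + (3 + 2 * x) * B m + (real m + 18) \<le> (B m + real m + 3) * (25 + 2 * x)"
    using x B_nonneg[of m] by (simp add: algebra_simps)
  then have ex2: "real m + (3 + 2 * x) * B m + (real m + 18) \<le> B (Suc m) * x - (real m + 3) / x"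
    using ex by linarith
  \<comment> \<open>A lower bound for the power of \<open>x\<close>, which may be tiny for small
    \<open>x\<close>, in a form that joins the other exponents.\<close>
  have "1 / x \<le> exp (1 / x)" using exp_ge_add_one_self[of "1 / x"] by linarith
  then have "exp (- (1 / x)) \<le> x" using x by (simp add: exp_minus field_simps)
  then have "exp (- (1 / x)) ^ (m + 3) \<le> x ^ (m + 3)" by (intro power_mono) auto
  moreover have "exp (- (1 / x)) ^ (m + 3) = exp (- ((real m + 3) / x))"
    by (simp flip: exp_of_nat_mult)
  ultimately have xp: "exp (- ((real m + 3) / x)) \<le> x ^ (m + 3)" by simp
  have "E * (real m + 18) \<le> E * exp (real m + 18)"
    using E exp_ge_add_one_self[of "real m + 18"] by (intro mult_left_mono) linarith+
  also have "\<dots> = exp (real m + (3 + 2 * x) * B m + (real m + 18))" unfolding E_def by (simp only: exp_add)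
  also have "\<dots> \<le> exp (- ((real m + 3) / x) + B (Suc m) * x)" using ex2 by simp
  also have "\<dots> = exp (- ((real m + 3) / x)) * exp (B (Suc m) * x)" by (rule exp_add)
  also have "\<dots> \<le> x ^ (m + 3) * exp (B (Suc m) * x)" using xp by (intro mult_right_mono) auto
  also have "\<dots> = g (Suc m) x" by (simp add: g_def pow_exp_def numeral_3_eq_3)
  finally have "E * (real m + 18) \<le> g (Suc m) x" .
  moreover have "1 * real m \<le> E * real m" using E by (intro mult_right_mono) auto
  ultimately show ?thesis using 1 by (simp add: algebra_simps)
qed

text \<open>With \<open>j = Suc m\<close>, a quarter or three quarters of a period after the start
  the \<open>j\<close>-th cosine has moved by at least 1. Earlier terms are bounded by twice their
  amplitudes, later ones have hardly moved. The lower bound on \<open>t\<close> ensures that these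
  times tend to infinity with \<open>m\<close>.\<close>

lemma drift_lower_bound:
  assumes x: "x > 0" and m: "(real m + 2) * x \<ge> 1 / x + 25 + 2 * x" "real m \<ge> 3 + 2 * x"
  shows "\<exists>t. t \<ge> 1 / (4 * \<bar>lam (Suc m)\<bar>) \<and> norm (drift \<theta> x t) \<ge> real m - (\<Sum>i. 63 * exp (- real i))"
proof -
  define j where "j = Suc m"
  define a where "a = (\<lambda>i. 2 * pi * (k i \<bullet> \<theta>) + 0)"
  have lp: "\<bar>lam j\<bar> > 0" by (rule lam_pos)
  obtain s where s: "s = 1 / 4 \<or> s = 3 / 4" "\<bar>cos (a j + 2 * pi * (sgn (lam j) * s)) - cos (a j)\<bar> \<ge> 1"
  proof -
    have "\<bar>sgn (lam j)\<bar> = 1" using lp by (simp add: abs_sgn_eq)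
    from cos_quarter_jump[OF this, of "a j"] show thesis using that by blast
  qed
  define t where "t = s / \<bar>lam j\<bar>"
  have t0: "t \<ge> 0" "t \<le> 1 / \<bar>lam j\<bar>" using s(1) lp by (auto simp: t_def field_simps)
  have t1: "t \<ge> 1 / (4 * \<bar>lam j\<bar>)" using s(1) lp by (auto simp: t_def field_simps)
  define f where "f = (\<lambda>i. (cos (a i + 2 * pi * lam i * t) - cos (a i)) *\<^sub>R g i x *\<^sub>R k i)"
  have sf: "summable (\<lambda>i. norm (f i))" unfolding f_def a_def by (rule summable_drift)
  have "drift \<theta> x t = suminf f" unfolding drift_def f_def a_def ..
  also have "\<dots> = (\<Sum>i. f (i + Suc j)) + (\<Sum>i<Suc j. f i)"
    by (rule suminf_split_initial_segment[OF summable_norm_cancel[OF sf]])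
  also have "\<dots> = f j + ((\<Sum>i. f (i + Suc j)) + (\<Sum>i<j. f i))" by simp
  finally have dr: "drift \<theta> x t = f j + ((\<Sum>i. f (i + Suc j)) + (\<Sum>i<j. f i))" .
  have nf: "norm (f i) = \<bar>cos (a i + 2 * pi * lam i * t) - cos (a i)\<bar> * (\<bar>g i x\<bar> * norm (k i))" for i
    by (simp add: f_def abs_mult)
  have gk: "\<bar>g i x\<bar> * norm (k i) \<le> \<bar>g i x\<bar> * K i" for i
    by (intro mult_left_mono norm_k_le) auto
  have "lam j * t = sgn (lam j) * s"
    by (simp add: t_def real_sgn_eq)
  then have "2 * pi * lam j * t = 2 * pi * (sgn (lam j) * s)" by simp
  with s(2) have s2: "1 \<le> \<bar>cos (a j + 2 * pi * lam j * t) - cos (a j)\<bar>" by (simp only:)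
  have "1 * (\<bar>g j x\<bar> * 1) \<le> norm (f j)"
    unfolding nf using norm_k_ge_1[of j] by (intro mult_mono[OF s2] mult_left_mono) auto
  then have fj: "g j x \<le> norm (f j)" using g_pos[OF x, of j] by simp
  have "norm (f i) \<le> 2 * (\<bar>g i x\<bar> * K i)" for i
    unfolding nf by (rule mult_mono[OF cos_diff_le(1) gk]) auto
  then have head: "norm (\<Sum>i<j. f i) \<le> (\<Sum>i<j. 2 * (\<bar>g i x\<bar> * K i))"
    by (rule sum_norm_le)
  have tl: "norm (f (i + Suc j)) \<le> 63 * exp (- real (i + Suc j))" for i
  proof -
    let ?n = "i + Suc j"
    have c: "\<bar>cos (a ?n + 2 * pi * lam ?n * t) - cos (a ?n)\<bar> \<le> 2 * pi * \<bar>lam ?n\<bar> * (1 / \<bar>lam j\<bar>)"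
    proof -
      have "\<bar>2 * pi * lam ?n * t\<bar> \<le> 2 * pi * \<bar>lam ?n\<bar> * (1 / \<bar>lam j\<bar>)"
        using t0 unfolding abs_mult by (intro mult_mono) auto
      then show ?thesis using cos_diff_le(2)[of "a ?n" "2 * pi * lam ?n * t"] by linarith
    qed
    have "norm (f ?n) \<le> 2 * pi * \<bar>lam ?n\<bar> * (1 / \<bar>lam j\<bar>) * (\<bar>g ?n x\<bar> * K ?n)"
      unfolding nf by (rule mult_mono[OF c gk]) auto
    also have "\<dots> = 2 * pi * (\<bar>g ?n x\<bar> * K ?n) * \<bar>lam ?n\<bar> / \<bar>lam j\<bar>" by simp
    also have "\<dots> \<le> \<bar>lam j\<bar> * (63 * exp (- real ?n)) / \<bar>lam j\<bar>"
    proof (rule divide_right_mono[OF tail_small[OF x]])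
      show "3 + 2 * x \<le> real ?n" using m(2) unfolding j_def by linarith
    qed auto
    also have "\<dots> = 63 * exp (- real ?n)" using lp by simp
    finally show ?thesis .
  qed
  have e63: "summable (\<lambda>i. 63 * exp (- real i))" by (rule summable_exp_minus)
  have e63': "summable (\<lambda>i. 63 * exp (- real (i + Suc j)))"
    using summable_ignore_initial_segment[OF e63] .
  have sft: "summable (\<lambda>i. norm (f (i + Suc j)))"
    using summable_ignore_initial_segment[OF sf] .
  have "norm (\<Sum>i. f (i + Suc j)) \<le> (\<Sum>i. norm (f (i + Suc j)))" by (rule summable_norm[OF sft])
  also have "\<dots> \<le> (\<Sum>i. 63 * exp (- real (i + Suc j)))" by (rule suminf_le[OF tl sft e63'])
  also have "\<dots> = (\<Sum>i. 63 * exp (- real i)) - (\<Sum>i<Suc j. 63 * exp (- real i))"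
    by (rule suminf_minus_initial_segment[OF e63])
  also have "\<dots> \<le> (\<Sum>i. 63 * exp (- real i))"
  proof -
    have "0 \<le> (\<Sum>i<Suc j. 63 * exp (- real i))" by (intro sum_nonneg) auto
    then show ?thesis by linarith
  qed
  finally have tail: "norm (\<Sum>i. f (i + Suc j)) \<le> (\<Sum>i. 63 * exp (- real i))" .
  have "norm (f j) - norm ((\<Sum>i. f (i + Suc j)) + (\<Sum>i<j. f i)) \<le> norm (drift \<theta> x t)"
    unfolding dr by (rule norm_diff_ineq)
  moreover have "norm ((\<Sum>i. f (i + Suc j)) + (\<Sum>i<j. f i)) \<le> norm (\<Sum>i. f (i + Suc j)) + norm (\<Sum>i<j. f i)"
    by (rule norm_triangle_ineq)
  moreover have "(\<Sum>i<j. 2 * (\<bar>g i x\<bar> * K i)) + real m \<le> g j x"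
    unfolding j_def by (rule head_small[OF x m(1)])
  ultimately have "norm (drift \<theta> x t) \<ge> real m - (\<Sum>i. 63 * exp (- real i))"
    using fj head tail by linarith
  then show ?thesis using t1 unfolding j_def by blast
qed

lemma orbit_unbounded:
  assumes x: "r $ l > 0"
  shows "Limsup at_top (\<lambda>t. ereal (norm (snd (orbit \<theta> r t)))) = \<infinity>"
proof (rule ccontr)
  assume "Limsup at_top (\<lambda>t. ereal (norm (snd (orbit \<theta> r t)))) \<noteq> \<infinity>"
  then have "Limsup at_top (\<lambda>t. ereal (norm (snd (orbit \<theta> r t)))) < \<infinity>" by (simp add: less_top)
  then obtain M :: real where "Limsup at_top (\<lambda>t. ereal (norm (snd (orbit \<theta> r t)))) < ereal M"
    by (metis less_PInf_Ex_of_nat less_irrefl)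
  then have "\<forall>\<^sub>F t in at_top. ereal (norm (snd (orbit \<theta> r t))) < ereal M" by (rule Limsup_lessD)
  then obtain T where T: "\<And>t. t \<ge> T \<Longrightarrow> norm (snd (orbit \<theta> r t)) < M"
    unfolding eventually_at_top_linorder by auto
  define x where "x = r $ l"
  have x0: "x > 0" using x by (simp add: x_def)
  define c where "c = (\<Sum>i. 63 * exp (- real i))"
  \<comment> \<open>The first two entries are the hypotheses of \<open>drift_lower_bound\<close>.
    The third makes \<open>m - c\<close> exceed \<open>M + norm r\<close>, and \<open>4 * T\<close>
    pushes the time, at least \<open>m / 4\<close>, beyond \<open>T\<close>.\<close>
  obtain m :: nat where m: "real m \<ge> max ((1 / x + 25 + 2 * x) / x) (max (3 + 2 * x) (max (M + c + norm r) (4 * T)))"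
    using real_arch_simple by blast
  have mM: "real m \<ge> M + c + norm r" and mT: "real m \<ge> 4 * T" using m by simp_all
  have m1: "(real m + 2) * x \<ge> 1 / x + 25 + 2 * x"
  proof -
    have "real m * x \<ge> 1 / x + 25 + 2 * x" using m x0 by (simp add: pos_divide_le_eq)
    then show ?thesis using x0 by (simp add: algebra_simps)
  qed
  obtain t where t: "t \<ge> 1 / (4 * \<bar>lam (Suc m)\<bar>)" "norm (drift \<theta> x t) \<ge> real m - c"
    using drift_lower_bound[OF x0 m1, of \<theta>] m unfolding c_def by auto
  have "\<bar>lam (Suc m)\<bar> \<le> exp (- real m)"
  proof -
    have "B (Suc m) \<ge> 1" using B_ge_2[of "Suc m"] by simp
    then have "real m * 1 \<le> (real (Suc m) + 1) * B (Suc m)" by (intro mult_mono) auto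
    then have "- (real (Suc m) + 1) * B (Suc m) \<le> - real m"
      by (simp only: mult_minus_left neg_le_iff_le mult_1_right)
    then have "exp (- (real (Suc m) + 1) * B (Suc m)) \<le> exp (- real m)" by (simp only: exp_le_cancel_iff)
    then show ?thesis using lam_le[of "Suc m"] unfolding lam_def by linarith
  qed
  then have "exp (real m) \<le> 1 / \<bar>lam (Suc m)\<bar>"
    using lam_pos[of "Suc m"] by (simp add: exp_minus field_simps)
  then have "real m \<le> 1 / \<bar>lam (Suc m)\<bar>" using exp_ge_add_one_self[of "real m"] by linarith
  then have "T \<le> t" using t(1) mT by simp
  from T[OF this] have "norm (r + drift \<theta> x t) < M" by (simp add: orbit_def x_def)
  moreover have "norm (drift \<theta> x t) \<le> norm (r + drift \<theta> x t) + norm r"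
    using norm_triangle_ineq4[of "r + drift \<theta> x t" r] by simp
  ultimately show False using t(2) mM by linarith
qed

section \<open>The Birkhoff normal form\<close>

lemma g'_small:
  assumes z: "\<bar>z\<bar> \<le> s" and s: "s \<le> 1"
  shows "\<bar>g' j z\<bar> \<le> s * bd j 0 1"
proof -
  have s0: "s \<ge> 0" using z by linarith
  have e: "exp (B j * z) \<le> exp (B j)"
    using mult_left_mono[of z 1 "B j"] z s by simp
  have p: "\<bar>pow_exp (Suc m) (B j) z\<bar> \<le> s * exp (B j)" for m
  proof -
    have "\<bar>z\<bar> ^ Suc m \<le> \<bar>z\<bar> ^ 1" using z s by (intro power_decreasing) auto
    then have "\<bar>z\<bar> ^ Suc m \<le> s" using z by simp
    then show ?thesis
      unfolding pow_exp_def abs_mult power_abs using e s0 by (intro mult_mono) auto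
  qed
  have "\<bar>g' j z\<bar> \<le> real (j + 2) * \<bar>pow_exp (j + 1) (B j) z\<bar> + B j * \<bar>pow_exp (j + 2) (B j) z\<bar>"
    unfolding g'_def by (rule order_trans[OF abs_triangle_ineq]) (simp add: abs_mult)
  also have "\<dots> \<le> real (j + 2) * (s * exp (B j)) + B j * (s * exp (B j))"
    using p[of j] p[of "j + 1"] by (intro add_mono mult_left_mono) auto
  also have "\<dots> = s * ((real (j + 2) + B j) * exp (B j))" by (simp add: algebra_simps)
  also have "\<dots> \<le> s * bd j 0 1"
    using linear_weight_le_bd[of 0 j 1] s0 by (intro mult_left_mono) auto
  finally show ?thesis .
qed

definition cL :: real where "cL = (\<Sum>j. \<bar>lam j\<bar> * bd j 0 1)"

lemma summable_cL: "summable (\<lambda>j. \<bar>lam j\<bar> * bd j 0 1)"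
  using summable_lam[of 0 0 1] by simp

lemma cL_nonneg: "cL \<ge> 0"
  unfolding cL_def by (intro suminf_nonneg summable_cL) (simp add: bd_nonneg)

text \<open>The factor \<open>s\<close> is the point: \<open>g' j\<close> vanishes at 0, so the
  Lipschitz constant shrinks with the interval. This gains the one order that the uniqueness proof
  needs.\<close>

lemma Q_lipschitz:
  assumes x: "\<bar>x\<bar> \<le> s" and y: "\<bar>y\<bar> \<le> s" and s: "s \<le> 1"
  shows "\<bar>Q \<theta> y - Q \<theta> x\<bar> \<le> cL * (s * \<bar>y - x\<bar>)"
proof -
  have gl: "\<bar>g j y - g j x\<bar> \<le> s * bd j 0 1 * \<bar>y - x\<bar>" for j
  proof -
    have "norm (g j y - g j x) \<le> s * bd j 0 1 * norm (y - x)"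
    proof (rule field_differentiable_bound[where S = "{-s..s}" and f' = "g' j"])
      show "(g j has_field_derivative g' j z) (at z within {- s..s})" for z
        using DERIV_g[of j z] by (rule has_field_derivative_at_within)
      show "norm (g' j z) \<le> s * bd j 0 1" if "z \<in> {-s..s}" for z
        using g'_small[of z s j] that s by (auto simp: abs_le_iff)
    qed (use x y in \<open>auto simp: abs_le_iff\<close>)
    then show ?thesis by simp
  qed
  have "(\<lambda>j. (g j y - g j x) * (cos (2 * pi * (k j \<bullet> \<theta>)) * lam j)) sums (Q \<theta> y - Q \<theta> x)"
    using sums_diff[OF Q_sums[of y \<theta>] Q_sums[of x \<theta>]] by (simp add: left_diff_distrib)
  then show ?thesis
    unfolding cL_def by (rule lam_series_bound[OF _ _ summable_cL]) (use gl in \<open>simp add: mult_ac\<close>)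
qed

text \<open>The coefficient of \<open>x\<^sup>m\<close> in the formal generating function \<open>f\<close>.\<close>
definition f0 :: "nat \<Rightarrow> real^'d \<Rightarrow> real" where
  "f0 m \<theta> = (\<Sum>j<m. gc j m / (2 * pi) * cos (2 * pi * (k j \<bullet> \<theta>) + - (pi / 2)))"

lemma f0_has_derivative:
  "(f0 m has_derivative (\<lambda>v. v \<bullet> (\<Sum>j<m. (gc j m * cos (2 * pi * (k j \<bullet> \<theta>))) *\<^sub>R k j))) (at \<theta>)"
proof -
  have "((\<lambda>\<theta>. \<Sum>j<m. gc j m / (2 * pi) * sin (2 * pi * (k j \<bullet> \<theta>))) has_derivative
      (\<lambda>v. \<Sum>j<m. gc j m / (2 * pi) * (2 * pi * (k j \<bullet> v) * cos (2 * pi * (k j \<bullet> \<theta>))))) (at \<theta>)"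
    by (auto intro!: derivative_eq_intros simp: fun_eq_iff mult_ac)
  moreover have "(\<Sum>j<m. gc j m / (2 * pi) * (2 * pi * (k j \<bullet> v) * cos (2 * pi * (k j \<bullet> \<theta>))))
     = v \<bullet> (\<Sum>j<m. (gc j m * cos (2 * pi * (k j \<bullet> \<theta>))) *\<^sub>R k j)" for v
    unfolding inner_sum_right by (intro sum.cong) (auto simp: inner_commute)
  moreover have "f0 m = (\<lambda>\<theta>. \<Sum>j<m. gc j m / (2 * pi) * sin (2 * pi * (k j \<bullet> \<theta>)))"
    unfolding f0_def[abs_def] by (simp add: cos_diff)
  ultimately show ?thesis by simp
qed

text \<open>The formal series \<open>f\<close> involves powers of \<open>r $ l\<close> alone, hence
  zero coefficients off \<open>range (single l)\<close>.\<close>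

definition acoef :: "('d \<Rightarrow> nat) \<Rightarrow> real^'d \<Rightarrow> real" where
  "acoef \<alpha> = (if \<alpha> \<in> range (single l) then f0 (\<alpha> l) else (\<lambda>_. 0))"

definition grad0 :: "nat \<Rightarrow> real^'d \<Rightarrow> real^'d" where
  "grad0 m \<theta> = (\<Sum>j<m. (gc j m * cos (2 * pi * (k j \<bullet> \<theta>))) *\<^sub>R k j)"

lemma acoef_has_derivative:
  "(acoef \<alpha> has_derivative (\<lambda>v. v \<bullet> (if \<alpha> \<in> range (single l) then grad0 (\<alpha> l) \<theta> else 0))) (at \<theta>)"
  unfolding acoef_def grad0_def using f0_has_derivative by auto

lemma grad_acoef: "grad1 (acoef \<alpha>) \<theta> = (if \<alpha> \<in> range (single l) then grad0 (\<alpha> l) \<theta> else 0)"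
  unfolding grad1_eqI[OF acoef_has_derivative] by (simp add: vec_eq_iff inner_axis')

lemma grad0_l: "grad0 m \<theta> $ l = 0"
  unfolding grad0_def by simp

lemma inner_grad0: "w \<bullet> grad0 m \<theta> = q m \<theta>"
  unfolding grad0_def q_def inner_sum_right by (simp add: lam_def)

lemma acoef_analytic: "real_analytic1 (acoef \<alpha>) UNIV"
proof (cases "\<alpha> \<in> range (single l)")
  case True
  then show ?thesis
    unfolding acoef_def f0_def[abs_def] if_P[OF True] by (intro real_analytic1_trig_sum) simp
next
  case False
  have "real_analytic1 (\<lambda>\<theta> :: real^'d. \<Sum>j\<in>({}::nat set). 0 * cos (2 * pi * (0 \<bullet> \<theta>) + 0)) UNIV"
    using real_analytic1_trig_sum[of "{} :: nat set" "\<lambda>_. 0" "\<lambda>_. 0" 0] by simp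
  then show ?thesis using False by (simp add: acoef_def)
qed

lemma acoef_periodic: "periodic1 (acoef \<alpha>)"
proof -
  have "f0 m (\<theta> + v) = f0 m \<theta>" if "int_vec v" for m \<theta> v
    unfolding f0_def inner_add_right cos_add_Ints[OF inner_int_vec[OF k_int that]] ..
  then show ?thesis unfolding periodic1_def acoef_def by simp
qed

lemma f0_01: "f0 0 = (\<lambda>_. 0)" "f0 (Suc 0) = (\<lambda>_. 0)"
  unfolding f0_def[abs_def] by (simp_all add: gc_def)

lemma H_shift: "H (\<theta>, r + v) = w \<bullet> r + w \<bullet> v - Q \<theta> (r $ l + v $ l)"
  by (simp add: H_def inner_add_right)

text \<open>The gradients have no \<open>l\<close>-component, so the substitution leaves
  \<open>r $ l\<close> alone and adds precisely the Taylor polynomial of \<open>Q\<close>; what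
  remains is its remainder.\<close>

lemma bnf_exists: "birkhoff_nf H (lin_series w)"
  unfolding birkhoff_nf_def
proof (intro exI[of _ acoef] conjI allI)
  fix \<alpha> :: "'d \<Rightarrow> nat"
  show "real_analytic1 (acoef \<alpha>) UNIV" by (rule acoef_analytic)
  show "periodic1 (acoef \<alpha>)" by (rule acoef_periodic)
  show "mdeg \<alpha> < 2 \<longrightarrow> acoef \<alpha> = (\<lambda>_. 0)"
  proof
    assume m: "mdeg \<alpha> < 2"
    show "acoef \<alpha> = (\<lambda>_. 0)"
    proof (cases "\<alpha> \<in> range (single l)")
      case True
      then obtain m where "\<alpha> = single l m" by auto
      then have "\<alpha> l = 0 \<or> \<alpha> l = Suc 0" using m by auto
      then show ?thesis using True f0_01 by (auto simp: acoef_def)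
    qed (simp add: acoef_def)
  qed
next
  fix \<theta> :: "real^'d" and n :: nat
  show "\<exists>C>0. \<exists>\<delta>>0. \<forall>r. norm r < \<delta> \<longrightarrow>
      \<bar>H (\<theta>, r + (\<Sum>\<alpha>\<in>{\<alpha>. mdeg \<alpha> \<le> n}. xmon r \<alpha> *\<^sub>R grad1 (acoef \<alpha>) \<theta>)) -
       (\<Sum>\<alpha>\<in>{\<alpha>. mdeg \<alpha> \<le> n}. lin_series w \<alpha> * xmon r \<alpha>)\<bar> \<le> C * norm r ^ (n + 1)"
  proof (rule exI[of _ "cQ + norm w + 1"], intro conjI exI[of _ "1::real"] allI impI)
    fix r :: "real^'d" assume r: "norm r < 1"
    have x: "\<bar>r $ l\<bar> \<le> norm r" by (rule component_le_norm_cart)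
    define v where "v = (\<Sum>m\<le>n. (r $ l) ^ m *\<^sub>R grad0 m \<theta>)"
    have v: "(\<Sum>\<alpha>\<in>{\<alpha>. mdeg \<alpha> \<le> n}. xmon r \<alpha> *\<^sub>R grad1 (acoef \<alpha>) \<theta>) = v"
      unfolding grad_acoef v_def by (rule sum_single_mdeg)
    have vl: "v $ l = 0" unfolding v_def by (simp add: grad0_l)
    have wv: "w \<bullet> v = (\<Sum>m\<le>n. q m \<theta> * (r $ l) ^ m)"
      unfolding v_def inner_sum_right by (simp add: inner_grad0 mult.commute)
    have "\<bar>Q \<theta> (r $ l) - (\<Sum>m\<le>n. q m \<theta> * (r $ l) ^ m)\<bar> \<le> cQ * \<bar>r $ l\<bar> ^ (n + 1)"
      by (rule Q_taylor) (use x r in linarith)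
    also have "\<dots> \<le> cQ * norm r ^ (n + 1)"
      using x cQ_nonneg by (intro mult_left_mono power_mono) auto
    finally have "\<bar>H (\<theta>, r + v) - (\<Sum>\<alpha>\<in>{\<alpha>. mdeg \<alpha> \<le> n}. lin_series w \<alpha> * xmon r \<alpha>)\<bar>
        \<le> cQ * norm r ^ (n + 1) + norm w * norm r ^ (n + 1)"
      using lin_series_sum_bound[of w r n] unfolding H_shift vl wv by simp
    also have "\<dots> \<le> (cQ + norm w + 1) * norm r ^ (n + 1)" by (simp add: algebra_simps)
    finally show "\<bar>H (\<theta>, r + (\<Sum>\<alpha>\<in>{\<alpha>. mdeg \<alpha> \<le> n}. xmon r \<alpha> *\<^sub>R grad1 (acoef \<alpha>) \<theta>)) -
       (\<Sum>\<alpha>\<in>{\<alpha>. mdeg \<alpha> \<le> n}. lin_series w \<alpha> * xmon r \<alpha>)\<bar> \<le> (cQ + norm w + 1) * norm r ^ (n + 1)"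
      unfolding v .
  qed (use cQ_nonneg norm_ge_zero[of w] in linarith)+
qed

text \<open>The induction carries along that the gradients have no \<open>l\<close>-component. If
  this holds below degree \<open>n\<close>, the substitution moves \<open>r $ l\<close> by order
  \<open>n\<close> only, and by \<open>Q_lipschitz\<close> this changes \<open>Q\<close> at order
  \<open>n + 1\<close>. The equation in degree \<open>n\<close> is then linear, driven by the known
  \<open>q\<close>.\<close>

lemma bnf_unique:
  assumes w: "non_resonant w" and N: "birkhoff_nf H N"
  shows "N = lin_series w"
proof -
  obtain a where a0: "\<And>\<alpha>. mdeg \<alpha> < 2 \<Longrightarrow> a \<alpha> = (\<lambda>_. 0)"
    and an: "\<And>\<alpha>. real_analytic1 (a \<alpha>) UNIV" and ap: "\<And>\<alpha>. periodic1 (a \<alpha>)"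
    and ab: "\<And>\<theta> n. \<exists>C>0. \<exists>\<delta>>0. \<forall>r. norm r < \<delta> \<longrightarrow>
        \<bar>H (\<theta>, r + (\<Sum>\<alpha>\<in>{\<alpha>. mdeg \<alpha> \<le> n}. xmon r \<alpha> *\<^sub>R grad1 (a \<alpha>) \<theta>))
          - (\<Sum>\<alpha>\<in>{\<alpha>. mdeg \<alpha> \<le> n}. N \<alpha> * xmon r \<alpha>)\<bar> \<le> C * norm r ^ (n + 1)"
    using N unfolding birkhoff_nf_def by blast
  have aD: "(a \<alpha> has_derivative frechet_derivative (a \<alpha>) (at \<theta>)) (at \<theta>)" for \<alpha> \<theta>
    using real_analytic1_differentiable[OF an] by (simp only: frechet_derivative_works)
  have main: "\<forall>\<alpha>. mdeg \<alpha> = n \<longrightarrow> N \<alpha> = lin_series w \<alpha> \<and> (\<forall>\<theta>. grad1 (a \<alpha>) \<theta> $ l = 0)" for n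
  proof (induction n rule: less_induct)
    case (less n)
    have low: "grad1 (a \<alpha>) \<theta> $ l = 0" if "mdeg \<alpha> < n" for \<alpha> \<theta> using less that by blast
    \<comment> \<open>At fixed \<open>\<theta>\<close>, the coefficient of
      \<open>xmon r \<alpha>\<close> in the linear part after substitution, minus \<open>Q\<close>
      and minus \<open>N\<close>.\<close>
    have coef: "lin_series w \<alpha> + w \<bullet> grad1 (a \<alpha>) \<theta> - (if \<alpha> \<in> range (single l) then q (\<alpha> l) \<theta> else 0) - N \<alpha> = 0"
      if \<alpha>: "mdeg \<alpha> \<le> n" for \<alpha> \<theta>
    proof -
      let ?A = "{\<alpha> :: 'd \<Rightarrow> nat. mdeg \<alpha> \<le> n}"
      define c where "c = (\<lambda>\<alpha>. lin_series w \<alpha> + w \<bullet> grad1 (a \<alpha>) \<theta> - (if \<alpha> \<in> range (single l) then q (\<alpha> l) \<theta> else 0) - N \<alpha>)"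
      obtain C \<delta> where C: "C > 0" "\<delta> > 0" and Cb: "\<And>r. norm r < \<delta> \<Longrightarrow>
        \<bar>H (\<theta>, r + (\<Sum>\<alpha>\<in>?A. xmon r \<alpha> *\<^sub>R grad1 (a \<alpha>) \<theta>)) - (\<Sum>\<alpha>\<in>?A. N \<alpha> * xmon r \<alpha>)\<bar> \<le> C * norm r ^ (n + 1)"
        using ab[of \<theta> n] by blast
      define Cv where "Cv = (\<Sum>\<alpha>\<in>?A. \<bar>grad1 (a \<alpha>) \<theta> $ l\<bar>)"
      have Cv: "Cv \<ge> 0" unfolding Cv_def by (intro sum_nonneg) auto
      \<comment> \<open>Within this radius both \<open>r $ l\<close> and its shifted value stay in
        the unit interval, where \<open>Q_lipschitz\<close> applies.\<close>
      define \<delta>' where "\<delta>' = min \<delta> (1 / (1 + Cv))"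
      have small: "\<bar>\<Sum>\<alpha>\<in>?A. c \<alpha> * xmon r \<alpha>\<bar> \<le> (C + norm w + cL * (1 + Cv) * Cv + cQ) * norm r ^ (n + 1)"
        if r: "norm r < \<delta>'" for r
      proof -
        define v where "v = (\<Sum>\<alpha>\<in>?A. xmon r \<alpha> *\<^sub>R grad1 (a \<alpha>) \<theta>)"
        have r1: "(1 + Cv) * norm r \<le> 1"
          using r Cv by (simp add: \<delta>'_def pos_less_divide_eq mult.commute)
        have "1 * norm r \<le> (1 + Cv) * norm r" using Cv by (intro mult_right_mono) auto
        then have r2: "norm r \<le> 1" "norm r \<le> (1 + Cv) * norm r" using r1 by auto
        have x: "\<bar>r $ l\<bar> \<le> norm r" by (rule component_le_norm_cart)
        have vl: "\<bar>v $ l\<bar> \<le> Cv * norm r ^ n"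
        proof -
          have "\<bar>v $ l\<bar> \<le> (\<Sum>\<alpha>\<in>?A. \<bar>xmon r \<alpha> * grad1 (a \<alpha>) \<theta> $ l\<bar>)"
            unfolding v_def by simp
          also have "\<dots> \<le> (\<Sum>\<alpha>\<in>?A. \<bar>grad1 (a \<alpha>) \<theta> $ l\<bar> * norm r ^ n)"
          proof (rule sum_mono)
            fix \<alpha> assume "\<alpha> \<in> ?A"
            then consider "mdeg \<alpha> < n" | "mdeg \<alpha> = n" by fastforce
            then show "\<bar>xmon r \<alpha> * grad1 (a \<alpha>) \<theta> $ l\<bar> \<le> \<bar>grad1 (a \<alpha>) \<theta> $ l\<bar> * norm r ^ n"
            proof cases
              case 2
              then have "\<bar>xmon r \<alpha>\<bar> \<le> norm r ^ n" using abs_xmon_le[of r \<alpha>] by simp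
              then have "\<bar>grad1 (a \<alpha>) \<theta> $ l\<bar> * \<bar>xmon r \<alpha>\<bar> \<le> \<bar>grad1 (a \<alpha>) \<theta> $ l\<bar> * norm r ^ n"
                by (intro mult_left_mono) auto
              then show ?thesis by (simp add: abs_mult mult.commute)
            qed (simp add: low)
          qed
          finally show ?thesis by (simp add: Cv_def sum_distrib_right)
        qed
        have lip: "\<bar>Q \<theta> (r $ l + v $ l) - Q \<theta> (r $ l)\<bar> \<le> cL * (1 + Cv) * Cv * norm r ^ (n + 1)"
        \<comment> \<open>In degree 0 the shift is not small with \<open>r\<close>, but there
          \<open>a0\<close> makes it vanish.\<close>
        proof (cases "n = 0")
          case True
          have "v = 0" unfolding v_def
          proof (rule sum.neutral, rule ballI)
            fix \<alpha> assume "\<alpha> \<in> ?A"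
            then have "a \<alpha> = (\<lambda>_. 0)" using a0 True by simp
            then have "grad1 (a \<alpha>) \<theta> = 0" using grad1_eqI[of "\<lambda>_. 0" "\<lambda>_. 0" \<theta>] by (simp add: vec_eq_iff)
            then show "xmon r \<alpha> *\<^sub>R grad1 (a \<alpha>) \<theta> = 0" by simp
          qed
          then show ?thesis using cL_nonneg Cv by simp
        next
          case False
          have "norm r ^ n \<le> norm r ^ 1" using r2 False by (intro power_decreasing) auto
          then have "Cv * norm r ^ n \<le> Cv * norm r" using Cv by (intro mult_left_mono) auto
          then have "\<bar>r $ l + v $ l\<bar> \<le> (1 + Cv) * norm r" using x vl by (simp add: algebra_simps)
          moreover have "\<bar>r $ l\<bar> \<le> (1 + Cv) * norm r" using x r2 by linarith
          ultimately have "\<bar>Q \<theta> (r $ l + v $ l) - Q \<theta> (r $ l)\<bar> \<le> cL * ((1 + Cv) * norm r * \<bar>(r $ l + v $ l) - r $ l\<bar>)"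
            using r1 by (intro Q_lipschitz) auto
          also have "\<dots> \<le> cL * ((1 + Cv) * norm r * (Cv * norm r ^ n))"
            using vl cL_nonneg Cv by (intro mult_left_mono) auto
          finally show ?thesis by (simp add: mult_ac)
        qed
        have tay: "\<bar>Q \<theta> (r $ l) - (\<Sum>m\<le>n. q m \<theta> * (r $ l) ^ m)\<bar> \<le> cQ * norm r ^ (n + 1)"
        proof -
          have "\<bar>Q \<theta> (r $ l) - (\<Sum>m\<le>n. q m \<theta> * (r $ l) ^ m)\<bar> \<le> cQ * \<bar>r $ l\<bar> ^ (n + 1)"
            by (rule Q_taylor) (use x r2 in linarith)
          also have "\<dots> \<le> cQ * norm r ^ (n + 1)"
            using x cQ_nonneg by (intro mult_left_mono power_mono) auto
          finally show ?thesis .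
        qed
        have wv: "w \<bullet> v = (\<Sum>\<alpha>\<in>?A. w \<bullet> grad1 (a \<alpha>) \<theta> * xmon r \<alpha>)"
          unfolding v_def inner_sum_right by (simp add: mult.commute)
        have qs: "(\<Sum>\<alpha>\<in>?A. (if \<alpha> \<in> range (single l) then q (\<alpha> l) \<theta> else 0) * xmon r \<alpha>) = (\<Sum>m\<le>n. q m \<theta> * (r $ l) ^ m)"
          using sum_single_mdeg[of r l "\<lambda>m. q m \<theta>" n] by (simp add: mult.commute)
        have "(\<Sum>\<alpha>\<in>?A. c \<alpha> * xmon r \<alpha>) = (\<Sum>\<alpha>\<in>?A. lin_series w \<alpha> * xmon r \<alpha>) + w \<bullet> v
            - (\<Sum>m\<le>n. q m \<theta> * (r $ l) ^ m) - (\<Sum>\<alpha>\<in>?A. N \<alpha> * xmon r \<alpha>)"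
          unfolding c_def wv qs[symmetric] by (simp only: left_diff_distrib distrib_right sum.distrib sum_subtractf)
        moreover have "\<bar>w \<bullet> r + w \<bullet> v - Q \<theta> (r $ l + v $ l) - (\<Sum>\<alpha>\<in>?A. N \<alpha> * xmon r \<alpha>)\<bar> \<le> C * norm r ^ (n + 1)"
          using Cb[of r] r unfolding v_def[symmetric] H_shift by (simp add: \<delta>'_def)
        moreover note lin_series_sum_bound[of w r n]
        moreover have "(C + norm w + cL * (1 + Cv) * Cv + cQ) * norm r ^ (n + 1) =
          C * norm r ^ (n + 1) + norm w * norm r ^ (n + 1) + cL * (1 + Cv) * Cv * norm r ^ (n + 1) + cQ * norm r ^ (n + 1)"
          by (simp only: distrib_right)
        ultimately show ?thesis using lip tay by linarith
      qed
      have "\<delta>' > 0" using C(2) Cv by (simp add: \<delta>'_def)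
      from mpoly_small_imp_0[OF w this small \<alpha>] have "c \<alpha> = 0" .
      then show ?thesis by (simp add: c_def)
    qed
    show ?case
    proof (intro allI impI)
      fix \<alpha> :: "'d \<Rightarrow> nat" assume \<alpha>: "mdeg \<alpha> = n"
      \<comment> \<open>The difference from the known solution: its derivative along
        \<open>w\<close> no longer contains \<open>q\<close> and is the constant
        \<open>N \<alpha> - lin_series w \<alpha>\<close>.\<close>
      define b where "b = (\<lambda>\<theta>. a \<alpha> \<theta> - acoef \<alpha> \<theta>)"
      define D where "D = (\<lambda>\<theta> v. frechet_derivative (a \<alpha>) (at \<theta>) v - v \<bullet> (if \<alpha> \<in> range (single l) then grad0 (\<alpha> l) \<theta> else 0))"
      have bD: "(b has_derivative D \<theta>) (at \<theta>)" for \<theta>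
        unfolding b_def D_def by (intro has_derivative_diff aD acoef_has_derivative)
      have bk: "D \<theta> w = N \<alpha> - lin_series w \<alpha>" for \<theta>
        using coef[of \<alpha> \<theta>] \<alpha> inner_grad1[OF aD, of w \<alpha> \<theta>] unfolding D_def by (simp add: inner_grad0 split: if_splits)
      have bp: "periodic1 b"
        using ap[of \<alpha>] acoef_periodic[of \<alpha>] unfolding b_def periodic1_def by simp
      note coh = periodic_cohomological[OF w bD bk bp]
      have "N \<alpha> = lin_series w \<alpha>" using coh(1) by simp
      moreover have "grad1 (a \<alpha>) \<theta> $ l = 0" for \<theta>
      proof -
        have "a \<alpha> = (\<lambda>\<theta>. acoef \<alpha> \<theta> + b 0)" using coh(2)[of _ 0] by (auto simp: b_def fun_eq_iff algebra_simps)
        then have "(a \<alpha> has_derivative (\<lambda>v. v \<bullet> (if \<alpha> \<in> range (single l) then grad0 (\<alpha> l) \<theta> else 0))) (at \<theta>)"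
          using has_derivative_add[OF acoef_has_derivative[of \<alpha> \<theta>] has_derivative_const[of "b 0"]] by simp
        from grad1_eqI[OF this] show ?thesis by (simp add: inner_axis' grad0_l)
      qed
      ultimately show "N \<alpha> = lin_series w \<alpha> \<and> (\<forall>\<theta>. grad1 (a \<alpha>) \<theta> $ l = 0)" by blast
    qed
  qed
  then show ?thesis by (auto simp: fun_eq_iff)
qed

end

section \<open>Existence of sparse frequencies\<close>

text \<open>The hypothesis yields vectors with
  \<open>\<bar>w \<bullet> v\<bar> \<le> exp (- A * L v)\<close> for any prescribed
  \<open>A\<close>. At each step \<open>A\<close> is computed from the past alone, large enough for
  the \<open>b'\<close> chosen afterwards, which is linear in \<open>L v'\<close>.\<close>

lemma sparse_frequencies_exist:
  fixes w :: "real^'d" and l :: 'd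
  assumes nonres: "non_resonant w"
    and liou: "\<exists>k :: nat \<Rightarrow> real^'d. (\<forall>j. int_vec (k j) \<and> k j $ l = 0 \<and> k j \<noteq> 0) \<and>
                 filterlim (\<lambda>j. ln \<bar>w \<bullet> k j\<bar> / infnorm (k j)) at_bot sequentially"
  shows "\<exists>k B. sparse_frequencies w l k B"
proof -
  define L where "L = (\<lambda>v :: real^'d. \<Sum>i\<in>UNIV. \<bar>v $ i\<bar>)"
  define adm where "adm = (\<lambda>v :: real^'d. int_vec v \<and> v $ l = 0 \<and> v \<noteq> 0 \<and> w \<bullet> v \<noteq> 0 \<and> L v \<ge> 1)"
  have ex: "\<exists>v. adm v \<and> \<bar>w \<bullet> v\<bar> \<le> exp (- A * L v)" if A: "A \<ge> 0" for A
  proof -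
    obtain k where k: "\<And>j. int_vec (k j) \<and> k j $ l = 0 \<and> k j \<noteq> 0"
      and lim: "filterlim (\<lambda>j. ln \<bar>w \<bullet> k j\<bar> / infnorm (k j)) at_bot sequentially"
      using liou by blast
    \<comment> \<open>The factor \<open>CARD('d)\<close> converts the maximum norm into the l1 norm
      \<open>L\<close>.\<close>
    have "\<forall>\<^sub>F j in sequentially. ln \<bar>w \<bullet> k j\<bar> / infnorm (k j) \<le> - (A * CARD('d))"
      using lim by (simp add: filterlim_at_bot)
    then obtain j where j: "ln \<bar>w \<bullet> k j\<bar> / infnorm (k j) \<le> - (A * CARD('d))"
      by (auto simp: eventually_sequentially)
    define v where "v = k j"
    have v: "int_vec v" "v $ l = 0" "v \<noteq> 0" using k by (auto simp: v_def)
    have wv: "w \<bullet> v \<noteq> 0" using nonres v unfolding non_resonant_def by blast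
    have inf: "infnorm v > 0" using v(3) by (simp add: infnorm_pos_lt)
    have Linf: "L v \<le> CARD('d) * infnorm v"
    proof -
      have "L v \<le> (\<Sum>i\<in>(UNIV::'d set). infnorm v)"
        unfolding L_def by (intro sum_mono component_le_infnorm_cart)
      then show ?thesis by simp
    qed
    obtain i where i: "v $ i \<noteq> 0" using v(3) by (auto simp: vec_eq_iff)
    have "1 \<le> \<bar>v $ i\<bar>" using i v(1) unfolding int_vec_def by (metis Ints_nonzero_abs_ge1)
    also have "\<dots> \<le> L v" unfolding L_def by (rule member_le_sum) auto
    finally have L1: "L v \<ge> 1" .
    have "ln \<bar>w \<bullet> v\<bar> \<le> - (A * CARD('d)) * infnorm v"
      using j inf by (simp add: v_def pos_divide_le_eq)
    also have "\<dots> \<le> - A * L v"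
      using mult_left_mono[OF Linf A] by (simp add: mult.assoc)
    finally have "exp (ln \<bar>w \<bullet> v\<bar>) \<le> exp (- A * L v)" by (simp only: exp_le_cancel_iff)
    then have "\<bar>w \<bullet> v\<bar> \<le> exp (- A * L v)" using wv by simp
    then show ?thesis using v wv L1 by (auto simp: adm_def)
  qed
  define P where "P = (\<lambda>n (v, b). adm v \<and> b \<ge> (real n + 1) * (L v + real n + 2) \<and> \<bar>w \<bullet> v\<bar> \<le> exp (- (real n + 1) * b))"
  define R where "R = (\<lambda>n (v, b) (v', b'). b' \<ge> (real n + 2) * (b + real n + 3) \<and> \<bar>w \<bullet> v'\<bar> \<le> \<bar>w \<bullet> v\<bar> * exp (- (real n + 2) * b'))"
  have "\<exists>f. \<forall>n. P n (f n) \<and> R n (f n) (f (Suc n))"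
  proof (rule dependent_nat_choice)
    \<comment> \<open>The rate 3 suffices to start with \<open>b = L v + 2\<close>, because
      \<open>L v \<ge> 1\<close> gives \<open>L v + 2 \<le> 3 * L v\<close>.\<close>
    obtain v where v: "adm v" "\<bar>w \<bullet> v\<bar> \<le> exp (- 3 * L v)" using ex[of 3] by auto
    have "L v \<ge> 1" using v by (simp add: adm_def)
    then have "exp (- 3 * L v) \<le> exp (- (L v + 2))" by simp
    with v(2) have "\<bar>w \<bullet> v\<bar> \<le> exp (- (L v + 2))" by (rule order_trans)
    then have "P 0 (v, L v + 2)" using v by (simp add: P_def)
    then show "\<exists>x. P 0 x" by blast
  next
    fix x n assume x: "P n x"
    obtain v b where vb: "x = (v, b)" by (cases x)
    have adm: "adm v" and b: "b \<ge> (real n + 1) * (L v + real n + 2)" using x by (auto simp: P_def vb)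
    have b0: "b \<ge> 0" using b adm by (intro order_trans[OF _ b]) (auto simp: adm_def)
    \<comment> \<open>Smallness relative to \<open>e\<close> yields the absolute bound in
      \<open>P\<close> and the bound relative to the previous divisor in \<open>R\<close> at
      once.\<close>
    define e where "e = min 1 \<bar>w \<bullet> v\<bar>"
    have e: "e > 0" "e \<le> 1" "e \<le> \<bar>w \<bullet> v\<bar>" using adm by (auto simp: e_def adm_def)
    \<comment> \<open>The first summand covers \<open>(n + 2) * b'\<close>, because
      \<open>L v' \<ge> 1\<close> turns the constant part of \<open>b'\<close> into a multiple of
      \<open>L v'\<close>; the second covers \<open>ln e\<close>.\<close>
    define A where "A = (real n + 2)\<^sup>2 * (real n + 4 + b) + \<bar>ln e\<bar>"
    have "A \<ge> 0" unfolding A_def using b0 by simp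
    then obtain v' where v': "adm v'" "\<bar>w \<bullet> v'\<bar> \<le> exp (- A * L v')" using ex by blast
    define b' where "b' = (real n + 2) * (L v' + real n + 3 + b)"
    have L1: "L v' \<ge> 1" using v' by (simp add: adm_def)
    have b'1: "b' \<ge> (real n + 2) * (b + real n + 3)" and b'2: "b' \<ge> (real n + 2) * (L v' + real n + 3)"
      unfolding b'_def using L1 b0 by (auto intro!: mult_left_mono)
    have "(real n + 2) * b' = (real n + 2)\<^sup>2 * (L v' + (real n + 3 + b))"
      by (simp add: b'_def power2_eq_square algebra_simps)
    also have "\<dots> \<le> (real n + 2)\<^sup>2 * ((real n + 4 + b) * L v')"
    proof (rule mult_left_mono)
      have "(real n + 3 + b) * 1 \<le> (real n + 3 + b) * L v'" using L1 b0 by (intro mult_left_mono) auto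
      then show "L v' + (real n + 3 + b) \<le> (real n + 4 + b) * L v'" by (simp add: algebra_simps)
    qed simp
    finally have "(real n + 2) * b' \<le> (real n + 2)\<^sup>2 * (real n + 4 + b) * L v'" by (simp add: mult.assoc)
    moreover have "\<bar>ln e\<bar> * 1 \<le> \<bar>ln e\<bar> * L v'" using L1 by (intro mult_left_mono) auto
    ultimately have "- A * L v' \<le> ln e + - (real n + 2) * b'"
      unfolding A_def by (simp add: distrib_right algebra_simps)
    then have "exp (- A * L v') \<le> exp (ln e + - (real n + 2) * b')" by (simp only: exp_le_cancel_iff)
    also have "\<dots> = e * exp (- (real n + 2) * b')" using e(1) by (simp only: exp_add exp_ln)
    finally have small: "\<bar>w \<bullet> v'\<bar> \<le> e * exp (- (real n + 2) * b')" using v'(2) by linarith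
    have "e * exp (- (real n + 2) * b') \<le> 1 * exp (- (real n + 2) * b')"
      using e by (intro mult_right_mono) auto
    with small have s1: "\<bar>w \<bullet> v'\<bar> \<le> exp (- (real n + 2) * b')" by linarith
    have "e * exp (- (real n + 2) * b') \<le> \<bar>w \<bullet> v\<bar> * exp (- (real n + 2) * b')"
      using e by (intro mult_right_mono) auto
    with small have s2: "\<bar>w \<bullet> v'\<bar> \<le> \<bar>w \<bullet> v\<bar> * exp (- (real n + 2) * b')" by linarith
    have sn: "real (Suc n) + 1 = real n + 2" "L v' + real (Suc n) + 2 = L v' + real n + 3" by simp_all
    have "P (Suc n) (v', b') \<and> R n x (v', b')"
      unfolding P_def R_def vb prod.case sn using v'(1) b'1 b'2 s1 s2 by blast
    then show "\<exists>y. P (Suc n) y \<and> R n x y" by blast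
  qed
  then obtain f where f: "\<And>n. P n (f n)" "\<And>n. R n (f n) (f (Suc n))" by blast
  have "sparse_frequencies w l (\<lambda>n. fst (f n)) (\<lambda>n. snd (f n))"
    by unfold_locales
      (use f in \<open>auto simp: P_def R_def adm_def L_def case_prod_unfold\<close>)
  then show ?thesis by blast
qed

text \<open>The coordinate \<open>l\<close> is the distinguished last one, and \<open>\<Psi>\<close>
  is a lift to the universal cover: it descends to the torus because integer translations are
  respected, and bijectivity is stated modulo integer vectors. The inverse is analytic as well,
  since a symplectic derivative is invertible. The curve \<open>\<gamma>\<close> is the orbit of the
  flow, because solutions of Hamilton's equations for an entire \<open>H\<close> are unique.\<close>

theorem theoremE:
  fixes w :: "real^'d" and l :: 'd
  assumes d3: "CARD('d) \<ge> 3"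
    and nonres: "non_resonant w"
    and liou: "\<exists>k :: nat \<Rightarrow> real^'d. (\<forall>j. int_vec (k j) \<and> k j $ l = 0 \<and> k j \<noteq> 0) \<and>
                 filterlim (\<lambda>j. ln \<bar>w \<bullet> k j\<bar> / infnorm (k j)) at_bot sequentially"
  shows "\<exists>H :: (real^'d) \<times> (real^'d) \<Rightarrow> real.
     real_entire2 H \<and> angle_periodic H \<and>
     (\<exists>C>0. \<exists>\<delta>>0. \<forall>\<theta> r. norm r \<le> \<delta> \<longrightarrow> \<bar>H (\<theta>, r) - w \<bullet> r\<bar> \<le> C * (norm r)\<^sup>2) \<and>
     (\<exists>\<Psi> :: (real^'d) \<times> (real^'d) \<Rightarrow> (real^'d) \<times> (real^'d).
        let M = {p. snd p $ l < 0} in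
        (\<forall>p\<in>M. \<Psi> p \<in> M) \<and>
        (\<forall>i. real_analytic2 (\<lambda>p. fst (\<Psi> p) $ i) M \<and> real_analytic2 (\<lambda>p. snd (\<Psi> p) $ i) M) \<and>
        (\<forall>p\<in>M. \<exists>D. (\<Psi> has_derivative D) (at p) \<and> (\<forall>u v. symp (D u) (D v) = symp u v)) \<and>
        (\<forall>\<theta> r k. (\<theta>, r) \<in> M \<longrightarrow> int_vec k \<longrightarrow>
            (\<exists>k'. int_vec k' \<and> \<Psi> (\<theta> + k, r) = \<Psi> (\<theta>, r) + (k', 0))) \<and>
        (\<forall>q\<in>M. \<exists>p\<in>M. \<exists>k. int_vec k \<and> \<Psi> p = q + (k, 0)) \<and>
        (\<forall>p\<in>M. \<forall>q\<in>M. \<forall>k. int_vec k \<longrightarrow> \<Psi> p = \<Psi> q + (k, 0) \<longrightarrow>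
            (\<exists>k'. int_vec k' \<and> p = q + (k', 0))) \<and>
        (\<forall>p\<in>M. H (\<Psi> p) = w \<bullet> snd p)) \<and>
     (\<forall>\<theta> r. r $ l > 0 \<longrightarrow>
        (\<exists>\<gamma>. \<gamma> 0 = (\<theta>, r) \<and> ham_solution H \<gamma> \<and>
             Limsup at_top (\<lambda>t. ereal (norm (snd (\<gamma> t)))) = \<infinity>)) \<and>
     birkhoff_nf H (lin_series w) \<and> (\<forall>N. birkhoff_nf H N \<longrightarrow> N = lin_series w)"
proof -
  obtain k B where "sparse_frequencies w l k B"
    using sparse_frequencies_exist[OF nonres liou] by blast
  then interpret sparse_frequencies w l k B .
  show ?thesis
    unfolding Let_def
  proof (rule exI[of _ H], (intro conjI; (rule exI[of _ \<Psi>])?; (intro conjI ballI allI impI)?))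
    show "real_entire2 H" by (rule H_entire)
    show "angle_periodic H" by (rule H_periodic)
    show "\<exists>C>0. \<exists>\<delta>>0. \<forall>\<theta> r. norm r \<le> \<delta> \<longrightarrow> \<bar>H (\<theta>, r) - w \<bullet> r\<bar> \<le> C * (norm r)\<^sup>2"
      by (rule H_quadratic)
    show "birkhoff_nf H (lin_series w)" by (rule bnf_exists)
    show "N = lin_series w" if "birkhoff_nf H N" for N using nonres that by (rule bnf_unique)
    show "\<exists>\<gamma>. \<gamma> 0 = (\<theta>, r) \<and> ham_solution H \<gamma> \<and>
        Limsup at_top (\<lambda>t. ereal (norm (snd (\<gamma> t)))) = \<infinity>" if "r $ l > 0" for \<theta> r
      using orbit_is_solution orbit_unbounded[OF that] by blast
  next
    fix p :: "(real^'d) \<times> (real^'d)" assume p: "p \<in> {p. snd p $ l < 0}"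
    show "\<Psi> p \<in> {p. snd p $ l < 0}" using p by (simp add: \<Psi>_def)
    show "\<exists>D. (\<Psi> has_derivative D) (at p) \<and> (\<forall>u v. symp (D u) (D v) = symp u v)"
      using p by (intro \<Psi>_symplectic) simp
    show "H (\<Psi> p) = w \<bullet> snd p" using p by (intro H_\<Psi>) simp
    have "int_vec (0::real^'d)" by (simp add: int_vec_def)
    moreover obtain p' where "snd p' $ l = snd p $ l" "\<Psi> p' = p" using \<Psi>_surj by blast
    ultimately show "\<exists>p'\<in>{p. snd p $ l < 0}. \<exists>k. int_vec k \<and> \<Psi> p' = p + (k, 0)"
      using p by (intro bexI[of _ p'] exI[of _ 0]) (auto simp flip: zero_prod_def)
  next
    fix i
    show "real_analytic2 (\<lambda>p. fst (\<Psi> p) $ i) {p. snd p $ l < 0}"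
      "real_analytic2 (\<lambda>p. snd (\<Psi> p) $ i) {p. snd p $ l < 0}"
      by (rule \<Psi>_analytic; simp)+
  next
    fix \<theta> r k :: "real^'d" assume "int_vec k"
    then show "\<exists>k'. int_vec k' \<and> \<Psi> (\<theta> + k, r) = \<Psi> (\<theta>, r) + (k', 0)"
      using \<Psi>_add_int[of k "(\<theta>, r)"] by (intro exI[of _ k]) simp
  next
    fix p p' :: "(real^'d) \<times> (real^'d)" and k assume k: "int_vec k" and "\<Psi> p = \<Psi> p' + (k, 0)"
    then have "\<Psi> p = \<Psi> (p' + (k, 0))" by (simp add: \<Psi>_add_int)
    then show "\<exists>k'. int_vec k' \<and> p = p' + (k', 0)" using \<Psi>_inj k by blast
  qed
qed

end
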